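(* Consider the adaptive algorithm AFEM-PGMRES described in the context, run formally with $\tau<0$ so that the tolerance test never stops it. Suppose that the error estimator satisfies stability (A1), reduction (A2), and reliability (A3), and that the employed preconditioners satisfy the norm equivalence (PRE). Let $0<\theta\le 1$, $C_{\rm mark}\ge 1$, $u_0^0\in\mathcal X_0$, $\lambda_{\rm alg}>0$, $C_{\rm alg}>0$ (and $k_{\max}\in\mathbb N$) be arbitrary. Then there exist constants $0<q_{\rm lin}<1$ and $C_{\rm lin}>0$ such that the quasi-error $\mathsf H_\ell^k=\eta_\ell(u_\ell^k)+\|\mathbf s_\ell^k\|_{\mathbf P_\ell^{-1}}$ satisfies $$\mathsf H_\ell^k\le C_{\rm lin}\,q_{\rm lin}^{|\ell,k|-|\ell',k'|}\,\mathsf H_{\ell'}^{k'}\qquad\text{for all }(\ell',k'),(\ell,k)\in\mathcal Q\text{ with }|\ell',k'|\le|\ell,k|.$$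
   Context: **Model problem.** $\Omega\subset\mathbb R^d$ ($d\ge1$) is a polyhedral Lipschitz domain, $\mathcal X:=H^1_0(\Omega)$, $f\in L^2(\Omega)$, $\boldsymbol f\in[L^2(\Omega)]^d$, $\boldsymbol b\in[L^\infty(\Omega)]^d$ with $\operatorname{div}\boldsymbol b\in L^\infty(\Omega)$, $c\in L^\infty(\Omega)$, $-\operatorname{div}\boldsymbol b+2c\ge0$ a.e., and $\boldsymbol K\in[L^\infty(\Omega)]^{d\times d}$ symmetric with smallest eigenvalue uniformly bounded from below by a positive constant. Set $a(v,w):=\langle\boldsymbol K\nabla v,\nabla w\rangle_{L^2(\Omega)}$, $b(v,w):=a(v,w)+\langle\boldsymbol b\cdot\nabla v,w\rangle_{L^2(\Omega)}+\langle cv,w\rangle_{L^2(\Omega)}$, $F(v):=\langle f,v\rangle_{L^2(\Omega)}+\langle\boldsymbol f,\nabla v\rangle_{L^2(\Omega)}$, $|||v|||:=a(v,v)^{1/2}$. There are constants $0<C_{\rm ell}\le C_{\rm bnd}$ with $|b(v,w)|\le C_{\rm bnd}|||v|||\,|||w|||$ and $b(v,v)\ge C_{\rm ell}|||v|||^2$ on $\mathcal X$. The exact solution $u^\star\in\mathcal X$ satisfies $b(u^\star,v)=F(v)$ for all $v\in\mathcal X$. **Discretization.** $\mathcal T_0$ is a conforming simplicial triangulation of $\Omega$ (admissible for newest vertex bisection, NVB), and $\boldsymbol f|_T\in[H^1(T)]^d$, $\boldsymbol K|_T\in[W^{1,\infty}(T)]^{d\times d}$ for all $T\in\mathcal T_0$.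 $\mathbb T(\mathcal T_H)$ is the set of triangulations obtained from $\mathcal T_H$ by finitely many NVB steps; $\mathtt{refine}(\mathcal T_H,\mathcal M_H)$ is the coarsest NVB refinement of $\mathcal T_H$ in which all elements of $\mathcal M_H\subseteq\mathcal T_H$ are refined. For fixed $p\in\mathbb N$, $\mathcal X_H\subset H^1_0(\Omega)$ is the space of globally continuous $\mathcal T_H$-piecewise polynomials of degree $\le p$ vanishing on $\partial\Omega$. $u_H^\star\in\mathcal X_H$ is the Galerkin solution: $b(u_H^\star,v_H)=F(v_H)$ for all $v_H\in\mathcal X_H$. Index $\ell$ replaces $H$ for the mesh $\mathcal T_\ell$. **Estimator.** For $T\in\mathcal T_H$, $v_H\in\mathcal X_H$: $\eta_H(T,v_H)^2:=|T|^{2/d}\|\operatorname{div}(\boldsymbol K\nabla v_H-\boldsymbol f)-\boldsymbol b\cdot\nabla v_H-cv_H+f\|_{L^2(T)}^2+|T|^{1/d}\|[\![(\boldsymbol K\nabla v_H-\boldsymbol f)\cdot n]\!]\|^2_{L^2(\partial T\cap\Omega)}$, where $[\![\cdot]\!]$ is the jump over facets; $\eta_H(\mathcal U_H,v_H):=(\sum_{T\in\mathcal U_H}\eta_H(T,v_H)^2)^{1/2}$ for $\mathcal U_H\subseteq\mathcal T_H$, and $\eta_H(v_H):=\eta_H(\mathcal T_H,v_H)$. The axioms are, with constants $C_{\rm stab},C_{\rm rel}>0$, $0<q_{\rm red}<1$, for all $\mathcal T_H\in\mathbb T(\mathcal T_0)$, $\mathcal T_h\in\mathbb T(\mathcal T_H)$,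 $v_H\in\mathcal X_H$, $v_h\in\mathcal X_h$: (A1) $|\eta_h(\mathcal T_h\cap\mathcal T_H,v_h)-\eta_H(\mathcal T_h\cap\mathcal T_H,v_H)|\le C_{\rm stab}|||v_h-v_H|||$; (A2) $\eta_h(\mathcal T_h\setminus\mathcal T_H,v_H)\le q_{\rm red}\,\eta_H(\mathcal T_H\setminus\mathcal T_h,v_H)$; (A3) $|||u^\star-u_H^\star|||\le C_{\rm rel}\,\eta_H(u_H^\star)$. **Preconditioner.** Let $\varphi_{\ell,1},\dots,\varphi_{\ell,N_\ell}$ be a basis of $\mathcal X_\ell$, $(\mathbf B_\ell)_{jk}:=b(\varphi_{\ell,k},\varphi_{\ell,j})$, $(\mathbf d_\ell)_j:=F(\varphi_{\ell,j})$. $\mathbf P_\ell\in\mathbb R^{N_\ell\times N_\ell}$ is symmetric positive definite, $(\mathbf x,\mathbf y)_{\mathbf P_\ell^{-1}}:=(\mathbf P_\ell^{-1}\mathbf x,\mathbf y)_2$ with induced norm $\|\cdot\|_{\mathbf P_\ell^{-1}}$. (PRE): there is $C_{\rm pre}\ge1$, independent of $\ell$, the mesh size and $p$, with $C_{\rm pre}^{-1}|||v_\ell|||\le\|\mathbf x_\ell\|_{\mathbf P_\ell^{-1}}\le C_{\rm pre}|||v_\ell|||$ for all $v_\ell=\sum_j(\mathbf x_\ell)_j\varphi_{\ell,j}\in\mathcal X_\ell$. **PGMRES (preconditioned GMRES with restart length $k_{\max}\in\mathbb N$).** Given $\mathbf x_\ell^0$, iterates are defined for $k\ge1$ as follows: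 with $K:=((k-1)\bmod k_{\max})+1$ and $m:=k-K$ (the index of the last restart), $\mathbf x_\ell^k$ is the unique minimizer of $\|\mathbf P_\ell(\mathbf d_\ell-\mathbf B_\ell\mathbf x)\|_{\mathbf P_\ell^{-1}}$ over $\mathbf x\in\mathbf x_\ell^m+\operatorname{span}\{(\mathbf P_\ell\mathbf B_\ell)^i\mathbf s_\ell^m:0\le i<K\}$, where $\mathbf s_\ell^k:=\mathbf P_\ell(\mathbf d_\ell-\mathbf B_\ell\mathbf x_\ell^k)$ is the preconditioned residual. Write $u_\ell^k:=\sum_j(\mathbf x_\ell^k)_j\varphi_{\ell,j}$. **Algorithm AFEM-PGMRES.** Input: $\mathcal T_0$, $0<\theta\le1$, $C_{\rm mark}\ge1$, $u_0^0\in\mathcal X_0$, $C_{\rm alg},\lambda_{\rm alg}>0$, $k_{\max}\in\mathbb N$, tolerance $\tau$; set $\mathsf S:=0$. Write $\mathsf H_\ell^k:=\eta_\ell(u_\ell^k)+\|\mathbf s_\ell^k\|_{\mathbf P_\ell^{-1}}$. For $\ell=0,1,2,\dots$: (i) Starting from $u_\ell^0$, perform PGMRES steps $k=1,2,\dots$ until, for the first time, $\|\mathbf s_\ell^k\|_{\mathbf P_\ell^{-1}}\le\lambda_{\rm alg}\,\eta_\ell(u_\ell^k)$; set $\underline k[\ell]:=k$ (if this never happens, $\underline k[\ell]:=\infty$ and the algorithm iterates forever on level $\ell$). Write $\underline k=\underline k[\ell]$ in $u_\ell^{\underline k}$, $\mathsf H_\ell^{\underline k}$. (ii) If $\mathsf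 H_\ell^{\underline k}\le\tau$, stop. Otherwise: (a) if $\ell\ge1$ and $\mathsf S>C_{\rm alg}(\mathsf H_\ell^{\underline k})^{-1}$, replace $C_{\rm alg}$ by $2C_{\rm alg}$ and $\lambda_{\rm alg}$ by $\lambda_{\rm alg}/2$; (b) replace $\mathsf S$ by $\mathsf S+(\mathsf H_\ell^{\underline k})^{-1}$. (Convention $1/0=\infty$.) (iii) Choose $\mathcal M_\ell\subseteq\mathcal T_\ell$ with $\theta\eta_\ell(u_\ell^{\underline k})^2\le\eta_\ell(\mathcal M_\ell,u_\ell^{\underline k})^2$ and $\#\mathcal M_\ell\le C_{\rm mark}\min\{\#\mathcal U:\mathcal U\subseteq\mathcal T_\ell,\ \theta\eta_\ell(u_\ell^{\underline k})^2\le\eta_\ell(\mathcal U,u_\ell^{\underline k})^2\}$. (iv) $\mathcal T_{\ell+1}:=\mathtt{refine}(\mathcal T_\ell,\mathcal M_\ell)$, $u_{\ell+1}^0:=u_\ell^{\underline k}$. **Index set.** $\mathcal Q$ is the set of all $(\ell,k)\in\mathbb N_0^2$ such that $u_\ell^k$ appears in the algorithm, ordered by $(\ell',k')\le(\ell,k)$ iff $u_{\ell'}^{k'}$ is defined not later than $u_\ell^k$ (lexicographic order), and $|\ell,k|:=\#\{(\ell',k')\in\mathcal Q:(\ell',k')\le(\ell,k)\}$. *)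

theory Defs
  imports
    "Jordan_Normal_Form.Gauss_Jordan_Elimination"
    "HOL-Analysis.Analysis"
    "HOL-Library.Extended_Nat"
begin

(* Both libraries claim these symbols; here they denote the operations of HOL-Analysis,
   and the list-indexed versions are written vec_index and scalar_prod. *)
no_notation Matrix.vec_index (infixl "$" 100)
no_notation Matrix.scalar_prod (infix "\<bullet>" 70)

section \<open>Function spaces\<close>

definition grad :: "(real^'n \<Rightarrow> real) \<Rightarrow> real^'n \<Rightarrow> real^'n" where
  "grad \<phi> x = (\<chi> i. frechet_derivative \<phi> (at x) (axis i 1))"

primrec Ck :: "nat \<Rightarrow> (real^'n \<Rightarrow> real) \<Rightarrow> bool" where
  "Ck 0 \<phi> \<longleftrightarrow> continuous_on UNIV \<phi>"
| "Ck (Suc k) \<phi> \<longleftrightarrow> (\<forall>x. \<phi> differentiable (at x)) \<and> (\<forall>i. Ck k (\<lambda>x. grad \<phi> x $ i))"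

definition smooth :: "(real^'n \<Rightarrow> real) \<Rightarrow> bool" where
  "smooth \<phi> \<longleftrightarrow> (\<forall>k. Ck k \<phi>)"

definition test_functions :: "(real^'n) set \<Rightarrow> (real^'n \<Rightarrow> real) set" where
  "test_functions U =
     {\<phi>. smooth \<phi> \<and> compact (closure {x. \<phi> x \<noteq> 0}) \<and> closure {x. \<phi> x \<noteq> 0} \<subseteq> U}"

(* Functions are representatives of their almost-everywhere classes. *)
definition L2 :: "'a measure \<Rightarrow> ('a \<Rightarrow> 'b::euclidean_space) set" where
  "L2 M = {v \<in> borel_measurable M. integrable M (\<lambda>x. (norm (v x))\<^sup>2)}"

definition l2norm :: "'a measure \<Rightarrow> ('a \<Rightarrow> 'b::euclidean_space) \<Rightarrow> real" where
  "l2norm M v = sqrt (\<integral>x. (norm (v x))\<^sup>2 \<partial>M)"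

definition Linf :: "'a measure \<Rightarrow> ('a \<Rightarrow> 'b::euclidean_space) set" where
  "Linf M = {v \<in> borel_measurable M. \<exists>B. AE x in M. norm (v x) \<le> B}"

definition is_weak_grad ::
    "(real^'n) set \<Rightarrow> (real^'n \<Rightarrow> real) \<Rightarrow> (real^'n \<Rightarrow> real^'n) \<Rightarrow> bool" where
  "is_weak_grad U v G \<longleftrightarrow>
     (\<forall>\<phi>\<in>test_functions U.
        (\<integral>x. v x *\<^sub>R grad \<phi> x \<partial>lebesgue_on U) = - (\<integral>x. \<phi> x *\<^sub>R G x \<partial>lebesgue_on U))"

definition is_weak_div ::
    "(real^'n) set \<Rightarrow> (real^'n \<Rightarrow> real^'n) \<Rightarrow> (real^'n \<Rightarrow> real) \<Rightarrow> bool" where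
  "is_weak_div U w g \<longleftrightarrow>
     (\<forall>\<phi>\<in>test_functions U.
        (\<integral>x. w x \<bullet> grad \<phi> x \<partial>lebesgue_on U) = - (\<integral>x. g x * \<phi> x \<partial>lebesgue_on U))"

definition H1 :: "(real^'n) set \<Rightarrow> (real^'n \<Rightarrow> real) set" where
  "H1 U = {v \<in> L2 (lebesgue_on U). \<exists>G\<in>L2 (lebesgue_on U). is_weak_grad U v G}"

definition W1inf :: "(real^'n) set \<Rightarrow> (real^'n \<Rightarrow> real) set" where
  "W1inf U = {v \<in> Linf (lebesgue_on U). \<exists>G\<in>Linf (lebesgue_on U). is_weak_grad U v G}"

(* Weak derivatives are unique only up to null sets; the choice of representative is immaterial
   because they occur below under integrals only. *)
definition weak_grad :: "(real^'n) set \<Rightarrow> (real^'n \<Rightarrow> real) \<Rightarrow> real^'n \<Rightarrow> real^'n" where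
  "weak_grad U v = (SOME G. G \<in> L2 (lebesgue_on U) \<and> is_weak_grad U v G)"

definition weak_div :: "(real^'n) set \<Rightarrow> (real^'n \<Rightarrow> real^'n) \<Rightarrow> real^'n \<Rightarrow> real" where
  "weak_div U w = (SOME g. g \<in> L2 (lebesgue_on U) \<and> is_weak_div U w g)"

definition H1_tendsto ::
    "(real^'n) set \<Rightarrow> (nat \<Rightarrow> real^'n \<Rightarrow> real) \<Rightarrow> (real^'n \<Rightarrow> real) \<Rightarrow> bool" where
  "H1_tendsto U \<phi> v \<longleftrightarrow>
     (\<lambda>m. l2norm (lebesgue_on U) (\<lambda>x. \<phi> m x - v x)) \<longlonglongrightarrow> 0 \<and>
     (\<lambda>m. l2norm (lebesgue_on U) (\<lambda>x. grad (\<phi> m) x - weak_grad U v x)) \<longlonglongrightarrow> 0"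

definition H10 :: "(real^'n) set \<Rightarrow> (real^'n \<Rightarrow> real) set" where
  "H10 U = {v \<in> H1 U. \<exists>\<phi>. (\<forall>m. \<phi> m \<in> test_functions U) \<and> H1_tendsto U \<phi> v}"

section \<open>Domains\<close>

(* Near each boundary point the domain is the strict epigraph of a Lipschitz function over the
   hyperplane orthogonal to a unit vector e. *)
definition lipschitz_domain :: "(real^'n) set \<Rightarrow> bool" where
  "lipschitz_domain U \<longleftrightarrow>
     open U \<and> connected U \<and> bounded U \<and> U \<noteq> {} \<and>
     (\<forall>x\<in>frontier U. \<exists>r>0. \<exists>e \<gamma> L. norm e = 1 \<and> L-lipschitz_on {z. z \<bullet> e = 0} \<gamma> \<and>
        ball x r \<inter> U = {y \<in> ball x r. \<gamma> (y - (y \<bullet> e) *\<^sub>R e) < y \<bullet> e})"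

definition polyhedral_lipschitz_domain :: "(real^'n) set \<Rightarrow> bool" where
  "polyhedral_lipschitz_domain U \<longleftrightarrow>
     lipschitz_domain U \<and> (\<exists>\<P>. finite \<P> \<and> (\<forall>P\<in>\<P>. polytope P) \<and> closure U = \<Union>\<P>)"

section \<open>Triangulations and newest vertex bisection\<close>

(* A tagged simplex: the ordered vertices z_0, ..., z_d and a type in {0, ..., d-1}. Its refinement
   edge joins z_0 and z_d. This is the Maubach/Stevenson formulation of newest vertex bisection. *)
type_synonym 'n tsimplex = "(real^'n) list \<times> nat"

type_synonym 'n tmesh = "'n tsimplex set"

definition geo :: "'n::finite tsimplex \<Rightarrow> (real^'n) set" where
  "geo T = convex hull (set (fst T))"

definition valid_tsimplex :: "'n::finite tsimplex \<Rightarrow> bool" where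
  "valid_tsimplex T \<longleftrightarrow>
     length (fst T) = CARD('n) + 1 \<and> distinct (fst T) \<and>
     \<not> affine_dependent (set (fst T)) \<and> snd T < CARD('n)"

definition conforming :: "'n::finite tmesh \<Rightarrow> bool" where
  "conforming \<T> \<longleftrightarrow>
     finite \<T> \<and> (\<forall>T\<in>\<T>. valid_tsimplex T) \<and> inj_on geo \<T> \<and> triangulation (geo ` \<T>)"

definition triangulates :: "'n::finite tmesh \<Rightarrow> (real^'n) set \<Rightarrow> bool" where
  "triangulates \<T> U \<longleftrightarrow> conforming \<T> \<and> \<Union>(geo ` \<T>) = closure U"

(* The children of (z_0, ..., z_d) of type g, with m the midpoint of z_0 and z_d, are
   (z_0, m, z_1, ..., z_g, z_(g+1), ..., z_(d-1)) and (z_d, m, z_1, ..., z_g, z_(d-1), ..., z_(g+1)),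
   both of type (g + 1) mod d. *)
definition nvb_children :: "'n::finite tsimplex \<Rightarrow> 'n tmesh" where
  "nvb_children T =
     (let zs = fst T; g = snd T; m = midpoint (hd zs) (last zs);
          inner = butlast (tl zs); g' = (g + 1) mod CARD('n)
      in {(hd zs # m # take g inner @ drop g inner, g'),
          (last zs # m # take g inner @ rev (drop g inner), g')})"

definition bisect_step :: "'n::finite tmesh \<Rightarrow> 'n tmesh \<Rightarrow> bool" where
  "bisect_step \<T> \<T>' \<longleftrightarrow> (\<exists>T\<in>\<T>. \<T>' = (\<T> - {T}) \<union> nvb_children T)"

(* Intermediate partitions may have hanging nodes; the result may not. *)
definition nvb_refinements :: "'n::finite tmesh \<Rightarrow> 'n tmesh set" where
  "nvb_refinements \<T> = {\<T>'. bisect_step\<^sup>*\<^sup>* \<T> \<T>' \<and> conforming \<T>'}"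

definition is_coarsest_refinement :: "'n::finite tmesh \<Rightarrow> 'n tmesh \<Rightarrow> 'n tmesh \<Rightarrow> bool" where
  "is_coarsest_refinement \<T> \<M> \<T>' \<longleftrightarrow>
     \<T>' \<in> nvb_refinements \<T> \<and> \<M> \<inter> \<T>' = {} \<and>
     (\<forall>\<T>''\<in>nvb_refinements \<T>. \<M> \<inter> \<T>'' = {} \<longrightarrow> \<T>'' \<in> nvb_refinements \<T>')"

definition nvb_refine :: "'n::finite tmesh \<Rightarrow> 'n tmesh \<Rightarrow> 'n tmesh" where
  "nvb_refine \<T> \<M> = (THE \<T>'. is_coarsest_refinement \<T> \<M> \<T>')"

(* Admissibility of the initial tagging: refinement with conforming closure is well-defined on every
   mesh that can be reached. Stevenson's matching condition is sufficient for this; in dimensions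
   one and two every tagging has this property. *)
definition nvb_admissible :: "'n::finite tmesh \<Rightarrow> bool" where
  "nvb_admissible \<T>0 \<longleftrightarrow>
     (\<forall>\<T>\<in>nvb_refinements \<T>0. \<forall>\<M>\<subseteq>\<T>. \<exists>!\<T>'. is_coarsest_refinement \<T> \<M> \<T>')"

section \<open>The model problem\<close>

record ('n::finite) pde =
  dom :: "(real^'n) set"
  diffusion :: "real^'n \<Rightarrow> real^'n^'n"
  advection :: "real^'n \<Rightarrow> real^'n"
  reaction :: "real^'n \<Rightarrow> real"
  source :: "real^'n \<Rightarrow> real"
  flux :: "real^'n \<Rightarrow> real^'n"

definition energy_form :: "'n::finite pde \<Rightarrow> (real^'n \<Rightarrow> real) \<Rightarrow> (real^'n \<Rightarrow> real) \<Rightarrow> real" where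
  "energy_form D v w =
     (\<integral>x. (diffusion D x *v weak_grad (dom D) v x) \<bullet> weak_grad (dom D) w x \<partial>lebesgue_on (dom D))"

definition bform :: "'n::finite pde \<Rightarrow> (real^'n \<Rightarrow> real) \<Rightarrow> (real^'n \<Rightarrow> real) \<Rightarrow> real" where
  "bform D v w =
     energy_form D v w
     + (\<integral>x. (advection D x \<bullet> weak_grad (dom D) v x) * w x \<partial>lebesgue_on (dom D))
     + (\<integral>x. reaction D x * v x * w x \<partial>lebesgue_on (dom D))"

definition rhs :: "'n::finite pde \<Rightarrow> (real^'n \<Rightarrow> real) \<Rightarrow> real" where
  "rhs D v =
     (\<integral>x. source D x * v x \<partial>lebesgue_on (dom D))
     + (\<integral>x. flux D x \<bullet> weak_grad (dom D) v x \<partial>lebesgue_on (dom D))"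

definition enorm :: "'n::finite pde \<Rightarrow> (real^'n \<Rightarrow> real) \<Rightarrow> real" where
  "enorm D v = sqrt (energy_form D v v)"

definition uniformly_positive_diffusion :: "'n::finite pde \<Rightarrow> bool" where
  "uniformly_positive_diffusion D \<longleftrightarrow>
     (\<exists>\<kappa>>0. AE x in lebesgue_on (dom D).
        transpose (diffusion D x) = diffusion D x \<and>
        (\<forall>\<mu> w. w \<noteq> 0 \<and> diffusion D x *v w = \<mu> *\<^sub>R w \<longrightarrow> \<kappa> \<le> \<mu>))"

definition model_problem :: "'n::finite pde \<Rightarrow> bool" where
  "model_problem D \<longleftrightarrow>
     polyhedral_lipschitz_domain (dom D) \<and>
     source D \<in> L2 (lebesgue_on (dom D)) \<and>
     flux D \<in> L2 (lebesgue_on (dom D)) \<and>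
     advection D \<in> Linf (lebesgue_on (dom D)) \<and>
     reaction D \<in> Linf (lebesgue_on (dom D)) \<and>
     (\<exists>divb \<in> Linf (lebesgue_on (dom D)).
        is_weak_div (dom D) (advection D) divb \<and>
        (AE x in lebesgue_on (dom D). - divb x + 2 * reaction D x \<ge> 0)) \<and>
     diffusion D \<in> Linf (lebesgue_on (dom D)) \<and>
     uniformly_positive_diffusion D"

definition bounded_elliptic :: "'n::finite pde \<Rightarrow> real \<Rightarrow> real \<Rightarrow> bool" where
  "bounded_elliptic D Cell Cbnd \<longleftrightarrow>
     0 < Cell \<and> Cell \<le> Cbnd \<and>
     (\<forall>v\<in>H10 (dom D). \<forall>w\<in>H10 (dom D). \<bar>bform D v w\<bar> \<le> Cbnd * enorm D v * enorm D w) \<and>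
     (\<forall>v\<in>H10 (dom D). bform D v v \<ge> Cell * (enorm D v)\<^sup>2)"

definition piecewise_regular :: "'n::finite pde \<Rightarrow> 'n tmesh \<Rightarrow> bool" where
  "piecewise_regular D \<T>0 \<longleftrightarrow>
     (\<forall>T\<in>\<T>0. (\<forall>i. (\<lambda>x. flux D x $ i) \<in> H1 (interior (geo T))) \<and>
             (\<forall>i j. (\<lambda>x. diffusion D x $ i $ j) \<in> W1inf (interior (geo T))))"

(* Solutions of b(u, v) = F(v) in V: the exact solution for V = H10 (dom D), the Galerkin solution
   for a finite element space V. *)
definition solves_in :: "'n::finite pde \<Rightarrow> (real^'n \<Rightarrow> real) set \<Rightarrow> (real^'n \<Rightarrow> real) \<Rightarrow> bool" where
  "solves_in D V u \<longleftrightarrow> u \<in> V \<and> (\<forall>v\<in>V. bform D u v = rhs D v)"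

section \<open>Finite element spaces\<close>

definition polynomial_le :: "nat \<Rightarrow> (real^'n::finite \<Rightarrow> real) \<Rightarrow> bool" where
  "polynomial_le p q \<longleftrightarrow>
     (\<exists>a::('n \<Rightarrow> nat) \<Rightarrow> real. \<forall>x.
        q x = (\<Sum>\<alpha> | (\<Sum>i\<in>UNIV. \<alpha> i) \<le> p. a \<alpha> * (\<Prod>i\<in>UNIV. (x $ i) ^ \<alpha> i)))"

(* Members are extended by zero outside the domain, so that equality of functions on the domain is
   equality in HOL. *)
definition fe_space :: "'n::finite pde \<Rightarrow> nat \<Rightarrow> 'n tmesh \<Rightarrow> (real^'n \<Rightarrow> real) set" where
  "fe_space D p \<T> =
     {v \<in> H10 (dom D). continuous_on (closure (dom D)) v \<and> (\<forall>x. x \<notin> dom D \<longrightarrow> v x = 0) \<and>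
        (\<forall>T\<in>\<T>. \<exists>q. polynomial_le p q \<and> (\<forall>x\<in>geo T. v x = q x))}"

section \<open>The residual error estimator\<close>

definition facet_normal :: "(real^'n) set \<Rightarrow> real^'n" where
  "facet_normal E = (SOME \<nu>. norm \<nu> = 1 \<and> (\<forall>x\<in>E. \<forall>y\<in>E. \<nu> \<bullet> (x - y) = 0))"

(* Surface measure on a flat facet E: the surface measure of a subset A of E is the volume of the
   right cylinder of height one over A. In dimension one this is the unit point mass. *)
definition facet_measure :: "(real^'n) set \<Rightarrow> (real^'n) measure" where
  "facet_measure E =
     (let \<nu> = facet_normal E; z = (SOME z. z \<in> E)
      in distr (lebesgue_on {x + t *\<^sub>R \<nu> |x t. x \<in> E \<and> 0 \<le> t \<and> t \<le> 1}) borel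
           (\<lambda>y. y - ((y - z) \<bullet> \<nu>) *\<^sub>R \<nu>))"

(* The trace on E of an H1 function on U as limit of the traces of smooth approximations. *)
definition is_trace ::
    "(real^'n) set \<Rightarrow> (real^'n) set \<Rightarrow> (real^'n \<Rightarrow> real) \<Rightarrow> (real^'n \<Rightarrow> real) \<Rightarrow> bool" where
  "is_trace U E w g \<longleftrightarrow>
     w \<in> H1 U \<and> g \<in> L2 (facet_measure E) \<and>
     (\<exists>\<phi>. (\<forall>m. smooth (\<phi> m)) \<and> H1_tendsto U \<phi> w \<and>
        (\<lambda>m. l2norm (facet_measure E) (\<lambda>x. \<phi> m x - g x)) \<longlonglongrightarrow> 0)"

definition vtrace ::
    "(real^'n) set \<Rightarrow> (real^'n) set \<Rightarrow> (real^'n \<Rightarrow> real^'n) \<Rightarrow> real^'n \<Rightarrow> real^'n" where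
  "vtrace U E w x = (\<chi> i. (SOME g. is_trace U E (\<lambda>y. w y $ i) g) x)"

definition total_flux :: "'n::finite pde \<Rightarrow> (real^'n \<Rightarrow> real) \<Rightarrow> real^'n \<Rightarrow> real^'n" where
  "total_flux D v x = diffusion D x *v weak_grad (dom D) v x - flux D x"

definition volume_residual ::
    "'n::finite pde \<Rightarrow> 'n tsimplex \<Rightarrow> (real^'n \<Rightarrow> real) \<Rightarrow> real^'n \<Rightarrow> real" where
  "volume_residual D T v x =
     weak_div (interior (geo T)) (total_flux D v) x
     - advection D x \<bullet> weak_grad (dom D) v x - reaction D x * v x + source D x"

definition flux_jump ::
    "'n::finite pde \<Rightarrow> 'n tsimplex \<Rightarrow> 'n tsimplex \<Rightarrow> (real^'n \<Rightarrow> real) \<Rightarrow> real^'n \<Rightarrow> real" where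
  "flux_jump D T T' v x =
     (let E = geo T \<inter> geo T'
      in (vtrace (interior (geo T)) E (total_flux D v) x
          - vtrace (interior (geo T')) E (total_flux D v) x) \<bullet> facet_normal E)"

(* On a conforming mesh the part of the boundary of T inside the domain is, up to a null set, the
   union of the facets that T shares with other elements. *)
definition eta_elem :: "'n::finite pde \<Rightarrow> 'n tmesh \<Rightarrow> 'n tsimplex \<Rightarrow> (real^'n \<Rightarrow> real) \<Rightarrow> real" where
  "eta_elem D \<T> T v = sqrt (
     measure lebesgue (geo T) powr (2 / real CARD('n))
       * (l2norm (lebesgue_on (interior (geo T))) (volume_residual D T v))\<^sup>2
     + measure lebesgue (geo T) powr (1 / real CARD('n))
       * (\<Sum>T' | T' \<in> \<T> \<and> (geo T \<inter> geo T') facet_of geo T.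
            (l2norm (facet_measure (geo T \<inter> geo T')) (flux_jump D T T' v))\<^sup>2))"

definition eta :: "'n::finite pde \<Rightarrow> 'n tmesh \<Rightarrow> 'n tmesh \<Rightarrow> (real^'n \<Rightarrow> real) \<Rightarrow> real" where
  "eta D \<T> \<U> v = sqrt (\<Sum>T\<in>\<U>. (eta_elem D \<T> T v)\<^sup>2)"

definition stability :: "'n::finite pde \<Rightarrow> nat \<Rightarrow> 'n tmesh \<Rightarrow> real \<Rightarrow> bool" where
  "stability D p \<T>0 Cstab \<longleftrightarrow>
     (\<forall>\<T>H\<in>nvb_refinements \<T>0. \<forall>\<T>h\<in>nvb_refinements \<T>H.
      \<forall>vH\<in>fe_space D p \<T>H. \<forall>vh\<in>fe_space D p \<T>h.
        \<bar>eta D \<T>h (\<T>h \<inter> \<T>H) vh - eta D \<T>H (\<T>h \<inter> \<T>H) vH\<bar>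
          \<le> Cstab * enorm D (\<lambda>x. vh x - vH x))"

definition reduction :: "'n::finite pde \<Rightarrow> nat \<Rightarrow> 'n tmesh \<Rightarrow> real \<Rightarrow> bool" where
  "reduction D p \<T>0 qred \<longleftrightarrow>
     (\<forall>\<T>H\<in>nvb_refinements \<T>0. \<forall>\<T>h\<in>nvb_refinements \<T>H. \<forall>vH\<in>fe_space D p \<T>H.
        eta D \<T>h (\<T>h - \<T>H) vH \<le> qred * eta D \<T>H (\<T>H - \<T>h) vH)"

definition reliability ::
    "'n::finite pde \<Rightarrow> nat \<Rightarrow> 'n tmesh \<Rightarrow> (real^'n \<Rightarrow> real) \<Rightarrow> real \<Rightarrow> bool" where
  "reliability D p \<T>0 ustar Crel \<longleftrightarrow>
     (\<forall>\<T>H\<in>nvb_refinements \<T>0. \<forall>uH. solves_in D (fe_space D p \<T>H) uH \<longrightarrow>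
        enorm D (\<lambda>x. ustar x - uH x) \<le> Crel * eta D \<T>H \<T>H uH)"

section \<open>Linear systems and preconditioned GMRES\<close>

definition fe_fun :: "nat \<Rightarrow> (nat \<Rightarrow> real^'n \<Rightarrow> real) \<Rightarrow> real Matrix.vec \<Rightarrow> real^'n \<Rightarrow> real" where
  "fe_fun N \<phi> x = (\<lambda>y. \<Sum>j<N. vec_index x j * \<phi> j y)"

definition is_basis :: "nat \<Rightarrow> (nat \<Rightarrow> real^'n \<Rightarrow> real) \<Rightarrow> (real^'n \<Rightarrow> real) set \<Rightarrow> bool" where
  "is_basis N \<phi> V \<longleftrightarrow>
     (\<forall>j<N. \<phi> j \<in> V) \<and> (\<forall>v\<in>V. \<exists>!x. x \<in> carrier_vec N \<and> v = fe_fun N \<phi> x)"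

definition galerkin_matrix ::
    "'n::finite pde \<Rightarrow> nat \<Rightarrow> (nat \<Rightarrow> real^'n \<Rightarrow> real) \<Rightarrow> real Matrix.mat" where
  "galerkin_matrix D N \<phi> = Matrix.mat N N (\<lambda>(j, k). bform D (\<phi> k) (\<phi> j))"

definition load_vector ::
    "'n::finite pde \<Rightarrow> nat \<Rightarrow> (nat \<Rightarrow> real^'n \<Rightarrow> real) \<Rightarrow> real Matrix.vec" where
  "load_vector D N \<phi> = Matrix.vec N (\<lambda>j. rhs D (\<phi> j))"

definition spd :: "nat \<Rightarrow> real Matrix.mat \<Rightarrow> bool" where
  "spd N P \<longleftrightarrow>
     P \<in> carrier_mat N N \<and> transpose_mat P = P \<and>
     (\<forall>x\<in>carrier_vec N. x \<noteq> 0\<^sub>v N \<longrightarrow> scalar_prod (P *\<^sub>v x) x > 0)"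

definition pnorm :: "real Matrix.mat \<Rightarrow> real Matrix.vec \<Rightarrow> real" where
  "pnorm P x = sqrt (scalar_prod (the (mat_inverse P) *\<^sub>v x) x)"

definition prec_residual ::
    "real Matrix.mat \<Rightarrow> real Matrix.mat \<Rightarrow> real Matrix.vec \<Rightarrow> real Matrix.vec \<Rightarrow> real Matrix.vec" where
  "prec_residual P B d x = P *\<^sub>v (d - B *\<^sub>v x)"

(* The span of the Krylov vectors is written as the column space of the matrix they form. *)
definition krylov_space ::
    "nat \<Rightarrow> real Matrix.mat \<Rightarrow> real Matrix.vec \<Rightarrow> nat \<Rightarrow> real Matrix.vec set" where
  "krylov_space N A s K =
     {mat_of_cols N (map (\<lambda>i. (A ^\<^sub>m i) *\<^sub>v s) [0..<K]) *\<^sub>v c |c. c \<in> carrier_vec K}"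

definition pgmres_step ::
    "nat \<Rightarrow> real Matrix.mat \<Rightarrow> real Matrix.mat \<Rightarrow> real Matrix.vec \<Rightarrow> nat \<Rightarrow> (nat \<Rightarrow> real Matrix.vec)
      \<Rightarrow> nat \<Rightarrow> bool" where
  "pgmres_step N P B d kmax x k \<longleftrightarrow>
     (let K = (k - 1) mod kmax + 1; m = k - K
      in is_arg_min (\<lambda>y. pnorm P (prec_residual P B d y))
           (\<lambda>y. y \<in> {x m + z |z. z \<in> krylov_space N (P * B) (prec_residual P B d (x m)) K})
           (x k))"

section \<open>The adaptive algorithm\<close>

(* The data produced by the algorithm. coeff r l k is the coefficient vector of the k-th iterate on
   level l; lam, calg and inv_sum hold the values of the three adapted quantities at the beginning
   of level l. Entries for levels or iterates that are never reached are irrelevant. *)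
record ('n::finite) afem_run =
  mesh :: "nat \<Rightarrow> 'n tmesh"
  marked :: "nat \<Rightarrow> 'n tmesh"
  ndof :: "nat \<Rightarrow> nat"
  basis_fun :: "nat \<Rightarrow> nat \<Rightarrow> real^'n \<Rightarrow> real"
  precond :: "nat \<Rightarrow> real Matrix.mat"
  coeff :: "nat \<Rightarrow> nat \<Rightarrow> real Matrix.vec"
  kstop :: "nat \<Rightarrow> enat"
  lam :: "nat \<Rightarrow> real"
  calg :: "nat \<Rightarrow> real"
  inv_sum :: "nat \<Rightarrow> ennreal"

definition iterate :: "'n::finite afem_run \<Rightarrow> nat \<Rightarrow> nat \<Rightarrow> real^'n \<Rightarrow> real" where
  "iterate r l k = fe_fun (ndof r l) (basis_fun r l) (coeff r l k)"

definition alg_err :: "'n::finite pde \<Rightarrow> 'n afem_run \<Rightarrow> nat \<Rightarrow> nat \<Rightarrow> real" where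
  "alg_err D r l k =
     pnorm (precond r l)
       (prec_residual (precond r l) (galerkin_matrix D (ndof r l) (basis_fun r l))
         (load_vector D (ndof r l) (basis_fun r l)) (coeff r l k))"

definition est :: "'n::finite pde \<Rightarrow> 'n afem_run \<Rightarrow> nat \<Rightarrow> nat \<Rightarrow> real" where
  "est D r l k = eta D (mesh r l) (mesh r l) (iterate r l k)"

definition quasi_error :: "'n::finite pde \<Rightarrow> 'n afem_run \<Rightarrow> nat \<Rightarrow> nat \<Rightarrow> real" where
  "quasi_error D r l k = est D r l k + alg_err D r l k"

definition level_finishes :: "'n::finite pde \<Rightarrow> real \<Rightarrow> 'n afem_run \<Rightarrow> nat \<Rightarrow> bool" where
  "level_finishes D \<tau> r l \<longleftrightarrow>
     kstop r l \<noteq> \<infinity> \<and> \<not> quasi_error D r l (the_enat (kstop r l)) \<le> \<tau>"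

definition reached :: "'n::finite pde \<Rightarrow> real \<Rightarrow> 'n afem_run \<Rightarrow> nat \<Rightarrow> bool" where
  "reached D \<tau> r l \<longleftrightarrow> (\<forall>j<l. level_finishes D \<tau> r j)"

definition solve_level :: "'n::finite pde \<Rightarrow> nat \<Rightarrow> nat \<Rightarrow> 'n afem_run \<Rightarrow> nat \<Rightarrow> bool" where
  "solve_level D p kmax r l \<longleftrightarrow>
     is_basis (ndof r l) (basis_fun r l) (fe_space D p (mesh r l)) \<and>
     spd (ndof r l) (precond r l) \<and>
     coeff r l 0 \<in> carrier_vec (ndof r l) \<and>
     (\<forall>k\<ge>1. enat k \<le> kstop r l \<longrightarrow>
        pgmres_step (ndof r l) (precond r l) (galerkin_matrix D (ndof r l) (basis_fun r l))
          (load_vector D (ndof r l) (basis_fun r l)) kmax (coeff r l) k) \<and>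
     (\<forall>k\<ge>1. enat k < kstop r l \<longrightarrow> \<not> alg_err D r l k \<le> lam r l * est D r l k) \<and>
     (\<forall>k. kstop r l = enat k \<longrightarrow> 1 \<le> k \<and> alg_err D r l k \<le> lam r l * est D r l k)"

definition update_params :: "'n::finite pde \<Rightarrow> 'n afem_run \<Rightarrow> nat \<Rightarrow> bool" where
  "update_params D r l \<longleftrightarrow>
     (let h = inverse (ennreal (quasi_error D r l (the_enat (kstop r l))));
          adapt = (l \<ge> 1 \<and> inv_sum r l > ennreal (calg r l) * h)
      in calg r (Suc l) = (if adapt then 2 * calg r l else calg r l) \<and>
         lam r (Suc l) = (if adapt then lam r l / 2 else lam r l) \<and>
         inv_sum r (Suc l) = inv_sum r l + h)"

definition doerfler_sets :: "'n::finite pde \<Rightarrow> real \<Rightarrow> 'n tmesh \<Rightarrow> (real^'n \<Rightarrow> real) \<Rightarrow> 'n tmesh set" where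
  "doerfler_sets D \<theta> \<T> v = {\<U>. \<U> \<subseteq> \<T> \<and> \<theta> * (eta D \<T> \<T> v)\<^sup>2 \<le> (eta D \<T> \<U> v)\<^sup>2}"

definition mark_refine :: "'n::finite pde \<Rightarrow> real \<Rightarrow> real \<Rightarrow> 'n afem_run \<Rightarrow> nat \<Rightarrow> bool" where
  "mark_refine D \<theta> Cmark r l \<longleftrightarrow>
     (let v = iterate r l (the_enat (kstop r l)); \<D> = doerfler_sets D \<theta> (mesh r l) v
      in marked r l \<in> \<D> \<and>
         real (card (marked r l)) \<le> Cmark * real (Min (card ` \<D>)) \<and>
         mesh r (Suc l) = nvb_refine (mesh r l) (marked r l) \<and>
         iterate r (Suc l) 0 = v)"

definition afem_pgmres ::
    "'n::finite pde \<Rightarrow> nat \<Rightarrow> 'n tmesh \<Rightarrow> real \<Rightarrow> real \<Rightarrow> (real^'n \<Rightarrow> real) \<Rightarrow> real \<Rightarrow> real \<Rightarrow> nat \<Rightarrow> real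
      \<Rightarrow> 'n afem_run \<Rightarrow> bool" where
  "afem_pgmres D p \<T>0 \<theta> Cmark u00 Calg lamalg kmax \<tau> r \<longleftrightarrow>
     mesh r 0 = \<T>0 \<and> iterate r 0 0 = u00 \<and>
     calg r 0 = Calg \<and> lam r 0 = lamalg \<and> inv_sum r 0 = 0 \<and>
     (\<forall>l. reached D \<tau> r l \<longrightarrow>
        solve_level D p kmax r l \<and>
        (level_finishes D \<tau> r l \<longrightarrow> update_params D r l \<and> mark_refine D \<theta> Cmark r l))"

definition norm_equivalence :: "'n::finite pde \<Rightarrow> real \<Rightarrow> 'n afem_run \<Rightarrow> real \<Rightarrow> bool" where
  "norm_equivalence D \<tau> r Cpre \<longleftrightarrow>
     (\<forall>l. reached D \<tau> r l \<longrightarrow>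
        (\<forall>x\<in>carrier_vec (ndof r l).
           inverse Cpre * enorm D (fe_fun (ndof r l) (basis_fun r l) x) \<le> pnorm (precond r l) x \<and>
           pnorm (precond r l) x \<le> Cpre * enorm D (fe_fun (ndof r l) (basis_fun r l) x)))"

definition index_set :: "'n::finite pde \<Rightarrow> real \<Rightarrow> 'n afem_run \<Rightarrow> (nat \<times> nat) set" where
  "index_set D \<tau> r = {(l, k). reached D \<tau> r l \<and> enat k \<le> kstop r l}"

definition step_count :: "'n::finite pde \<Rightarrow> real \<Rightarrow> 'n afem_run \<Rightarrow> nat \<Rightarrow> nat \<Rightarrow> nat" where
  "step_count D \<tau> r l k =
     card {(l', k'). (l', k') \<in> index_set D \<tau> r \<and> (l' < l \<or> l' = l \<and> k' \<le> k)}"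

end

theory Submission
  imports Defs "Jordan_Normal_Form.Determinant"
begin

text \<open>The increments of Galerkin solutions on nested spaces are quasi-orthogonal: their squares over
  \<open>n\<close> levels sum up to \<open>o(n)\<close> times the squared initial error. For a coercive nonsymmetric form
  this follows by pairing the increments with a biorthogonal system, whose sums are estimated by
  repeated bisection and the parallelogram law. With estimator reduction and reliability it yields
  R-linear decay of the quasi-error over the levels, provided \<open>lam\<close> is small.

  If the parameters were adapted infinitely often, \<open>lam\<close> would become small; the resulting decay
  bounds the sum of the inverse quasi-errors of all previous levels by a fixed multiple of the current
  inverse quasi-error, which contradicts further adaptations. Hence eventually no adaptation takes
  place, and this alone means that the sums of the inverse quasi-errors grow geometrically, i.e. that
  the quasi-error decays R-linearly over the levels, however large the final \<open>lam\<close> is.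

  Within a level, every restart cycle of GMRES contracts the preconditioned residual, which before the
  last step dominates the estimator. Together, the two decays bound the tail sums of the quasi-error
  along the index set by its current value, which is equivalent to linear convergence.\<close>

(* Both imports bring in these symbols again; here they denote the operations of HOL-Analysis. *)
no_notation Matrix.vec_index (infixl "$" 100)
no_notation Matrix.scalar_prod (infix "\<bullet>" 70)

section \<open>Test functions and uniqueness of weak gradients\<close>

text \<open>\<open>weak_grad\<close> is a choice among almost everywhere equal representatives, so
  even the bilinearity of \<open>bform\<close> rests on uniqueness of weak gradients, hence on the
  fundamental lemma of the calculus of variations. Errors are measured by
  \<open>N v = sqrt (b v v)\<close> instead of the energy norm: the parallelogram law holds on the
  diagonal of every bilinear form, symmetric or not, and one constant \<kappa> bounds
  \<open>b\<close> against \<open>N\<close>. If \<open>b v w = 0\<close> in just this order, the law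
  bounds the square of a sum by \<sigma> < 2 times the sum of squares. Bisecting
  \<open>2 ^ m\<close> vectors \<open>m\<close> times then costs \<open>(2 * \<sigma>) ^ m\<close>
  for the square, against \<open>4 ^ m\<close> from the triangle inequality, and the root of this is
  \<open>o(2 ^ m)\<close>. Over a long block the mean square of the increments is therefore small
  against the initial estimator, which halves the estimator. The value at which \<open>lam\<close>
  settles is known only after the run, so the constants are extracted from the run. The solver may
  iterate forever on one level, so the number of levels may be finite; an enumeration of the index
  set covers both cases.\<close>

lemma grad_eq:
  assumes "(\<phi> has_derivative \<phi>') (at x)"
  shows "grad \<phi> x = (\<chi> i. \<phi>' (axis i 1))"
  unfolding grad_def using frechet_derivative_at[OF assms] by simp

lemma grad_linear:
  assumes "\<phi> differentiable (at x)" "\<psi> differentiable (at x)"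
  shows "grad (\<lambda>x. \<alpha> * \<phi> x + \<beta> * \<psi> x) x = \<alpha> *\<^sub>R grad \<phi> x + \<beta> *\<^sub>R grad \<psi> x"
proof -
  obtain \<phi>' \<psi>' where d: "(\<phi> has_derivative \<phi>') (at x)" "(\<psi> has_derivative \<psi>') (at x)"
    using assms unfolding differentiable_def by blast
  have "((\<lambda>x. \<alpha> * \<phi> x + \<beta> * \<psi> x) has_derivative (\<lambda>h. \<alpha> * \<phi>' h + \<beta> * \<psi>' h)) (at x)"
    by (auto intro!: derivative_eq_intros d)
  from grad_eq[OF this] grad_eq[OF d(1)] grad_eq[OF d(2)] show ?thesis
    by (simp add: vec_eq_iff)
qed

lemma grad_mult:
  assumes "\<phi> differentiable (at x)" "\<psi> differentiable (at x)"
  shows "grad (\<lambda>x. \<phi> x * \<psi> x) x = \<phi> x *\<^sub>R grad \<psi> x + \<psi> x *\<^sub>R grad \<phi> x"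
proof -
  obtain \<phi>' \<psi>' where d: "(\<phi> has_derivative \<phi>') (at x)" "(\<psi> has_derivative \<psi>') (at x)"
    using assms unfolding differentiable_def by blast
  have "((\<lambda>x. \<phi> x * \<psi> x) has_derivative (\<lambda>h. \<phi> x * \<psi>' h + \<phi>' h * \<psi> x)) (at x)"
    by (auto intro!: derivative_eq_intros d)
  from grad_eq[OF this] grad_eq[OF d(1)] grad_eq[OF d(2)] show ?thesis
    by (simp add: vec_eq_iff)
qed

section \<open>Closure properties of smooth functions\<close>

lemma Ck_SucD: "Ck (Suc k) \<phi> \<Longrightarrow> Ck k \<phi>"
proof (induction k arbitrary: \<phi>)
  case 0
  then show ?case
    by (auto simp: continuous_at_imp_continuous_on differentiable_imp_continuous_within)
qed auto

lemma Ck_const: "Ck k (\<lambda>x::real^'n. c)"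
proof (induction k arbitrary: c)
  case (Suc k)
  have "grad (\<lambda>x. c) x = 0" for x :: "real^'n"
    using grad_eq[OF has_derivative_const, of c x] by (simp add: vec_eq_iff)
  then have "(\<lambda>x::real^'n. grad (\<lambda>x. c) x $ i) = (\<lambda>x. 0)" for i by auto
  with Suc show ?case by simp
qed simp

lemma Ck_linear:
  assumes "Ck k \<phi>" "Ck k \<psi>"
  shows "Ck k (\<lambda>x. \<alpha> * \<phi> x + \<beta> * \<psi> x)"
  using assms
proof (induction k arbitrary: \<phi> \<psi>)
  case 0
  then show ?case by (auto intro!: continuous_intros)
next
  case (Suc k)
  have d: "\<phi> differentiable (at x)" "\<psi> differentiable (at x)" for x
    using Suc.prems by auto
  have "Ck k (\<lambda>x. \<alpha> * grad \<phi> x $ i + \<beta> * grad \<psi> x $ i)" for i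
    using Suc by auto
  moreover have "(\<lambda>x. \<alpha> * \<phi> x + \<beta> * \<psi> x) differentiable (at x)" for x
    by (intro derivative_intros d)
  ultimately show ?case using d by (simp add: grad_linear)
qed

lemma Ck_mult:
  assumes "Ck k \<phi>" "Ck k \<psi>"
  shows "Ck k (\<lambda>x. \<phi> x * \<psi> x)"
  using assms
proof (induction k arbitrary: \<phi> \<psi>)
  case 0
  then show ?case by (auto intro!: continuous_intros)
next
  case (Suc k)
  have d: "\<phi> differentiable (at x)" "\<psi> differentiable (at x)" for x
    using Suc.prems by auto
  have "Ck k (\<lambda>x. 1 * (\<phi> x * grad \<psi> x $ i) + 1 * (\<psi> x * grad \<phi> x $ i))" for i
    by (intro Ck_linear Suc.IH) (use Suc.prems Ck_SucD in auto)
  moreover have "(\<lambda>x. \<phi> x * \<psi> x) differentiable (at x)" for x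
    by (intro derivative_intros d)
  ultimately show ?case using d by (simp add: grad_mult)
qed

lemma smooth_differentiable: "smooth \<phi> \<Longrightarrow> \<phi> differentiable (at x)"
  unfolding smooth_def by (metis Ck.simps(2))

lemma smooth_continuous: "smooth \<phi> \<Longrightarrow> continuous_on UNIV \<phi>"
  unfolding smooth_def by (metis Ck.simps(1))

lemma smooth_continuous_grad:
  assumes "smooth \<phi>" shows "continuous_on UNIV (grad \<phi>)"
proof -
  have "Ck (Suc 0) \<phi>" using assms unfolding smooth_def by blast
  then have "continuous_on UNIV (\<lambda>x. grad \<phi> x $ i)" for i by simp
  then have "continuous_on UNIV (\<lambda>x. \<chi> i. grad \<phi> x $ i)" by (rule continuous_on_vec_lambda)
  then show ?thesis by simp
qed

lemma smooth_linear:
  assumes "smooth \<phi>" "smooth \<psi>"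
  shows "smooth (\<lambda>x. \<alpha> * \<phi> x + \<beta> * \<psi> x)"
  unfolding smooth_def
proof
  fix k show "Ck k (\<lambda>x. \<alpha> * \<phi> x + \<beta> * \<psi> x)"
    by (rule Ck_linear) (use assms[unfolded smooth_def] in \<open>simp_all only: \<close>)
qed

lemma smooth_mult: "smooth \<phi> \<Longrightarrow> smooth \<psi> \<Longrightarrow> smooth (\<lambda>x. \<phi> x * \<psi> x)"
  unfolding smooth_def by (intro allI Ck_mult[of _ \<phi> \<psi>]) simp_all

lemma smooth_prod:
  assumes "finite A" "\<And>i. i \<in> A \<Longrightarrow> smooth (\<phi> i)"
  shows "smooth (\<lambda>x. \<Prod>i\<in>A. \<phi> i x)"
  using assms
proof (induction A rule: finite_induct)
  case empty
  then show ?case by (simp add: smooth_def Ck_const)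
next
  case (insert a A)
  then show ?case by (simp add: smooth_mult)
qed

section \<open>Smooth bump functions on boxes\<close>

text \<open>The powers of \<open>1 / t\<close> make the family closed under differentiation, so that
  smoothness follows by an induction over all \<open>n\<close> at once. \<epsilon> stays free
  because letting it tend to 0 turns \<open>bump \<epsilon> 0\<close> into the indicator of the
  positive half-line.\<close>

definition bump :: "real \<Rightarrow> nat \<Rightarrow> real \<Rightarrow> real" where
  "bump \<epsilon> n t = (if t > 0 then exp (- \<epsilon> / t) / t ^ n else 0)"

lemma bump_has_derivative:
  assumes "\<epsilon> > 0"
  shows "(bump \<epsilon> n has_real_derivative \<epsilon> * bump \<epsilon> (n + 2) t - real n * bump \<epsilon> (n + 1) t) (at t)"
proof -
  consider "t > 0" | "t < 0" | "t = 0" by linarith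
  then show ?thesis
  proof cases
    case 1
    have "((\<lambda>t. exp (- \<epsilon> / t) / t ^ n) has_real_derivative
        (exp (- \<epsilon> / t) * (\<epsilon> / (t * t)) * t ^ n - exp (- \<epsilon> / t) * (n * t ^ (n - 1))) / (t ^ n * t ^ n)) (at t)"
      using 1 by (auto intro!: derivative_eq_intros)
    also have "(exp (- \<epsilon> / t) * (\<epsilon> / (t * t)) * t ^ n - exp (- \<epsilon> / t) * (n * t ^ (n - 1))) / (t ^ n * t ^ n)
       = \<epsilon> * bump \<epsilon> (n + 2) t - real n * bump \<epsilon> (n + 1) t"
      using 1 by (cases n) (simp_all add: bump_def field_simps)
    finally show ?thesis
      by (rule has_field_derivative_transform_within_open[where S="{0<..}"]) (use 1 in \<open>auto simp: bump_def\<close>)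
  next
    case 2
    have "((\<lambda>t. 0) has_real_derivative 0) (at t)" by simp
    then have "(bump \<epsilon> n has_real_derivative 0) (at t)"
      by (rule has_field_derivative_transform_within_open[where S="{..<0}"]) (use 2 in \<open>auto simp: bump_def\<close>)
    with 2 show ?thesis by (simp add: bump_def)
  next
    case 3
    have pos: "((\<lambda>h. bump \<epsilon> n h / h) \<longlongrightarrow> 0) (at_right 0)"
    proof -
      \<comment> \<open>With \<open>y = \<epsilon> / h\<close> the difference quotient at 0 is
        \<open>y ^ (n + 1) * exp (- y) / \<epsilon> ^ (n + 1)\<close>, which vanishes as
        \<open>y\<close> tends to infinity.\<close>
      have "((\<lambda>y. (y ^ (n + 1) / exp y) / \<epsilon> ^ (n + 1)) \<longlongrightarrow> 0 / \<epsilon> ^ (n + 1)) at_top"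
        by (intro tendsto_divide tendsto_power_div_exp_0 tendsto_const) (use assms in simp)
      moreover have "filterlim (\<lambda>h. \<epsilon> / h) at_top (at_right 0)"
        unfolding divide_inverse
        by (rule filterlim_tendsto_pos_mult_at_top[OF tendsto_const assms filterlim_inverse_at_top_right])
      ultimately have "((\<lambda>h. ((\<epsilon> / h) ^ (n + 1) / exp (\<epsilon> / h)) / \<epsilon> ^ (n + 1)) \<longlongrightarrow> 0) (at_right 0)"
        by (auto dest: filterlim_compose simp del: power_Suc)
      moreover have "\<forall>\<^sub>F h in at_right 0. ((\<epsilon> / h) ^ (n + 1) / exp (\<epsilon> / h)) / \<epsilon> ^ (n + 1) = bump \<epsilon> n h / h"
        using assms by (auto simp: eventually_at_right_less bump_def exp_minus field_simps
            intro!: eventually_mono[OF eventually_at_right_less])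
      ultimately show ?thesis by (rule Lim_transform_eventually)
    qed
    have neg: "((\<lambda>h. bump \<epsilon> n h / h) \<longlongrightarrow> 0) (at_left 0)"
      by (rule Lim_transform_eventually[OF tendsto_const])
         (auto simp: bump_def eventually_at_left_field intro!: exI[of _ "-1"])
    have "((\<lambda>h. bump \<epsilon> n h / h) \<longlongrightarrow> 0) (at 0)"
      using pos neg by (simp add: filterlim_at_split)
    then have "(bump \<epsilon> n has_real_derivative 0) (at 0)"
      by (simp add: has_field_derivative_iff bump_def)
    with 3 show ?thesis by (simp add: bump_def)
  qed
qed

lemma smooth_bump:
  assumes "\<epsilon> > 0"
  shows "smooth (\<lambda>x::real^'n. bump \<epsilon> n (s * (x $ i) + c))"
proof -
  have "Ck k (\<lambda>x::real^'n. bump \<epsilon> n (s * (x $ i) + c))" for k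
  proof (induction k arbitrary: n)
    case 0
    have "continuous_on UNIV (bump \<epsilon> n)"
      using DERIV_isCont[OF bump_has_derivative[OF assms]] continuous_at_imp_continuous_on by blast
    then show ?case
      by (auto intro!: continuous_on_compose2[of UNIV "bump \<epsilon> n"] continuous_intros)
  next
    case (Suc k)
    let ?D = "\<lambda>t. \<epsilon> * bump \<epsilon> (n + 2) t - real n * bump \<epsilon> (n + 1) t"
    have d: "((\<lambda>x. bump \<epsilon> n (s * (x $ i) + c)) has_derivative (\<lambda>h. ?D (s * (x $ i) + c) * (s * (h $ i)))) (at x)"
      for x :: "real^'n"
    proof -
      have "((\<lambda>x::real^'n. s * (x $ i) + c) has_derivative (\<lambda>h. s * (h $ i))) (at x)"
        by (auto intro!: derivative_eq_intros bounded_linear.has_derivative[OF bounded_linear_vec_nth])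
      from diff_chain_at[OF this, of "bump \<epsilon> n"] show ?thesis
        using bump_has_derivative[OF assms, of n "s * (x $ i) + c"]
        by (simp add: has_field_derivative_def o_def)
    qed
    have g: "grad (\<lambda>x. bump \<epsilon> n (s * (x $ i) + c)) x $ j =
        (if j = i then s * \<epsilon> else 0) * bump \<epsilon> (n + 2) (s * (x $ i) + c)
        + (if j = i then - s * real n else 0) * bump \<epsilon> (n + 1) (s * (x $ i) + c)" for x :: "real^'n" and j
      using grad_eq[OF d, of x] by (simp add: axis_def algebra_simps)
    have "(\<lambda>x::real^'n. bump \<epsilon> n (s * (x $ i) + c)) differentiable (at x)" for x
      using d unfolding differentiable_def by blast
    then show ?case
      unfolding Ck.simps g using Ck_linear[OF Suc Suc] by blast
  qed
  then show ?thesis by (simp add: smooth_def)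
qed

text \<open>Nonzero exactly on the open box, bounded by 1 and convergent to its indicator as
  \<epsilon> tends to 0: test functions can thus replace indicators of boxes under the
  integral.\<close>

definition box_bump :: "real \<Rightarrow> real^'n \<Rightarrow> real^'n \<Rightarrow> real^'n \<Rightarrow> real" where
  "box_bump \<epsilon> a b x = (\<Prod>i\<in>UNIV. bump \<epsilon> 0 (x $ i - a $ i) * bump \<epsilon> 0 (b $ i - x $ i))"

lemma smooth_box_bump:
  assumes "\<epsilon> > 0"
  shows "smooth (box_bump \<epsilon> a b)"
proof -
  have "smooth (\<lambda>x. bump \<epsilon> 0 (x $ i - a $ i))" for i
    using smooth_bump[OF assms, of 0 1 i "- (a $ i)"] by simp
  moreover have "smooth (\<lambda>x. bump \<epsilon> 0 (b $ i - x $ i))" for i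
    using smooth_bump[OF assms, of 0 "-1" i "b $ i"] by simp
  ultimately show ?thesis
    unfolding box_bump_def[abs_def] by (intro smooth_prod smooth_mult finite)
qed

lemma box_bump_nonzero: "box_bump \<epsilon> a b x \<noteq> 0 \<longleftrightarrow> x \<in> box a b"
  by (auto simp: box_bump_def bump_def mem_box_cart)

lemma box_bump_bounded: "\<epsilon> > 0 \<Longrightarrow> norm (box_bump \<epsilon> a b x) \<le> 1"
proof -
  assume e: "\<epsilon> > 0"
  have "0 \<le> bump \<epsilon> 0 t \<and> bump \<epsilon> 0 t \<le> 1" for t
    using e by (auto simp: bump_def)
  then have "0 \<le> bump \<epsilon> 0 s * bump \<epsilon> 0 t \<and> bump \<epsilon> 0 s * bump \<epsilon> 0 t \<le> 1" for s t
    by (simp add: mult_le_one)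
  then show ?thesis unfolding box_bump_def
    by (simp add: prod_nonneg prod_le_1)
qed

lemma box_bump_test_function:
  assumes "\<epsilon> > 0" "cbox a b \<subseteq> U"
  shows "box_bump \<epsilon> a b \<in> test_functions U"
proof -
  have "closure {x. box_bump \<epsilon> a b x \<noteq> 0} \<subseteq> cbox a b"
    using closure_minimal[OF box_subset_cbox[of a b] closed_cbox] by (simp add: box_bump_nonzero)
  moreover have "compact (closure {x. box_bump \<epsilon> a b x \<noteq> 0})"
    by (simp add: box_bump_nonzero bounded_box)
  ultimately show ?thesis
    using assms(2) smooth_box_bump[OF assms(1), of a b] unfolding test_functions_def mem_Collect_eq by blast
qed

lemma box_bump_tendsto:
  fixes a b x :: "real^'n"
  shows "(\<lambda>m. box_bump (inverse (real (Suc m))) a b x) \<longlonglongrightarrow> indicator (box a b) x"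
proof (cases "x \<in> box a b")
  case True
  have b: "(\<lambda>m. bump (inverse (real (Suc m))) 0 t) \<longlonglongrightarrow> 1" if "t > 0" for t
  proof -
    have "(\<lambda>m. exp (- inverse (real (Suc m)) / t)) \<longlonglongrightarrow> exp (- 0 / t)"
      by (intro tendsto_intros LIMSEQ_inverse_real_of_nat) (use that in auto)
    then show ?thesis using that by (simp add: bump_def)
  qed
  have "(\<lambda>m. box_bump (inverse (real (Suc m))) a b x) \<longlonglongrightarrow> (\<Prod>i\<in>(UNIV::'n set). 1 * 1)"
    unfolding box_bump_def
  proof (rule tendsto_prod)
    fix i
    show "(\<lambda>m. bump (inverse (real (Suc m))) 0 (x $ i - a $ i) * bump (inverse (real (Suc m))) 0 (b $ i - x $ i))
        \<longlonglongrightarrow> 1 * 1"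
      by (intro tendsto_mult b) (use True in \<open>auto simp: mem_box_cart\<close>)
  qed
  with True show ?thesis by simp
next
  case False
  then have "box_bump e a b x = 0" for e using box_bump_nonzero by blast
  with False show ?thesis by simp
qed

section \<open>The fundamental lemma of the calculus of variations\<close>

lemma integral_box_eq_0:
  fixes G :: "real^'n \<Rightarrow> 'b::euclidean_space"
  assumes U: "U \<in> sets lebesgue" and G: "integrable (lebesgue_on U) G"
    and orth: "\<And>\<phi>. \<phi> \<in> test_functions U \<Longrightarrow> (\<integral>x. \<phi> x *\<^sub>R G x \<partial>lebesgue_on U) = 0"
    and sub: "box a b = {} \<or> cbox a b \<subseteq> U"
  shows "(LINT x:box a b|lebesgue_on U. G x) = 0"
proof (cases "box a b = {}")
  case False
  let ?s = "\<lambda>m x. box_bump (inverse (real (Suc m))) a b x *\<^sub>R G x"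
  have bU: "box a b \<in> sets (lebesgue_on U)"
    using sub False box_subset_cbox[of a b] by (auto simp: sets_restrict_space_iff U)
  have "(\<lambda>m. LINT x|lebesgue_on U. ?s m x) \<longlonglongrightarrow> (LINT x|lebesgue_on U. indicator (box a b) x *\<^sub>R G x)"
  proof (rule integral_dominated_convergence[where w="\<lambda>x. norm (G x)"])
    show "(\<lambda>x. indicat_real (box a b) x *\<^sub>R G x) \<in> borel_measurable (lebesgue_on U)"
      using G bU by (intro borel_measurable_scaleR borel_measurable_indicator) auto
    show "?s m \<in> borel_measurable (lebesgue_on U)" for m
    proof (intro borel_measurable_scaleR)
      have "continuous_on U (box_bump (inverse (real (Suc m))) a b)"
        by (rule continuous_on_subset[OF smooth_continuous[OF smooth_box_bump]]) auto
      then show "box_bump (inverse (real (Suc m))) a b \<in> borel_measurable (lebesgue_on U)"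
        using U by (rule continuous_imp_measurable_on_sets_lebesgue)
    qed (use G in auto)
    show "AE x in lebesgue_on U. norm (?s m x) \<le> norm (G x)" for m
    proof (rule AE_I2)
      fix x
      have "norm (box_bump (inverse (real (Suc m))) a b x) * norm (G x) \<le> 1 * norm (G x)"
        by (intro mult_right_mono box_bump_bounded) auto
      then show "norm (?s m x) \<le> norm (G x)" by simp
    qed
    show "AE x in lebesgue_on U. (\<lambda>m. ?s m x) \<longlonglongrightarrow> indicator (box a b) x *\<^sub>R G x"
      by (intro AE_I2 tendsto_scaleR box_bump_tendsto tendsto_const)
  qed (use G in auto)
  moreover have "(LINT x|lebesgue_on U. ?s m x) = 0" for m
    using sub False by (intro orth box_bump_test_function) auto
  ultimately show ?thesis
    unfolding set_lebesgue_integral_def by (simp only: LIMSEQ_const_iff)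
qed (simp add: set_lebesgue_integral_def)

text \<open>Open boxes form an intersection-stable generator of the Borel sets, so a Dynkin argument
  carries the vanishing of the integral from boxes to Borel sets, and Lebesgue sets differ from
  these by null sets. Working inside one box makes the whole space a box, which the complement step
  requires.\<close>

lemma density_zero_of_boxes:
  fixes G :: "'a::euclidean_space \<Rightarrow> 'b::euclidean_space"
  assumes G: "integrable (lebesgue_on (box c d)) G"
    and box0: "\<And>a b. box a b \<subseteq> box c d \<Longrightarrow> (LINT x:box a b|lebesgue_on (box c d). G x) = 0"
  shows "AE x in lebesgue_on (box c d). G x = 0"
proof -
  let ?Q = "box c d"
  let ?M = "lebesgue_on ?Q"
  have meas: "A \<inter> ?Q \<in> sets ?M" if "A \<in> sets lebesgue" for A
    using that by (auto simp: sets_restrict_space_iff)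
  have si: "set_integrable ?M (A \<inter> ?Q) G" if "A \<in> sets lebesgue" for A
    unfolding set_integrable_def using integrable_mult_indicator[OF meas[OF that] G] .
  have borel0: "(LINT x:A \<inter> ?Q|?M. G x) = 0" if "A \<in> sets borel" for A
  proof -
    have "Int_stable (range (\<lambda>(a, b). box a b :: 'a set))"
      by (auto simp: Int_stable_def box_Int_box)
    moreover have "range (\<lambda>(a, b). box a b :: 'a set) \<subseteq> Pow UNIV" by auto
    moreover have "A \<in> sigma_sets UNIV (range (\<lambda>(a, b). box a b))"
      using that unfolding borel_eq_box by simp
    ultimately show ?thesis
    proof (induction rule: sigma_sets_induct_disjoint)
      case (basic A)
      then obtain a b where A: "A = box a b" by auto
      show ?case unfolding A box_Int_box
        by (rule box0[OF Int_lower2[of "box a b" "box c d", unfolded box_Int_box]])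
    next
      case empty
      then show ?case by (simp add: set_lebesgue_integral_def)
    next
      case (compl A)
      then have A: "A \<in> sets lebesgue" by (simp add: borel_eq_box)
      then have A': "UNIV - A \<in> sets lebesgue" by auto
      have "(LINT x:(A \<inter> ?Q) \<union> ((UNIV - A) \<inter> ?Q)|?M. G x)
          = (LINT x:A \<inter> ?Q|?M. G x) + (LINT x:(UNIV - A) \<inter> ?Q|?M. G x)"
        by (intro set_integral_Un si A A') auto
      moreover have "(A \<inter> ?Q) \<union> ((UNIV - A) \<inter> ?Q) = ?Q" by auto
      ultimately show ?case using compl.IH box0[OF order_refl] by simp
    next
      case (union F)
      then have F: "F i \<in> sets lebesgue" for i by (auto simp: borel_eq_box subset_eq)
      have "(LINT x:(\<Union>i. F i \<inter> ?Q)|?M. G x) = (\<Sum>i. (LINT x:F i \<inter> ?Q|?M. G x))"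
      proof (rule lebesgue_integral_countable_add)
        show "F i \<inter> ?Q \<in> sets ?M" for i using meas F by auto
        show "F i \<inter> ?Q \<inter> (F j \<inter> ?Q) = {}" if "i \<noteq> j" for i j
          using union.hyps that by (auto simp: disjoint_family_on_def)
        have "set_integrable ?M ((\<Union>i. F i) \<inter> ?Q) G" using F by (intro si) auto
        then show "set_integrable ?M (\<Union>i. F i \<inter> ?Q) G" by (simp add: Int_UN_distrib2)
      qed
      then show ?case using union.IH by (simp add: Int_UN_distrib2)
    qed
  qed
  have "finite_measure ?M" by (simp add: finite_measure_lebesgue_on)
  then interpret finite_measure ?M .
  show ?thesis
  proof (rule density_zero[OF G])
    fix A assume A: "A \<in> sets ?M"
    then have AQ: "A \<subseteq> ?Q" "A \<in> sets lebesgue" by (auto simp: sets_restrict_space_iff)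
    \<comment> \<open>\<open>A\<close> is only Lebesgue measurable; its Borel main part has the same
      integral because the remainder is null.\<close>
    let ?B = "main_part lborel A"
    have B: "?B \<in> sets borel" using main_part_sets[OF AQ(2)] by simp
    have "null_part lborel A \<in> null_sets lebesgue"
      using null_part[of A lborel] AQ(2) null_sets_completion_iff2 by blast
    then have "AE x in lebesgue. x \<notin> null_part lborel A" by (rule AE_not_in)
    then have "AE x in ?M. x \<notin> null_part lborel A"
      by (auto simp: AE_restrict_space_iff elim: eventually_mono)
    moreover have "x \<in> A \<longleftrightarrow> x \<in> ?B \<or> x \<in> null_part lborel A" for x
      using main_part_null_part_Un[OF AQ(2)] by blast
    ultimately have ae: "AE x in ?M. indicat_real A x *\<^sub>R G x = indicator (?B \<inter> ?Q) x *\<^sub>R G x"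
      using AQ(1) by (auto elim!: eventually_mono simp: indicator_def)
    have "(LINT x:A|?M. G x) = (LINT x:?B \<inter> ?Q|?M. G x)"
      unfolding set_lebesgue_integral_def
    proof (rule integral_cong_AE)
      show "(\<lambda>x. indicat_real A x *\<^sub>R G x) \<in> borel_measurable ?M"
        using A G by (intro borel_measurable_scaleR borel_measurable_indicator) auto
      show "(\<lambda>x. indicat_real (?B \<inter> ?Q) x *\<^sub>R G x) \<in> borel_measurable ?M"
        using meas[of ?B] B G by (intro borel_measurable_scaleR borel_measurable_indicator) auto
    qed (rule ae)
    then show "(LINT x:A|?M. G x) = 0" using borel0[OF B] by simp
  qed
qed

text \<open>Every point of \<open>U\<close> lies in a box whose closed box stays in
  \<open>U\<close>, and on such a box \<open>G\<close> vanishes almost everywhere. By Lindelof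
  countably many of these boxes cover \<open>U\<close>, so the exceptional null sets form one null
  set.\<close>

lemma AE_zero_if_orthogonal_to_test_functions:
  fixes G :: "real^'n \<Rightarrow> 'b::euclidean_space"
  assumes U: "open U" and G: "integrable (lebesgue_on U) G"
    and orth: "\<And>\<phi>. \<phi> \<in> test_functions U \<Longrightarrow> (\<integral>x. \<phi> x *\<^sub>R G x \<partial>lebesgue_on U) = 0"
  shows "AE x in lebesgue_on U. G x = 0"
proof -
  have UL: "U \<in> sets lebesgue" using U by auto
  have local: "AE x in lebesgue. x \<in> box c d \<longrightarrow> G x = 0" if cd: "cbox c d \<subseteq> U" for c d
  proof -
    have sub: "box c d \<subseteq> U" using cd box_subset_cbox by blast
    have conv: "(\<integral>x. f x \<partial>lebesgue_on (box c d)) = (LINT x|lebesgue_on U. indicator (box c d) x *\<^sub>R f x)"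
      for f :: "real^'n \<Rightarrow> 'b"
    proof -
      have "indicat_real U x *\<^sub>R indicat_real (box c d) x *\<^sub>R f x = indicat_real (box c d) x *\<^sub>R f x" for x
        using sub by (auto simp: indicator_def)
      then show ?thesis using UL by (simp add: integral_restrict_space del: scaleR_scaleR)
    qed
    have "integrable (lebesgue_on (box c d)) G"
    proof -
      have "integrable (lebesgue_on U) (\<lambda>x. indicator (box c d) x *\<^sub>R G x)"
        using sub UL G by (intro integrable_mult_indicator) (auto simp: sets_restrict_space_iff)
      moreover have "indicat_real U x *\<^sub>R indicat_real (box c d) x *\<^sub>R G x = indicat_real (box c d) x *\<^sub>R G x" for x
        using sub by (auto simp: indicator_def)
      ultimately show ?thesis using UL by (simp add: integrable_restrict_space del: scaleR_scaleR)
    qed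
    then have "AE x in lebesgue_on (box c d). G x = 0"
    proof (rule density_zero_of_boxes)
      fix a b assume ab: "box a b \<subseteq> box c d"
      have "box a b = {} \<or> cbox a b \<subseteq> U"
      proof (cases "box a b = {}")
        case False
        then have "cbox a b = closure (box a b)" by simp
        also have "\<dots> \<subseteq> cbox c d" using ab box_subset_cbox by (intro closure_minimal) auto
        finally show ?thesis using cd by blast
      qed simp
      from integral_box_eq_0[OF UL G orth this] have "(LINT x:box a b|lebesgue_on U. G x) = 0" .
      moreover have "indicat_real (box c d) x *\<^sub>R indicat_real (box a b) x *\<^sub>R G x = indicat_real (box a b) x *\<^sub>R G x" for x
        using ab by (auto simp: indicator_def)
      ultimately show "(LINT x:box a b|lebesgue_on (box c d). G x) = 0"
        unfolding set_lebesgue_integral_def conv by (simp del: scaleR_scaleR)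
    qed
    then show ?thesis by (simp add: AE_restrict_space_iff)
  qed
  define \<F> where "\<F> = {box c d |c d. cbox c d \<subseteq> U}"
  have "\<And>S. S \<in> \<F> \<Longrightarrow> open S" by (auto simp: \<F>_def)
  then obtain \<F>' where F': "\<F>' \<subseteq> \<F>" "countable \<F>'" "\<Union>\<F>' = \<Union>\<F>" by (rule Lindelof)
  have cover: "U \<subseteq> \<Union>\<F>'"
  proof
    fix x assume "x \<in> U"
    from open_contains_cbox[OF U this] obtain a b where "cbox a b \<subseteq> U" "x \<in> box a b" .
    then show "x \<in> \<Union>\<F>'" unfolding F'(3) \<F>_def by blast
  qed
  have "AE x in lebesgue. \<forall>S\<in>\<F>'. x \<in> S \<longrightarrow> G x = 0"
    using F'(1) local by (subst AE_ball_countable[OF F'(2)]) (auto simp: \<F>_def)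
  then have "AE x in lebesgue. x \<in> U \<longrightarrow> G x = 0"
    using cover by (auto elim!: eventually_mono)
  then show ?thesis using UL by (simp add: AE_restrict_space_iff)
qed

section \<open>Linearity of the variational problem\<close>

lemma L2_measurable: "v \<in> L2 M \<Longrightarrow> v \<in> borel_measurable M"
  by (simp add: L2_def)

text \<open>Only integrability is wanted, so bounding a product by the sum of the squares takes the
  place of Hoelder's inequality.\<close>

lemma integrable_L2_dominated:
  fixes f :: "'a \<Rightarrow> 'c::euclidean_space" and g :: "'a \<Rightarrow> 'b::euclidean_space" and h :: "'a \<Rightarrow> 'd::euclidean_space"
  assumes f: "f \<in> borel_measurable M" and g: "g \<in> L2 M" and h: "h \<in> L2 M"
    and le: "AE x in M. norm (f x) \<le> C * (norm (g x) * norm (h x))"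
  shows "integrable M f"
proof (rule Bochner_Integration.integrable_bound)
  show "integrable M (\<lambda>x. \<bar>C\<bar> * ((norm (g x))\<^sup>2 + (norm (h x))\<^sup>2))"
    using g h by (auto simp: L2_def)
  have "C * (a * b) \<le> \<bar>C\<bar> * (a\<^sup>2 + b\<^sup>2)" if "a \<ge> 0" "b \<ge> 0" for a b :: real
  proof -
    have "a * b \<le> a\<^sup>2 + b\<^sup>2"
      using sum_squares_bound[of a b] mult_nonneg_nonneg[OF that] by (simp add: mult.assoc)
    then have "\<bar>C\<bar> * (a * b) \<le> \<bar>C\<bar> * (a\<^sup>2 + b\<^sup>2)" by (intro mult_left_mono) auto
    moreover have "C * (a * b) \<le> \<bar>C\<bar> * (a * b)" using that by (intro mult_right_mono) auto
    ultimately show ?thesis by linarith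
  qed
  then have le2: "C * (norm (g x) * norm (h x)) \<le> norm (\<bar>C\<bar> * ((norm (g x))\<^sup>2 + (norm (h x))\<^sup>2))" for x
    by (simp add: abs_mult)
  show "AE x in M. norm (f x) \<le> norm (\<bar>C\<bar> * ((norm (g x))\<^sup>2 + (norm (h x))\<^sup>2))"
    by (rule eventually_mono[OF le]) (rule order_trans[OF _ le2])
qed (rule f)

lemma norm_linear_sq_le:
  fixes a b :: "'a::real_normed_vector"
  shows "(norm (\<alpha> *\<^sub>R a + \<beta> *\<^sub>R b))\<^sup>2 \<le> 2 * \<alpha>\<^sup>2 * (norm a)\<^sup>2 + 2 * \<beta>\<^sup>2 * (norm b)\<^sup>2"
proof -
  have "(norm (\<alpha> *\<^sub>R a + \<beta> *\<^sub>R b))\<^sup>2 \<le> (norm (\<alpha> *\<^sub>R a) + norm (\<beta> *\<^sub>R b))\<^sup>2"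
    by (intro power_mono norm_triangle_ineq) auto
  also have "\<dots> \<le> 2 * (norm (\<alpha> *\<^sub>R a))\<^sup>2 + 2 * (norm (\<beta> *\<^sub>R b))\<^sup>2"
    using sum_squares_bound[of "norm (\<alpha> *\<^sub>R a)" "norm (\<beta> *\<^sub>R b)"] by (simp add: power2_sum)
  finally show ?thesis by (simp add: power_mult_distrib)
qed

lemma L2_linear:
  assumes "v \<in> L2 M" "w \<in> L2 M"
  shows "(\<lambda>x. \<alpha> *\<^sub>R v x + \<beta> *\<^sub>R w x) \<in> L2 M" (is "?u \<in> _")
proof -
  have m: "?u \<in> borel_measurable M" using assms by (auto simp: L2_def)
  have "integrable M (\<lambda>x. (norm (?u x))\<^sup>2)"
  proof (rule Bochner_Integration.integrable_bound)
    show "integrable M (\<lambda>x. 2 * \<alpha>\<^sup>2 * (norm (v x))\<^sup>2 + 2 * \<beta>\<^sup>2 * (norm (w x))\<^sup>2)"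
      using assms by (auto simp: L2_def)
    show "(\<lambda>x. (norm (?u x))\<^sup>2) \<in> borel_measurable M" using m by measurable
    show "AE x in M. norm ((norm (?u x))\<^sup>2)
        \<le> norm (2 * \<alpha>\<^sup>2 * (norm (v x))\<^sup>2 + 2 * \<beta>\<^sup>2 * (norm (w x))\<^sup>2)"
      using norm_linear_sq_le by (intro AE_I2) simp
  qed
  with m show ?thesis by (simp add: L2_def)
qed

lemma L2_linear_real:
  fixes v w :: "'a \<Rightarrow> real"
  assumes "v \<in> L2 M" "w \<in> L2 M"
  shows "(\<lambda>x. \<alpha> * v x + \<beta> * w x) \<in> L2 M"
  using L2_linear[OF assms, of \<alpha> \<beta>] by simp

lemma L2_diff:
  assumes "v \<in> L2 M" "w \<in> L2 M"
  shows "(\<lambda>x. v x - w x) \<in> L2 M"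
  using L2_linear[OF assms, of 1 "-1"] by simp

lemma l2norm_tendsto_0_linear:
  assumes L2: "\<And>m. f m \<in> L2 M" "\<And>m. g m \<in> L2 M"
    and lim: "(\<lambda>m. l2norm M (f m)) \<longlonglongrightarrow> 0" "(\<lambda>m. l2norm M (g m)) \<longlonglongrightarrow> 0"
  shows "(\<lambda>m. l2norm M (\<lambda>x. \<alpha> *\<^sub>R f m x + \<beta> *\<^sub>R g m x)) \<longlonglongrightarrow> 0"
    (is "(\<lambda>m. l2norm M (?u m)) \<longlonglongrightarrow> 0")
proof -
  let ?h = "\<lambda>m. sqrt (2 * \<alpha>\<^sup>2 * (l2norm M (f m))\<^sup>2 + 2 * \<beta>\<^sup>2 * (l2norm M (g m))\<^sup>2)"
  have sq: "(l2norm M v)\<^sup>2 = (\<integral>x. (norm (v x))\<^sup>2 \<partial>M)" for v :: "'a \<Rightarrow> 'b"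
    by (simp add: l2norm_def)
  have le: "l2norm M (?u m) \<le> ?h m" for m
  proof -
    have "(\<integral>x. (norm (?u m x))\<^sup>2 \<partial>M)
        \<le> (\<integral>x. 2 * \<alpha>\<^sup>2 * (norm (f m x))\<^sup>2 + 2 * \<beta>\<^sup>2 * (norm (g m x))\<^sup>2 \<partial>M)"
      using L2_linear[OF L2(1)[of m] L2(2)[of m]] L2[of m]
      by (intro integral_mono norm_linear_sq_le) (auto simp: L2_def)
    also have "\<dots> = 2 * \<alpha>\<^sup>2 * (l2norm M (f m))\<^sup>2 + 2 * \<beta>\<^sup>2 * (l2norm M (g m))\<^sup>2"
      using L2[of m] by (simp add: sq L2_def)
    finally show ?thesis by (simp add: l2norm_def)
  qed
  have lim_h: "?h \<longlonglongrightarrow> sqrt (2 * \<alpha>\<^sup>2 * 0\<^sup>2 + 2 * \<beta>\<^sup>2 * 0\<^sup>2)" by (intro tendsto_intros lim)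
  show ?thesis
    by (rule tendsto_sandwich[where f="\<lambda>_. 0" and h="?h"])
      (use le lim_h in \<open>simp_all add: l2norm_def\<close>)
qed

section \<open>Sobolev spaces on bounded open sets\<close>

lemma test_functions_linear:
  assumes "\<phi> \<in> test_functions U" "\<psi> \<in> test_functions U"
  shows "(\<lambda>x. \<alpha> * \<phi> x + \<beta> * \<psi> x) \<in> test_functions U"
proof -
  let ?c = "\<lambda>\<phi>. closure {x. \<phi> x \<noteq> (0::real)}"
  have "{x. \<alpha> * \<phi> x + \<beta> * \<psi> x \<noteq> 0} \<subseteq> {x. \<phi> x \<noteq> 0} \<union> {x. \<psi> x \<noteq> 0}" by auto
  from closure_mono[OF this] have sub: "?c (\<lambda>x. \<alpha> * \<phi> x + \<beta> * \<psi> x) \<subseteq> ?c \<phi> \<union> ?c \<psi>"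
    by (simp only: closure_Un)
  have c: "compact (?c \<phi> \<union> ?c \<psi>)" using assms by (auto simp: test_functions_def)
  have "bounded {x. \<alpha> * \<phi> x + \<beta> * \<psi> x \<noteq> 0}"
    by (rule bounded_subset[OF compact_imp_bounded[OF c] order_trans[OF closure_subset sub]])
  then have "compact (?c (\<lambda>x. \<alpha> * \<phi> x + \<beta> * \<psi> x))" by simp
  moreover have "smooth (\<lambda>x. \<alpha> * \<phi> x + \<beta> * \<psi> x)"
    by (rule smooth_linear) (use assms in \<open>simp_all add: test_functions_def\<close>)
  moreover have "?c (\<lambda>x. \<alpha> * \<phi> x + \<beta> * \<psi> x) \<subseteq> U"
    by (rule order_trans[OF sub]) (use assms in \<open>simp add: test_functions_def\<close>)
  ultimately show ?thesis unfolding test_functions_def mem_Collect_eq by (intro conjI)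
qed

text \<open>Openness gives uniqueness of weak gradients; boundedness gives finite measure, so that
  test functions and their gradients are square integrable.\<close>

locale bounded_open_set =
  fixes U :: "(real^'n) set"
  assumes open_U: "open U" and bounded_U: "bounded U"
begin

abbreviation "M \<equiv> lebesgue_on U"

lemma finite_measure_M: "finite_measure M"
  using open_U bounded_U by (simp add: finite_measure_lebesgue_on lmeasurable_open)

lemma continuous_in_L2:
  fixes f :: "real^'n \<Rightarrow> 'b::euclidean_space"
  assumes f: "continuous_on UNIV f"
  shows "f \<in> L2 M"
proof -
  have m: "f \<in> borel_measurable M"
    by (rule continuous_imp_measurable_on_sets_lebesgue[OF continuous_on_subset[OF f subset_UNIV]]) (use open_U in auto)
  have "compact (f ` closure U)"
    by (rule compact_continuous_image[OF continuous_on_subset[OF f subset_UNIV]]) (use bounded_U in simp)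
  from compact_imp_bounded[OF this] obtain B where B: "\<And>x. x \<in> closure U \<Longrightarrow> norm (f x) \<le> B"
    by (auto simp: bounded_iff)
  interpret finite_measure M by (rule finite_measure_M)
  have "integrable M (\<lambda>x. (norm (f x))\<^sup>2)"
  proof (rule integrable_const_bound[where B="B\<^sup>2"])
    show "AE x in M. norm ((norm (f x))\<^sup>2) \<le> B\<^sup>2"
    proof (rule AE_I2)
      fix x assume "x \<in> space M"
      then have "x \<in> closure U" using closure_subset[of U] by auto
      from power_mono[OF B[OF this], of 2] show "norm ((norm (f x))\<^sup>2) \<le> B\<^sup>2" by simp
    qed
  qed (use m in \<open>simp add: borel_measurable_power\<close>)
  with m show ?thesis by (simp add: L2_def)
qed

lemma test_function_L2: "\<phi> \<in> test_functions U \<Longrightarrow> \<phi> \<in> L2 M"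
  by (rule continuous_in_L2) (simp add: test_functions_def smooth_continuous)

lemma grad_test_function_L2: "\<phi> \<in> test_functions U \<Longrightarrow> grad \<phi> \<in> L2 M"
  by (rule continuous_in_L2) (simp add: test_functions_def smooth_continuous_grad)

lemma integrable_scaleR_L2:
  fixes v :: "real^'n \<Rightarrow> real" and w :: "real^'n \<Rightarrow> 'b::euclidean_space"
  assumes "v \<in> L2 M" "w \<in> L2 M"
  shows "integrable M (\<lambda>x. v x *\<^sub>R w x)"
  using assms[THEN L2_measurable]
  by (intro integrable_L2_dominated[OF _ assms, where C=1] AE_I2) auto

lemma is_weak_grad_linear:
  assumes L2: "v \<in> L2 M" "w \<in> L2 M" "G \<in> L2 M" "H \<in> L2 M"
    and wg: "is_weak_grad U v G" "is_weak_grad U w H"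
  shows "is_weak_grad U (\<lambda>x. \<alpha> * v x + \<beta> * w x) (\<lambda>x. \<alpha> *\<^sub>R G x + \<beta> *\<^sub>R H x)"
  unfolding is_weak_grad_def
proof
  fix \<phi> assume \<phi>: "\<phi> \<in> test_functions U"
  have i: "integrable M (\<lambda>x. v x *\<^sub>R grad \<phi> x)" "integrable M (\<lambda>x. w x *\<^sub>R grad \<phi> x)"
    "integrable M (\<lambda>x. \<phi> x *\<^sub>R G x)" "integrable M (\<lambda>x. \<phi> x *\<^sub>R H x)"
    by (intro integrable_scaleR_L2 L2 test_function_L2[OF \<phi>] grad_test_function_L2[OF \<phi>])+
  have "(\<integral>x. (\<alpha> * v x + \<beta> * w x) *\<^sub>R grad \<phi> x \<partial>M)
      = (\<integral>x. \<alpha> *\<^sub>R (v x *\<^sub>R grad \<phi> x) + \<beta> *\<^sub>R (w x *\<^sub>R grad \<phi> x) \<partial>M)"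
    by (simp add: scaleR_left_distrib)
  also have "\<dots> = \<alpha> *\<^sub>R (\<integral>x. v x *\<^sub>R grad \<phi> x \<partial>M) + \<beta> *\<^sub>R (\<integral>x. w x *\<^sub>R grad \<phi> x \<partial>M)"
    using i by (simp del: scaleR_scaleR)
  also have "\<dots> = - (\<alpha> *\<^sub>R (\<integral>x. \<phi> x *\<^sub>R G x \<partial>M) + \<beta> *\<^sub>R (\<integral>x. \<phi> x *\<^sub>R H x \<partial>M))"
    using wg \<phi> by (simp add: is_weak_grad_def)
  also have "\<dots> = - (\<integral>x. \<alpha> *\<^sub>R (\<phi> x *\<^sub>R G x) + \<beta> *\<^sub>R (\<phi> x *\<^sub>R H x) \<partial>M)"
    using i by (simp del: scaleR_scaleR)
  also have "\<dots> = - (\<integral>x. \<phi> x *\<^sub>R (\<alpha> *\<^sub>R G x + \<beta> *\<^sub>R H x) \<partial>M)"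
    by (simp add: scaleR_right_distrib mult.commute)
  finally show "(\<integral>x. (\<alpha> * v x + \<beta> * w x) *\<^sub>R grad \<phi> x \<partial>M) = - (\<integral>x. \<phi> x *\<^sub>R (\<alpha> *\<^sub>R G x + \<beta> *\<^sub>R H x) \<partial>M)" .
qed

text \<open>The two defining identities make \<open>G - H\<close> orthogonal to all test functions.
  Through this, a statement about the chosen \<open>weak_grad\<close> reduces to exhibiting any
  square integrable weak gradient.\<close>

lemma weak_grad_unique:
  assumes L2: "G \<in> L2 M" "H \<in> L2 M" and wg: "is_weak_grad U v G" "is_weak_grad U v H"
  shows "AE x in M. G x = H x"
proof -
  have "AE x in M. G x - H x = 0"
  proof (rule AE_zero_if_orthogonal_to_test_functions[OF open_U])
    have "(\<lambda>x. 1::real) \<in> L2 M" by (rule continuous_in_L2) simp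
    from integrable_scaleR_L2[OF this L2_diff[OF L2]] show "integrable M (\<lambda>x. G x - H x)" by simp
    fix \<phi> assume \<phi>: "\<phi> \<in> test_functions U"
    have i: "integrable M (\<lambda>x. \<phi> x *\<^sub>R G x)" "integrable M (\<lambda>x. \<phi> x *\<^sub>R H x)"
      by (intro integrable_scaleR_L2 L2 test_function_L2[OF \<phi>])+
    then have "(\<integral>x. \<phi> x *\<^sub>R (G x - H x) \<partial>M) = (\<integral>x. \<phi> x *\<^sub>R G x \<partial>M) - (\<integral>x. \<phi> x *\<^sub>R H x \<partial>M)"
      by (simp add: scaleR_diff_right)
    also have "\<dots> = 0"
      using wg[unfolded is_weak_grad_def, THEN bspec, OF \<phi>] by simp
    finally show "(\<integral>x. \<phi> x *\<^sub>R (G x - H x) \<partial>M) = 0" .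
  qed
  then show ?thesis by (auto elim: eventually_mono)
qed

lemma weak_grad:
  assumes "v \<in> H1 U"
  shows "weak_grad U v \<in> L2 M" "is_weak_grad U v (weak_grad U v)"
proof -
  have "\<exists>G. G \<in> L2 M \<and> is_weak_grad U v G" using assms by (auto simp: H1_def)
  from someI_ex[OF this] show "weak_grad U v \<in> L2 M" "is_weak_grad U v (weak_grad U v)"
    by (auto simp: weak_grad_def)
qed

lemma H1_L2: "v \<in> H1 U \<Longrightarrow> v \<in> L2 M"
  by (simp add: H1_def)

lemma H1_linear:
  assumes "v \<in> H1 U" "w \<in> H1 U"
  shows "(\<lambda>x. \<alpha> * v x + \<beta> * w x) \<in> H1 U"
proof -
  note wg = weak_grad[OF assms(1)] weak_grad[OF assms(2)]
  have "is_weak_grad U (\<lambda>x. \<alpha> * v x + \<beta> * w x) (\<lambda>x. \<alpha> *\<^sub>R weak_grad U v x + \<beta> *\<^sub>R weak_grad U w x)"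
    using assms[THEN H1_L2] wg by (intro is_weak_grad_linear)
  moreover have "(\<lambda>x. \<alpha> *\<^sub>R weak_grad U v x + \<beta> *\<^sub>R weak_grad U w x) \<in> L2 M"
    using wg by (intro L2_linear)
  moreover have "(\<lambda>x. \<alpha> * v x + \<beta> * w x) \<in> L2 M"
    using assms[THEN H1_L2] by (rule L2_linear_real)
  ultimately show ?thesis
    unfolding H1_def mem_Collect_eq by (intro conjI bexI)
qed

lemma weak_grad_linear:
  assumes "v \<in> H1 U" "w \<in> H1 U"
  shows "AE x in M. weak_grad U (\<lambda>x. \<alpha> * v x + \<beta> * w x) x = \<alpha> *\<^sub>R weak_grad U v x + \<beta> *\<^sub>R weak_grad U w x"
proof -
  note wg = weak_grad[OF assms(1)] weak_grad[OF assms(2)] weak_grad[OF H1_linear[OF assms], of \<alpha> \<beta>]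
  have "is_weak_grad U (\<lambda>x. \<alpha> * v x + \<beta> * w x) (\<lambda>x. \<alpha> *\<^sub>R weak_grad U v x + \<beta> *\<^sub>R weak_grad U w x)"
    using assms[THEN H1_L2] wg by (intro is_weak_grad_linear)
  moreover have "(\<lambda>x. \<alpha> *\<^sub>R weak_grad U v x + \<beta> *\<^sub>R weak_grad U w x) \<in> L2 M"
    using wg by (intro L2_linear)
  ultimately show ?thesis
    using wg by (intro weak_grad_unique)
qed

lemma H10_H1: "v \<in> H10 U \<Longrightarrow> v \<in> H1 U"
  by (simp add: H10_def)

lemma H10_linear:
  assumes v: "v \<in> H10 U" and w: "w \<in> H10 U"
  shows "(\<lambda>x. \<alpha> * v x + \<beta> * w x) \<in> H10 U"
proof -
  note H1 = H10_H1[OF v] H10_H1[OF w]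
  obtain \<phi> \<psi> where t: "\<And>m. \<phi> m \<in> test_functions U" "\<And>m. \<psi> m \<in> test_functions U"
    and lim: "H1_tendsto U \<phi> v" "H1_tendsto U \<psi> w"
    using v w by (auto simp: H10_def)
  let ?c = "\<lambda>m x. \<alpha> * \<phi> m x + \<beta> * \<psi> m x" and ?u = "\<lambda>x. \<alpha> * v x + \<beta> * w x"
  have "(\<lambda>m. l2norm M (\<lambda>x. \<alpha> *\<^sub>R (\<phi> m x - v x) + \<beta> *\<^sub>R (\<psi> m x - w x))) \<longlonglongrightarrow> 0"
    using lim t H1 by (intro l2norm_tendsto_0_linear L2_diff test_function_L2 H1_L2) (auto simp: H1_tendsto_def)
  moreover have "(\<lambda>x. \<alpha> *\<^sub>R (\<phi> m x - v x) + \<beta> *\<^sub>R (\<psi> m x - w x)) = (\<lambda>x. ?c m x - ?u x)" for m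
    by (auto simp: algebra_simps)
  ultimately have 1: "(\<lambda>m. l2norm M (\<lambda>x. ?c m x - ?u x)) \<longlonglongrightarrow> 0" by simp
  let ?e = "\<lambda>m x. \<alpha> *\<^sub>R (grad (\<phi> m) x - weak_grad U v x) + \<beta> *\<^sub>R (grad (\<psi> m) x - weak_grad U w x)"
    and ?f = "\<lambda>m x. grad (?c m) x - weak_grad U ?u x"
  have "(\<lambda>m. l2norm M (?e m)) \<longlonglongrightarrow> 0"
    using lim t H1
    by (intro l2norm_tendsto_0_linear L2_diff grad_test_function_L2 weak_grad(1)) (auto simp: H1_tendsto_def)
  \<comment> \<open>The gradient of the combined test function is the combination of the gradients
    everywhere, that of the limit only almost everywhere, which the norm does not see.\<close>
  moreover have "l2norm M (?e m) = l2norm M (?f m)" for m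
  proof -
    have d: "\<phi> m differentiable at x" "\<psi> m differentiable at x" for x
      using t by (auto simp: test_functions_def smooth_differentiable)
    have L2: "?e m \<in> L2 M" "?f m \<in> L2 M"
      using t H1
      by (intro L2_linear L2_diff grad_test_function_L2 test_functions_linear weak_grad(1) H1_linear; simp)+
    have "(\<integral>x. (norm (?e m x))\<^sup>2 \<partial>M) = (\<integral>x. (norm (?f m x))\<^sup>2 \<partial>M)"
    proof (rule integral_cong_AE)
      show "(\<lambda>x. (norm (?e m x))\<^sup>2) \<in> borel_measurable M" "(\<lambda>x. (norm (?f m x))\<^sup>2) \<in> borel_measurable M"
        using L2 unfolding L2_def by auto
      show "AE x in M. (norm (?e m x))\<^sup>2 = (norm (?f m x))\<^sup>2"
        using weak_grad_linear[OF H1, of \<alpha> \<beta>]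
        by eventually_elim (simp add: grad_linear[OF d] algebra_simps)
    qed
    then show ?thesis by (simp add: l2norm_def)
  qed
  ultimately have 2: "(\<lambda>m. l2norm M (?f m)) \<longlonglongrightarrow> 0" by simp
  show ?thesis
    unfolding H10_def mem_Collect_eq H1_tendsto_def
    by (intro conjI exI[of _ ?c] allI H1_linear H1 test_functions_linear t 1 2)
qed

end

section \<open>The bilinear form and the load functional\<close>

lemma integral_linear_AE:
  fixes f g h :: "'a \<Rightarrow> real"
  assumes "integrable M f" "integrable M g" "integrable M h"
    and "AE x in M. h x = \<alpha> * f x + \<beta> * g x"
  shows "integral\<^sup>L M h = \<alpha> * integral\<^sup>L M f + \<beta> * integral\<^sup>L M g"
proof -
  have "integral\<^sup>L M h = (\<integral>x. \<alpha> * f x + \<beta> * g x \<partial>M)"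
    using assms by (intro integral_cong_AE) auto
  then show ?thesis using assms by simp
qed

text \<open>The dimension factor is a crude loss that does no harm, since the bound serves
  integrability only.\<close>

lemma norm_matrix_vector_mult_le:
  fixes A :: "real^'n^'m"
  shows "norm (A *v x) \<le> real CARD('m) * (norm A * norm x)"
proof -
  have "norm (A *v x) \<le> (\<Sum>i\<in>UNIV. \<bar>(A *v x) $ i\<bar>)" by (rule norm_le_l1_cart)
  also have "\<dots> \<le> (\<Sum>i\<in>(UNIV::'m set). norm A * norm x)"
  proof (rule sum_mono)
    fix i
    have "\<bar>(A *v x) $ i\<bar> \<le> norm (A $ i) * norm x"
      unfolding matrix_vector_mul_component by (rule Cauchy_Schwarz_ineq2)
    also have "\<dots> \<le> norm A * norm x"
      by (intro mult_right_mono Finite_Cartesian_Product.norm_nth_le) auto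
    finally show "\<bar>(A *v x) $ i\<bar> \<le> norm A * norm x" .
  qed
  finally show ?thesis by simp
qed

lemma borel_measurable_vec_nth:
  fixes f :: "'a \<Rightarrow> 'b::euclidean_space^'n"
  shows "f \<in> borel_measurable M \<Longrightarrow> (\<lambda>x. f x $ i) \<in> borel_measurable M"
  by (rule measurable_compose[OF _ borel_measurable_continuous_onI]) (auto intro: continuous_intros)

lemma borel_measurable_matrix_inner:
  fixes A :: "'a \<Rightarrow> real^'n^'n" and g h :: "'a \<Rightarrow> real^'n"
  assumes "A \<in> borel_measurable M" "g \<in> borel_measurable M" "h \<in> borel_measurable M"
  shows "(\<lambda>x. (A x *v g x) \<bullet> h x) \<in> borel_measurable M"
proof -
  have "(\<lambda>x. \<Sum>i\<in>UNIV. (A x $ i \<bullet> g x) * h x $ i) \<in> borel_measurable M"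
    by (intro borel_measurable_sum borel_measurable_times borel_measurable_inner borel_measurable_vec_nth assms)
  then show ?thesis by (simp add: inner_vec_def[of "_ *v _"] matrix_vector_mul_component)
qed

locale pde_problem =
  fixes D :: "'n::finite pde"
  assumes model: "model_problem D"
begin

sublocale bounded_open_set "dom D"
  using model by unfold_locales (auto simp: model_problem_def polyhedral_lipschitz_domain_def lipschitz_domain_def)

lemma integrable_Linf_weighted:
  fixes f :: "real^'n \<Rightarrow> real" and g :: "real^'n \<Rightarrow> 'b::euclidean_space" and h :: "real^'n \<Rightarrow> 'c::euclidean_space"
    and K :: "real^'n \<Rightarrow> 'd::euclidean_space"
  assumes K: "K \<in> Linf M" and f: "f \<in> borel_measurable M" and g: "g \<in> L2 M" and h: "h \<in> L2 M"
    and c: "c \<ge> 0" and le: "\<And>x. \<bar>f x\<bar> \<le> c * (norm (K x) * (norm (g x) * norm (h x)))"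
  shows "integrable M f"
proof -
  obtain B where B: "AE x in M. norm (K x) \<le> B" using K by (auto simp: Linf_def)
  show ?thesis
  proof (rule integrable_L2_dominated[OF f g h])
    show "AE x in M. norm (f x) \<le> (c * B) * (norm (g x) * norm (h x))"
      using B
    proof eventually_elim
      case (elim x)
      have "c * (norm (K x) * (norm (g x) * norm (h x))) \<le> c * (B * (norm (g x) * norm (h x)))"
        using c by (intro mult_left_mono mult_right_mono elim) auto
      then show ?case using le[of x] by (simp add: mult.assoc)
    qed
  qed
qed

lemma coefficients: "diffusion D \<in> Linf M" "advection D \<in> Linf M" "reaction D \<in> Linf M"
  "source D \<in> L2 M" "flux D \<in> L2 M"
  using model by (auto simp: model_problem_def)

lemma Linf_measurable: "K \<in> Linf M \<Longrightarrow> K \<in> borel_measurable M"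
  by (simp add: Linf_def)

lemma integrable_diffusion:
  assumes g: "g \<in> L2 M" and h: "h \<in> L2 M"
  shows "integrable M (\<lambda>x. (diffusion D x *v g x) \<bullet> h x)"
proof (rule integrable_Linf_weighted[OF coefficients(1) _ g h, where c="real CARD('n)"])
  show "(\<lambda>x. (diffusion D x *v g x) \<bullet> h x) \<in> borel_measurable M"
    by (intro borel_measurable_matrix_inner Linf_measurable coefficients L2_measurable g h)
  fix x
  have "\<bar>(diffusion D x *v g x) \<bullet> h x\<bar> \<le> norm (diffusion D x *v g x) * norm (h x)"
    by (rule Cauchy_Schwarz_ineq2)
  also have "\<dots> \<le> (real CARD('n) * (norm (diffusion D x) * norm (g x))) * norm (h x)"
    by (intro mult_right_mono norm_matrix_vector_mult_le) auto
  finally show "\<bar>(diffusion D x *v g x) \<bullet> h x\<bar>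
      \<le> real CARD('n) * (norm (diffusion D x) * (norm (g x) * norm (h x)))" by (simp add: mult.assoc)
qed simp

lemma integrable_advection:
  assumes g: "g \<in> L2 M" and h: "h \<in> L2 M"
  shows "integrable M (\<lambda>x. (advection D x \<bullet> g x) * h x)"
proof (rule integrable_Linf_weighted[OF coefficients(2) _ g h, where c=1])
  show "(\<lambda>x. (advection D x \<bullet> g x) * h x) \<in> borel_measurable M"
    by (intro borel_measurable_times borel_measurable_inner Linf_measurable coefficients L2_measurable g h)
  show "\<bar>(advection D x \<bullet> g x) * h x\<bar> \<le> 1 * (norm (advection D x) * (norm (g x) * norm (h x)))" for x
    using mult_right_mono[OF Cauchy_Schwarz_ineq2, of "\<bar>h x\<bar>" "advection D x" "g x"]
    by (simp add: abs_mult mult.assoc)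
qed simp

lemma integrable_reaction:
  assumes g: "g \<in> L2 M" and h: "h \<in> L2 M"
  shows "integrable M (\<lambda>x. reaction D x * g x * h x)"
proof (rule integrable_Linf_weighted[OF coefficients(3) _ g h, where c=1])
  show "(\<lambda>x. reaction D x * g x * h x) \<in> borel_measurable M"
    by (intro borel_measurable_times Linf_measurable coefficients L2_measurable g h)
qed (simp_all add: abs_mult mult.assoc)

lemma bform_linear_left:
  assumes v: "v \<in> H10 (dom D)" and w: "w \<in> H10 (dom D)" and z: "z \<in> H10 (dom D)"
  shows "bform D (\<lambda>x. \<alpha> * v x + \<beta> * w x) z = \<alpha> * bform D v z + \<beta> * bform D w z"
proof -
  note H1 = v[THEN H10_H1] w[THEN H10_H1] z[THEN H10_H1]
  let ?u = "\<lambda>x. \<alpha> * v x + \<beta> * w x"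
  have u: "?u \<in> H1 (dom D)" by (intro H1_linear H1)
  note ae = weak_grad_linear[OF H1(1,2), of \<alpha> \<beta>]
  have "energy_form D ?u z = \<alpha> * energy_form D v z + \<beta> * energy_form D w z"
    unfolding energy_form_def
    by (rule integral_linear_AE; (intro integrable_diffusion weak_grad(1) H1 u)?)
      (rule eventually_mono[OF ae], simp add: matrix_vector_right_distrib matrix_vector_mult_scaleR inner_left_distrib)
  moreover have "(\<integral>x. (advection D x \<bullet> weak_grad (dom D) ?u x) * z x \<partial>M)
    = \<alpha> * (\<integral>x. (advection D x \<bullet> weak_grad (dom D) v x) * z x \<partial>M)
    + \<beta> * (\<integral>x. (advection D x \<bullet> weak_grad (dom D) w x) * z x \<partial>M)"
    by (rule integral_linear_AE; (intro integrable_advection weak_grad(1) H1_L2 H1 u)?)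
      (rule eventually_mono[OF ae], simp add: inner_right_distrib algebra_simps)
  moreover have "(\<integral>x. reaction D x * ?u x * z x \<partial>M)
    = \<alpha> * (\<integral>x. reaction D x * v x * z x \<partial>M) + \<beta> * (\<integral>x. reaction D x * w x * z x \<partial>M)"
    by (rule integral_linear_AE; (intro integrable_reaction H1_L2 H1 u)?) (simp add: algebra_simps)
  ultimately show ?thesis unfolding bform_def by (simp add: algebra_simps)
qed

lemma bform_linear_right:
  assumes v: "v \<in> H10 (dom D)" and w: "w \<in> H10 (dom D)" and z: "z \<in> H10 (dom D)"
  shows "bform D z (\<lambda>x. \<alpha> * v x + \<beta> * w x) = \<alpha> * bform D z v + \<beta> * bform D z w"
proof -
  note H1 = v[THEN H10_H1] w[THEN H10_H1] z[THEN H10_H1]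
  let ?u = "\<lambda>x. \<alpha> * v x + \<beta> * w x"
  have u: "?u \<in> H1 (dom D)" by (intro H1_linear H1)
  note ae = weak_grad_linear[OF H1(1,2), of \<alpha> \<beta>]
  have "energy_form D z ?u = \<alpha> * energy_form D z v + \<beta> * energy_form D z w"
    unfolding energy_form_def
    by (rule integral_linear_AE; (intro integrable_diffusion weak_grad(1) H1 u)?)
      (rule eventually_mono[OF ae], simp add: inner_right_distrib)
  moreover have "(\<integral>x. (advection D x \<bullet> weak_grad (dom D) z x) * ?u x \<partial>M)
    = \<alpha> * (\<integral>x. (advection D x \<bullet> weak_grad (dom D) z x) * v x \<partial>M)
    + \<beta> * (\<integral>x. (advection D x \<bullet> weak_grad (dom D) z x) * w x \<partial>M)"
    by (rule integral_linear_AE; (intro integrable_advection weak_grad(1) H1_L2 H1 u)?)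
      (simp add: algebra_simps)
  moreover have "(\<integral>x. reaction D x * z x * ?u x \<partial>M)
    = \<alpha> * (\<integral>x. reaction D x * z x * v x \<partial>M) + \<beta> * (\<integral>x. reaction D x * z x * w x \<partial>M)"
    by (rule integral_linear_AE; (intro integrable_reaction H1_L2 H1 u)?) (simp add: algebra_simps)
  ultimately show ?thesis unfolding bform_def by (simp add: algebra_simps)
qed

lemma rhs_linear:
  assumes v: "v \<in> H10 (dom D)" and w: "w \<in> H10 (dom D)"
  shows "rhs D (\<lambda>x. \<alpha> * v x + \<beta> * w x) = \<alpha> * rhs D v + \<beta> * rhs D w"
proof -
  note H1 = v[THEN H10_H1] w[THEN H10_H1]
  let ?u = "\<lambda>x. \<alpha> * v x + \<beta> * w x"
  have u: "?u \<in> H1 (dom D)" by (intro H1_linear H1)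
  note ae = weak_grad_linear[OF H1, of \<alpha> \<beta>]
  note s = coefficients(4) and f = coefficients(5)
  have si: "integrable M (\<lambda>x. source D x * v x)" if "v \<in> L2 M" for v
    using integrable_scaleR_L2[OF s that] by simp
  have fi: "integrable M (\<lambda>x. flux D x \<bullet> g x)" if "g \<in> L2 M" for g
    by (rule integrable_L2_dominated[OF _ f that, where C=1])
       (use L2_measurable[OF f] L2_measurable[OF that] in \<open>simp_all add: Cauchy_Schwarz_ineq2\<close>)
  have "(\<integral>x. source D x * ?u x \<partial>M) = \<alpha> * (\<integral>x. source D x * v x \<partial>M) + \<beta> * (\<integral>x. source D x * w x \<partial>M)"
    by (rule integral_linear_AE; (intro si H1_L2 H1 u)?) (simp add: algebra_simps)
  moreover have "(\<integral>x. flux D x \<bullet> weak_grad (dom D) ?u x \<partial>M)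
    = \<alpha> * (\<integral>x. flux D x \<bullet> weak_grad (dom D) v x \<partial>M) + \<beta> * (\<integral>x. flux D x \<bullet> weak_grad (dom D) w x \<partial>M)"
    by (rule integral_linear_AE; (intro fi weak_grad(1) H1 u)?)
      (rule eventually_mono[OF ae], simp add: inner_right_distrib)
  ultimately show ?thesis unfolding rhs_def by (simp add: algebra_simps)
qed

lemma polynomial_le_linear:
  assumes "polynomial_le p q" "polynomial_le p s"
  shows "polynomial_le p (\<lambda>x. \<alpha> * q x + \<beta> * s x)"
proof -
  obtain a b where
    a: "\<And>x. q x = (\<Sum>\<gamma> | (\<Sum>i\<in>UNIV. \<gamma> i) \<le> p. a \<gamma> * (\<Prod>i\<in>UNIV. (x $ i) ^ \<gamma> i))" and
    b: "\<And>x. s x = (\<Sum>\<gamma> | (\<Sum>i\<in>UNIV. \<gamma> i) \<le> p. b \<gamma> * (\<Prod>i\<in>UNIV. (x $ i) ^ \<gamma> i))"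
    using assms unfolding polynomial_le_def by blast
  show ?thesis
    unfolding polynomial_le_def a b
    by (intro exI[of _ "\<lambda>\<gamma>. \<alpha> * a \<gamma> + \<beta> * b \<gamma>"])
       (simp add: sum_distrib_left sum.distrib[symmetric] algebra_simps)
qed

lemma fe_space_linear:
  assumes v: "v \<in> fe_space D p \<T>" and w: "w \<in> fe_space D p \<T>"
  shows "(\<lambda>x. \<alpha> * v x + \<beta> * w x) \<in> fe_space D p \<T>"
proof -
  have "\<exists>q. polynomial_le p q \<and> (\<forall>x\<in>geo T. \<alpha> * v x + \<beta> * w x = q x)" if "T \<in> \<T>" for T
  proof -
    obtain q s where "polynomial_le p q" "polynomial_le p s"
      and eq: "\<forall>x\<in>geo T. v x = q x" "\<forall>x\<in>geo T. w x = s x"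
      using v w \<open>T \<in> \<T>\<close> unfolding fe_space_def by blast
    from polynomial_le_linear[OF this(1,2), of \<alpha> \<beta>] eq
    show ?thesis by (intro exI[of _ "\<lambda>x. \<alpha> * q x + \<beta> * s x"]) simp
  qed
  moreover have "(\<lambda>x. \<alpha> * v x + \<beta> * w x) \<in> H10 (dom D)"
    using v w by (intro H10_linear) (auto simp: fe_space_def)
  moreover have "continuous_on (closure (dom D)) (\<lambda>x. \<alpha> * v x + \<beta> * w x)"
    using v w unfolding fe_space_def by (intro continuous_intros) auto
  ultimately show ?thesis using v w unfolding fe_space_def by simp
qed

lemma fe_space_H10: "v \<in> fe_space D p \<T> \<Longrightarrow> v \<in> H10 (dom D)"
  by (simp add: fe_space_def)

end

section \<open>Quasi-orthogonality of Galerkin solutions\<close>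

text \<open>Boundedness is measured against the diagonal of \<open>b\<close> itself, so that the
  arguments below involve one norm only. Vectors are real functions under pointwise operations;
  \<kappa> will be the ratio of the boundedness and ellipticity constants.\<close>

locale coercive_form =
  fixes V :: "('a \<Rightarrow> real) set" and b :: "('a \<Rightarrow> real) \<Rightarrow> ('a \<Rightarrow> real) \<Rightarrow> real" and \<kappa> :: real
  assumes V_linear: "v \<in> V \<Longrightarrow> w \<in> V \<Longrightarrow> (\<lambda>x. \<alpha> * v x + \<beta> * w x) \<in> V"
    and V_nonempty: "V \<noteq> {}"
    and b_linear_left: "v \<in> V \<Longrightarrow> w \<in> V \<Longrightarrow> z \<in> V \<Longrightarrow>
      b (\<lambda>x. \<alpha> * v x + \<beta> * w x) z = \<alpha> * b v z + \<beta> * b w z"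
    and b_linear_right: "v \<in> V \<Longrightarrow> w \<in> V \<Longrightarrow> z \<in> V \<Longrightarrow>
      b z (\<lambda>x. \<alpha> * v x + \<beta> * w x) = \<alpha> * b z v + \<beta> * b z w"
    and b_nonneg: "v \<in> V \<Longrightarrow> b v v \<ge> 0"
    and \<kappa>_ge_1: "\<kappa> \<ge> 1"
    and b_bounded: "v \<in> V \<Longrightarrow> w \<in> V \<Longrightarrow> \<bar>b v w\<bar> \<le> \<kappa> * (sqrt (b v v) * sqrt (b w w))"
begin

definition N :: "('a \<Rightarrow> real) \<Rightarrow> real" where
  "N v = sqrt (b v v)"

abbreviation gap :: "('a \<Rightarrow> real) \<Rightarrow> ('a \<Rightarrow> real) \<Rightarrow> real" where
  "gap v w \<equiv> N (\<lambda>x. v x - w x)"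

lemma N_nonneg: "v \<in> V \<Longrightarrow> N v \<ge> 0" and N_sq: "v \<in> V \<Longrightarrow> (N v)\<^sup>2 = b v v"
  using b_nonneg by (auto simp: N_def)

lemma b_le: "v \<in> V \<Longrightarrow> w \<in> V \<Longrightarrow> b v w \<le> \<kappa> * (N v * N w)"
  using b_bounded[of v w] by (simp add: N_def)

lemma V_add: "v \<in> V \<Longrightarrow> w \<in> V \<Longrightarrow> (\<lambda>x. v x + w x) \<in> V"
  using V_linear[of v w 1 1] by simp

lemma V_diff: "v \<in> V \<Longrightarrow> w \<in> V \<Longrightarrow> (\<lambda>x. v x - w x) \<in> V"
  using V_linear[of v w 1 "-1"] by simp

lemma V_zero: "(\<lambda>x. 0) \<in> V"
  using V_nonempty V_linear[of _ _ 0 0] by fastforce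

lemma b_add_left: "v \<in> V \<Longrightarrow> w \<in> V \<Longrightarrow> z \<in> V \<Longrightarrow> b (\<lambda>x. v x + w x) z = b v z + b w z"
  using b_linear_left[of v w z 1 1] by simp

lemma b_add_right: "v \<in> V \<Longrightarrow> w \<in> V \<Longrightarrow> z \<in> V \<Longrightarrow> b z (\<lambda>x. v x + w x) = b z v + b z w"
  using b_linear_right[of v w z 1 1] by simp

lemma b_diff_left: "v \<in> V \<Longrightarrow> w \<in> V \<Longrightarrow> z \<in> V \<Longrightarrow> b (\<lambda>x. v x - w x) z = b v z - b w z"
  using b_linear_left[of v w z 1 "-1"] by simp

lemma b_diff_right: "v \<in> V \<Longrightarrow> w \<in> V \<Longrightarrow> z \<in> V \<Longrightarrow> b z (\<lambda>x. v x - w x) = b z v - b z w"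
  using b_linear_right[of v w z 1 "-1"] by simp

lemma b_zero: "z \<in> V \<Longrightarrow> b (\<lambda>x. 0) z = 0" "z \<in> V \<Longrightarrow> b z (\<lambda>x. 0) = 0"
  using b_linear_left[OF V_zero V_zero, of z 0 0] b_linear_right[OF V_zero V_zero, of z 0 0] by auto

lemma V_sum:
  assumes "finite A" "\<And>k. k \<in> A \<Longrightarrow> f k \<in> V"
  shows "(\<lambda>x. \<Sum>k\<in>A. f k x) \<in> V"
  using assms by (induction A rule: finite_induct) (simp_all add: V_zero V_add)

lemma b_sum_left:
  assumes "finite A" "\<And>k. k \<in> A \<Longrightarrow> f k \<in> V" "z \<in> V"
  shows "b (\<lambda>x. \<Sum>k\<in>A. f k x) z = (\<Sum>k\<in>A. b (f k) z)"
  using assms by (induction A rule: finite_induct) (simp_all add: b_zero b_add_left V_sum)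

lemma b_sum_right:
  assumes "finite A" "\<And>k. k \<in> A \<Longrightarrow> f k \<in> V" "z \<in> V"
  shows "b z (\<lambda>x. \<Sum>k\<in>A. f k x) = (\<Sum>k\<in>A. b z (f k))"
  using assms by (induction A rule: finite_induct) (simp_all add: b_zero b_add_right V_sum)

text \<open>The mixed terms \<open>b v w\<close> and \<open>b w v\<close> cancel between the two
  squares, so the law holds for nonsymmetric \<open>b\<close>.\<close>

lemma parallelogram:
  assumes "v \<in> V" "w \<in> V"
  shows "(N (\<lambda>x. v x + w x))\<^sup>2 + (gap v w)\<^sup>2 = 2 * ((N v)\<^sup>2 + (N w)\<^sup>2)"
  using assms
  by (simp add: N_sq V_add V_diff b_add_left b_add_right b_diff_left b_diff_right)

text \<open>Dropping the second square in the parallelogram law costs the factor 2. All later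
  constants are qualitative, so this substitute for the triangle inequality suffices.\<close>

lemma N_add_le:
  assumes "v \<in> V" "w \<in> V"
  shows "N (\<lambda>x. v x + w x) \<le> 2 * (N v + N w)"
proof (rule power2_le_imp_le)
  have "(N (\<lambda>x. v x + w x))\<^sup>2 \<le> 2 * ((N v)\<^sup>2 + (N w)\<^sup>2)"
    using parallelogram[OF assms] by (smt (verit) zero_le_power2)
  also have "\<dots> \<le> (2 * (N v + N w))\<^sup>2"
    using N_nonneg[OF assms(1)] N_nonneg[OF assms(2)] mult_nonneg_nonneg[of "N v" "N w"]
      zero_le_power2[of "N v"] zero_le_power2[of "N w"]
    by (simp add: power_mult_distrib power2_sum)
  finally show "(N (\<lambda>x. v x + w x))\<^sup>2 \<le> (2 * (N v + N w))\<^sup>2" .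
qed (use assms N_nonneg in simp)

lemma N_minus_commute:
  assumes "v \<in> V" "w \<in> V"
  shows "gap v w = gap w v"
  using assms by (simp add: N_def b_diff_left b_diff_right V_diff)

lemma N_diff_le:
  assumes "u \<in> V" "v \<in> V" "w \<in> V"
  shows "gap u w \<le> 2 * (gap u v + gap v w)"
  using N_add_le[OF V_diff[OF assms(1,2)] V_diff[OF assms(2,3)]] by simp

text \<open>The argument of Cea's lemma: boundedness of \<open>b\<close> turns the assumption into a
  bound of the square of \<open>N v\<close> by \<open>\<kappa> * (N v * N w)\<close>, and one factor
  \<open>N v\<close> cancels.\<close>

lemma N_le_if_orthogonal:
  assumes "v \<in> V" "w \<in> V" and eq: "b v v \<le> b w v \<or> b v v \<le> b v w"
  shows "N v \<le> \<kappa> * N w"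
proof (cases "N v = 0")
  case True
  then show ?thesis using N_nonneg[OF assms(2)] \<kappa>_ge_1 by simp
next
  case False
  then have pos: "N v > 0" using N_nonneg[OF assms(1)] by simp
  have "(N v)\<^sup>2 \<le> \<kappa> * (N w * N v)"
    using eq b_le[OF assms(2,1)] b_le[OF assms(1,2)] by (auto simp: N_sq[OF assms(1)] mult.commute)
  then have "N v * N v \<le> (\<kappa> * N w) * N v" by (simp add: power2_eq_square mult.assoc)
  then show ?thesis using pos by simp
qed

text \<open>In the parallelogram law the square of \<open>N (v + w)\<close> is twice the sum of
  squares minus the square of \<open>gap v w\<close>. If \<open>b v w = 0\<close>, both
  \<open>N v\<close> and \<open>N w\<close> are at most \<open>\<kappa> * gap v w\<close>, so the
  subtracted term is at least the sum of squares divided by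
  \<open>2 * \<kappa>\<^sup>2\<close>.\<close>

definition \<sigma> :: real where
  "\<sigma> = 2 - 1 / (2 * \<kappa>\<^sup>2)"

lemma \<sigma>_bounds: "1 \<le> \<sigma>" "\<sigma> < 2"
proof -
  have "1 \<le> \<kappa>\<^sup>2" using \<kappa>_ge_1 by (simp add: one_le_power)
  then have "1 / (2 * \<kappa>\<^sup>2) \<le> 1" "1 / (2 * \<kappa>\<^sup>2) > 0"
    by (auto simp: divide_le_eq_1 intro!: divide_pos_pos)
  then show "1 \<le> \<sigma>" "\<sigma> < 2" by (auto simp: \<sigma>_def)
qed

lemma N_add_sq_le_if_orthogonal:
  assumes v: "v \<in> V" and w: "w \<in> V" and orth: "b v w = 0"
  shows "(N (\<lambda>x. v x + w x))\<^sup>2 \<le> \<sigma> * ((N v)\<^sup>2 + (N w)\<^sup>2)"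
proof -
  let ?d = "\<lambda>x. v x - w x"
  have d: "?d \<in> V" using v w by (rule V_diff)
  \<comment> \<open>Orthogonality in one order serves both vectors:
    \<open>b v v = b v (v - w)\<close> and \<open>b w w = b (w - v) w\<close>.\<close>
  have "N v \<le> \<kappa> * N ?d" using v w orth by (intro N_le_if_orthogonal d) (simp_all add: b_diff_right)
  then have 1: "(N v)\<^sup>2 \<le> \<kappa>\<^sup>2 * (N ?d)\<^sup>2"
    using power_mono[of "N v" "\<kappa> * N ?d" 2] N_nonneg[OF v] by (simp add: power_mult_distrib)
  have "N w \<le> \<kappa> * gap w v"
    using v w orth by (intro N_le_if_orthogonal V_diff) (simp_all add: b_diff_left)
  then have "N w \<le> \<kappa> * N ?d" using N_minus_commute[OF v w] by simp
  then have 2: "(N w)\<^sup>2 \<le> \<kappa>\<^sup>2 * (N ?d)\<^sup>2"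
    using power_mono[of "N w" "\<kappa> * N ?d" 2] N_nonneg[OF w] by (simp add: power_mult_distrib)
  have "((N v)\<^sup>2 + (N w)\<^sup>2) / (2 * \<kappa>\<^sup>2) \<le> (N ?d)\<^sup>2"
    using 1 2 \<kappa>_ge_1 by (simp add: field_simps)
  then show ?thesis
    using parallelogram[OF v w] unfolding \<sigma>_def by (simp add: algebra_simps add_divide_distrib)
qed

text \<open>The two halves of the block are again orthogonal in one order, so every bisection
  contributes 2 for the two halves and \<sigma> for adding them, in place of the 4 of the triangle
  inequality.\<close>

lemma N_sum_sq_le_if_orthogonal:
  fixes w :: "nat \<Rightarrow> 'a \<Rightarrow> real"
  assumes w: "\<And>k. w k \<in> V" and orth: "\<And>j k. j < k \<Longrightarrow> b (w j) (w k) = 0"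
    and bound: "\<And>k. i \<le> k \<Longrightarrow> k < i + 2 ^ m \<Longrightarrow> N (w k) \<le> R"
  shows "(N (\<lambda>x. \<Sum>k\<in>{i..<i + 2 ^ m}. w k x))\<^sup>2 \<le> (2 * \<sigma>) ^ m * R\<^sup>2"
  using bound
proof (induction m arbitrary: i)
  case 0
  have "N (w i) \<le> R" using 0 by simp
  then show ?case using N_nonneg[OF w] by (simp add: power_mono)
next
  case (Suc m)
  let ?y = "\<lambda>x. \<Sum>k\<in>{i..<i + 2 ^ m}. w k x" and ?z = "\<lambda>x. \<Sum>k\<in>{i + 2 ^ m..<i + 2 ^ m + 2 ^ m}. w k x"
  have V: "?y \<in> V" "?z \<in> V" by (intro V_sum w; simp)+
  have "b ?y ?z = (\<Sum>j\<in>{i..<i + 2 ^ m}. \<Sum>k\<in>{i + 2 ^ m..<i + 2 ^ m + 2 ^ m}. b (w j) (w k))"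
    by (simp add: b_sum_left b_sum_right w V)
  also have "\<dots> = 0" by (intro sum.neutral ballI orth) auto
  finally have 0: "b ?y ?z = 0" .
  have "(\<lambda>x. \<Sum>k\<in>{i..<i + 2 ^ Suc m}. w k x) = (\<lambda>x. ?y x + ?z x)"
    by (intro ext) (simp add: sum.atLeastLessThan_concat mult_2 add.assoc[symmetric])
  then have "(N (\<lambda>x. \<Sum>k\<in>{i..<i + 2 ^ Suc m}. w k x))\<^sup>2 \<le> \<sigma> * ((N ?y)\<^sup>2 + (N ?z)\<^sup>2)"
    using N_add_sq_le_if_orthogonal[OF V 0] by simp
  also have "\<dots> \<le> \<sigma> * ((2 * \<sigma>) ^ m * R\<^sup>2 + (2 * \<sigma>) ^ m * R\<^sup>2)"
    using \<sigma>_bounds by (intro mult_left_mono add_mono Suc.IH Suc.prems) auto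
  finally show ?case by (simp add: algebra_simps)
qed

text \<open>The increments \<open>d\<close> of the Galerkin solutions are only left-orthogonal to the coarser spaces.
  Their adjoint counterparts \<open>w\<close>, obtained by subtracting the adjoint Galerkin projections, form a
  system that is biorthogonal to \<open>d\<close>, so that the square sum of \<open>d\<close> is the pairing of the two
  sums. The sum of the \<open>w\<close> grows more slowly than the triangle inequality predicts.\<close>
lemma quasi_orthogonality:
  assumes X: "\<And>k. X k \<subseteq> V" "\<And>k. X k \<subseteq> X (Suc k)"
    and X_diff: "\<And>k v w. v \<in> X k \<Longrightarrow> w \<in> X k \<Longrightarrow> (\<lambda>x. v x - w x) \<in> X k"
    and u: "\<And>k. u k \<in> X k"
    and orth: "\<And>k v. v \<in> X k \<Longrightarrow> b (\<lambda>x. u (Suc k) x - u k x) v = 0"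
    and adj: "\<And>k d. d \<in> V \<Longrightarrow> \<exists>w\<in>X k. \<forall>v\<in>X k. b v w = b v d"
    and R: "\<And>j k. j \<le> k \<Longrightarrow> k \<le> 2 ^ m \<Longrightarrow> gap (u k) (u j) \<le> R"
  shows "(\<Sum>k<2 ^ m. (gap (u (Suc k)) (u k))\<^sup>2) \<le> \<kappa>\<^sup>2 * sqrt ((2 * \<sigma>) ^ m) * R\<^sup>2"
proof -
  define d where "d = (\<lambda>k x. u (Suc k) x - u k x)"
  have mono: "X j \<subseteq> X k" if "j \<le> k" for j k using that by (rule lift_Suc_mono_le[of X, OF X(2)])
  have dX: "d k \<in> X (Suc k)" for k
    unfolding d_def using u[of "Suc k"] u[of k] X(2)[of k] by (intro X_diff) auto
  have dV: "d k \<in> V" for k using dX X(1) by blast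
  have "\<forall>k. \<exists>p. p \<in> X k \<and> (\<forall>v\<in>X k. b v p = b v (d k))"
    using adj[OF dV] by blast
  from choice[OF this] obtain P where P: "\<And>k. P k \<in> X k" "\<And>k v. v \<in> X k \<Longrightarrow> b v (P k) = b v (d k)"
    by blast
  define w where "w = (\<lambda>k x. d k x - P k x)"
  have PV: "P k \<in> V" for k using P(1) X(1) by blast
  have wX: "w k \<in> X (Suc k)" for k
    unfolding w_def using dX[of k] P(1)[of k] X(2)[of k] by (intro X_diff) auto
  have wV: "w k \<in> V" for k using wX X(1) by blast
  have orth_w: "b v (w k) = 0" if "v \<in> X k" for v k
    unfolding w_def using P(2)[OF that] that X(1) dV PV by (subst b_diff_right) auto
  have orth_d: "b (d k) v = 0" if "v \<in> X k" for v k
    unfolding d_def by (rule orth[OF that])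
  have ww: "b (w j) (w k) = 0" if "j < k" for j k
    using wX[of j] mono[of "Suc j" k] that by (intro orth_w) auto
  \<comment> \<open>For \<open>j < k\<close> the right-orthogonality of \<open>w k\<close> applies
    to \<open>d j \<in> X k\<close>; for \<open>j > k\<close> the left-orthogonality of
    \<open>d j\<close> applies to \<open>w k \<in> X j\<close>.\<close>
  have dw: "b (d j) (w k) = (if j = k then (N (d k))\<^sup>2 else 0)" for j k
  proof (cases j k rule: linorder_cases)
    case less
    then show ?thesis using dX[of j] mono[of "Suc j" k] orth_w by auto
  next
    case equal
    have "b (d k) (w k) = b (d k) (d k) - b (d k) (P k)"
      unfolding w_def by (intro b_diff_right dV PV)
    with equal show ?thesis using orth_d[OF P(1)] N_sq[OF dV] by simp
  next
    case greater
    then show ?thesis using wX[of k] mono[of "Suc k" j] orth_d by auto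
  qed
  have Nd: "N (d k) \<le> R" if "k < 2 ^ m" for k
    unfolding d_def using that by (intro R) auto
  have R0: "R \<ge> 0" using Nd[of 0] N_nonneg[OF dV, of 0] by simp
  \<comment> \<open>\<open>P k \<in> X k\<close> drops out in the first argument:
    \<open>b (w k) (w k) = b (d k) (w k)\<close>.\<close>
  have "N (w k) \<le> \<kappa> * N (d k)" for k
  proof (rule N_le_if_orthogonal[OF wV dV])
    have "b (w k) (w k) = b (d k) (w k) - b (P k) (w k)"
      using b_diff_left[OF dV PV wV, of k k k] by (simp add: w_def)
    then show "b (w k) (w k) \<le> b (d k) (w k) \<or> b (w k) (w k) \<le> b (w k) (d k)"
      using orth_w[OF P(1)] by simp
  qed
  then have Nw: "N (w k) \<le> \<kappa> * R" if "k < 2 ^ m" for k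
    using Nd[OF that] \<kappa>_ge_1 by (meson mult_left_mono order_trans zero_le_one)
  let ?W = "\<lambda>x. \<Sum>k\<in>{0..<0 + 2 ^ m}. w k x"
  have W: "?W \<in> V" by (intro V_sum wV) simp
  have "(N ?W)\<^sup>2 \<le> (2 * \<sigma>) ^ m * (\<kappa> * R)\<^sup>2"
    by (intro N_sum_sq_le_if_orthogonal wV ww Nw) auto
  then have "N ?W \<le> sqrt ((2 * \<sigma>) ^ m * (\<kappa> * R)\<^sup>2)"
    by (rule real_le_rsqrt)
  also have "\<dots> = sqrt ((2 * \<sigma>) ^ m) * (\<kappa> * R)"
    using \<kappa>_ge_1 R0 by (simp add: real_sqrt_mult)
  finally have NW: "N ?W \<le> sqrt ((2 * \<sigma>) ^ m) * (\<kappa> * R)" .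
  have U: "(\<lambda>x. \<Sum>j<2 ^ m. d j x) = (\<lambda>x. u (2 ^ m) x - u 0 x)"
    unfolding d_def by (rule ext) (rule sum_lessThan_telescope[where f="\<lambda>k. u k _"])
  \<comment> \<open>By biorthogonality the square sum equals the full double sum, which is
    \<open>b\<close> of the two summed systems. The sum of \<open>d\<close> telescopes, so its norm
    is bounded by \<open>R\<close> whatever \<open>m\<close> is; only \<open>?W\<close> contributes
    growth.\<close>
  have "(\<Sum>k<2 ^ m. (N (d k))\<^sup>2) = (\<Sum>k\<in>{0..<0 + 2 ^ m}. \<Sum>j<2 ^ m. b (d j) (w k))"
    by (auto simp: dw sum.delta lessThan_atLeast0 intro!: sum.cong)
  also have "\<dots> = (\<Sum>j<2 ^ m. \<Sum>k\<in>{0..<0 + 2 ^ m}. b (d j) (w k))"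
    by (rule sum.swap)
  also have "\<dots> = b (\<lambda>x. \<Sum>j<2 ^ m. d j x) ?W"
    by (simp add: b_sum_left b_sum_right dV wV V_sum)
  also have "\<dots> = b (\<lambda>x. u (2 ^ m) x - u 0 x) ?W" unfolding U ..
  also have "\<dots> \<le> \<kappa> * (gap (u (2 ^ m)) (u 0) * N ?W)"
    using W u X(1) by (intro b_le V_diff) auto
  also have "\<dots> \<le> \<kappa> * (R * (sqrt ((2 * \<sigma>) ^ m) * (\<kappa> * R)))"
    using NW R[of 0 "2 ^ m"] R0 \<kappa>_ge_1 N_nonneg[OF W] by (intro mult_left_mono mult_mono) auto
  finally show ?thesis unfolding d_def by (simp add: power2_eq_square algebra_simps)
qed

end

section \<open>Geometric decay from contraction over blocks\<close>

text \<open>Rounding \<open>k - j\<close> down to a multiple of \<open>n\<close> loses less than one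
  block, whence the factor \<open>1 / q\<close>; quasi-monotonicity covers the remainder with
  \<open>C\<close>. The horizon \<open>L\<close> restricts everything to indices that exist, as
  solver iterates end at the stopping index.\<close>

lemma geometric_decay_of_blocks:
  fixes g :: "nat \<Rightarrow> real"
  assumes n: "n \<ge> 1" and q: "0 < q" "q < 1" and C: "C \<ge> 1"
    and nonneg: "\<And>k. k \<le> L \<Longrightarrow> g k \<ge> 0"
    and mono: "\<And>j k. j \<le> k \<Longrightarrow> k \<le> L \<Longrightarrow> g k \<le> C * g j"
    and block: "\<And>k. k + n \<le> L \<Longrightarrow> g (k + n) \<le> q * g k"
    and jk: "j \<le> k" "k \<le> L"
  shows "g k \<le> C / q * root n q ^ (k - j) * g j"
proof -
  have pow: "g (j + n * i) \<le> q ^ i * g j" if "j + n * i \<le> L" for i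
    using that
  proof (induction i)
    case (Suc i)
    then have "g (j + n * i + n) \<le> q * g (j + n * i)" by (intro block) (simp add: algebra_simps)
    also have "\<dots> \<le> q * (q ^ i * g j)" using Suc q by (intro mult_left_mono Suc.IH) auto
    finally show ?case by (simp add: algebra_simps)
  qed simp
  let ?\<rho> = "root n q" and ?i = "(k - j) div n"
  have \<rho>: "?\<rho> ^ n = q" "0 < ?\<rho>" "?\<rho> < 1" using n q by auto
  have i: "j + n * ?i \<le> k" using times_div_less_eq_dividend[of n "k - j"] jk by linarith
  have "g k \<le> C * g (j + n * ?i)" using i jk by (intro mono) auto
  also have "\<dots> \<le> C * (q ^ ?i * g j)" using i jk C by (intro mult_left_mono pow) auto
  also have "q ^ ?i \<le> ?\<rho> ^ (k - j) / q"
  proof -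
    have "?\<rho> ^ (k - j) = ?\<rho> ^ (n * ?i) * ?\<rho> ^ ((k - j) mod n)"
      by (simp add: power_add[symmetric])
    moreover have "?\<rho> ^ n \<le> ?\<rho> ^ ((k - j) mod n)" using \<rho> n by (intro power_decreasing) (auto intro: less_imp_le)
    ultimately have "q ^ ?i * q \<le> ?\<rho> ^ (k - j)"
      using \<rho> q by (simp add: power_mult mult_left_mono)
    then show ?thesis using q by (simp add: field_simps)
  qed
  finally show ?thesis
    using C nonneg[of j] jk by (simp add: mult_right_mono algebra_simps)
qed

context coercive_form
begin

text \<open>Up to a constant, the bound for the mean of the squared estimators over a block of
  length \<open>2 ^ m\<close>, relative to the square at its start. It vanishes for large
  \<open>m\<close> because \<open>sqrt (2 * \<sigma>) < 2\<close>.\<close>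

definition block_factor :: "real \<Rightarrow> nat \<Rightarrow> real" where
  "block_factor C m = (1 + C * sqrt ((2 * \<sigma>) ^ m)) / 2 ^ m"

lemma block_factor_tendsto_0: "block_factor C \<longlonglongrightarrow> 0"
proof -
  have "(1 + C * sqrt ((2 * \<sigma>) ^ m)) / 2 ^ m = (1 / 2) ^ m + C * (sqrt (\<sigma> / 2)) ^ m" for m
  proof -
    have "sqrt (2 * \<sigma>) / 2 = sqrt (\<sigma> / 2)"
      using real_sqrt_divide[of "2 * \<sigma>" 4] by simp
    then have eq: "sqrt ((2 * \<sigma>) ^ m) / 2 ^ m = (sqrt (\<sigma> / 2)) ^ m"
      unfolding real_sqrt_power power_divide[symmetric] by simp
    have "(1 + C * sqrt ((2 * \<sigma>) ^ m)) / 2 ^ m = 1 / 2 ^ m + C * (sqrt ((2 * \<sigma>) ^ m) / 2 ^ m)"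
      by (simp add: add_divide_distrib)
    then show ?thesis unfolding eq by (simp add: power_one_over)
  qed
  moreover have "(\<lambda>m. (1 / 2 :: real) ^ m + C * (sqrt (\<sigma> / 2)) ^ m) \<longlonglongrightarrow> 0 + C * 0"
  proof (intro tendsto_add tendsto_mult tendsto_const LIMSEQ_power_zero)
    show "norm (sqrt (\<sigma> / 2)) < 1" using \<sigma>_bounds by (simp add: real_sqrt_lt_1_iff)
  qed simp
  ultimately show ?thesis by (simp only: block_factor_def[abs_def] add_0 mult_zero_right)
qed

text \<open>Summing the squared recursion over a block bounds the square sum of \<open>g\<close> by
  a sublinear factor times the square of \<open>g l\<close>. By quasi-monotonicity each summand is
  at least a fixed multiple of the square of the last value, which must therefore be small once the
  block is long.\<close>

lemma estimator_decay:
  fixes X :: "nat \<Rightarrow> ('a \<Rightarrow> real) set" and u :: "nat \<Rightarrow> 'a \<Rightarrow> real" and g :: "nat \<Rightarrow> real"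
  assumes X: "\<And>k. X k \<subseteq> V" "\<And>k. X k \<subseteq> X (Suc k)"
    and X_diff: "\<And>k v w. v \<in> X k \<Longrightarrow> w \<in> X k \<Longrightarrow> (\<lambda>x. v x - w x) \<in> X k"
    and u: "\<And>k. u k \<in> X k"
    and orth: "\<And>k v. v \<in> X k \<Longrightarrow> b (\<lambda>x. u (Suc k) x - u k x) v = 0"
    and adj: "\<And>k d. d \<in> V \<Longrightarrow> \<exists>w\<in>X k. \<forall>v\<in>X k. b v w = b v d"
    and g: "\<And>k. g k \<ge> 0" and q: "0 < q" "q < 1" and c: "c > 0" and C: "C > 0"
    and step: "\<And>k. g (Suc k) \<le> q * g k + c * gap (u (Suc k)) (u k)"
    and rel: "\<And>j k. j \<le> k \<Longrightarrow> gap (u k) (u j) \<le> C * g j"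
  shows "\<exists>\<rho> C. 0 < \<rho> \<and> \<rho> < 1 \<and> C \<ge> 1 \<and> (\<forall>j k. j \<le> k \<longrightarrow> g k \<le> C * \<rho> ^ (k - j) * g j)"
proof -
  define d where "d = (\<lambda>k. gap (u (Suc k)) (u k))"
  have V: "u k \<in> V" for k using u X(1) by blast
  have d0: "d k \<ge> 0" for k unfolding d_def by (intro N_nonneg V_diff V)
  \<comment> \<open>Both solutions are compared with \<open>u l\<close>; the two terms and the
    factor 2 of \<open>N_diff_le\<close> give 4.\<close>
  have osc: "gap (u k) (u j) \<le> 4 * C * g l" if "l \<le> j" "j \<le> k" for j k l
  proof -
    have "gap (u k) (u j) \<le> 2 * (gap (u k) (u l) + gap (u l) (u j))"
      by (intro N_diff_le V)
    also have "gap (u l) (u j) = gap (u j) (u l)" by (intro N_minus_commute V)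
    also have "2 * (gap (u k) (u l) + gap (u j) (u l)) \<le> 2 * (C * g l + C * g l)"
      using that by (intro mult_left_mono add_mono rel) auto
    finally show ?thesis by (simp add: mult.assoc)
  qed
  \<comment> \<open>\<open>Cm\<close> is a bound that the recursion cannot leave:
    \<open>q * Cm + 4 * c * C \<le> Cm\<close>.\<close>
  define Cm where "Cm = 1 + 4 * c * C / (1 - q)"
  have Cm: "Cm \<ge> 1" using q c C by (simp add: Cm_def)
  have mono: "g k \<le> Cm * g l" if "l \<le> k" for l k
    using that
  proof (induction k rule: dec_induct)
    case base
    show ?case using mult_right_mono[OF Cm g[of l]] by simp
  next
    case (step k)
    have "g (Suc k) \<le> q * g k + c * d k" using assms(12) by (simp add: d_def)
    also have "\<dots> \<le> q * (Cm * g l) + c * (4 * C * g l)"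
      using step.IH osc[of l k "Suc k"] step.hyps q c by (intro add_mono mult_left_mono) (auto simp: d_def)
    also have "\<dots> = (q * Cm + 4 * c * C) * g l" by (simp add: algebra_simps)
    also have "q * Cm + 4 * c * C \<le> Cm"
    proof -
      have "(1 - q) * Cm = (1 - q) + 4 * c * C" using q by (simp add: Cm_def field_simps)
      then show ?thesis using q by (simp add: algebra_simps)
    qed
    finally show ?case using g[of l] by (simp add: mult_right_mono)
  qed
  \<comment> \<open>Convexity of the square with weights \<open>q\<close> and \<open>1 - q\<close>,
    applied to \<open>g k\<close> and \<open>c * d k / (1 - q)\<close>, keeps the factor
    \<open>q\<close> in front of \<open>(g k)\<^sup>2\<close>.\<close>
  define C3 where "C3 = c\<^sup>2 / (1 - q)"
  have C3: "C3 > 0" using c q by (simp add: C3_def)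
  have sq: "(g (Suc k))\<^sup>2 \<le> q * (g k)\<^sup>2 + C3 * (d k)\<^sup>2" for k
  proof -
    have "(g (Suc k))\<^sup>2 \<le> (q * g k + c * d k)\<^sup>2"
      using step[of k] g by (intro power_mono) (auto simp: d_def)
    also have "\<dots> \<le> q * (g k)\<^sup>2 + C3 * (d k)\<^sup>2"
    proof -
      define t where "t = c * d k / (1 - q)"
      have t: "c * d k = (1 - q) * t" using q by (simp add: t_def)
      have "C3 * (d k)\<^sup>2 = (1 - q) * t\<^sup>2"
        using q by (simp add: C3_def t_def power_divide power_mult_distrib power2_eq_square[of "1 - q"])
      moreover have "q * (g k)\<^sup>2 + (1 - q) * t\<^sup>2 - (q * g k + (1 - q) * t)\<^sup>2 = q * (1 - q) * (g k - t)\<^sup>2"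
        by (simp add: power2_eq_square algebra_simps)
      moreover have "q * (1 - q) * (g k - t)\<^sup>2 \<ge> 0" using q by simp
      ultimately show ?thesis unfolding t by linarith
    qed
    finally show ?thesis .
  qed
  \<comment> \<open>\<open>C4\<close> collects the constants of the quasi-orthogonality sum;
    \<open>C5\<close> stems from quasi-monotonicity and from absorbing \<open>q\<close> times the
    sum. \<open>C5 * block_factor C4 m\<close> bounds the ratio of the squares over a block, and
    below 1/4 it halves \<open>g\<close>.\<close>
  define C4 where "C4 = C3 * \<kappa>\<^sup>2 * (4 * C)\<^sup>2"
  define C5 where "C5 = Cm\<^sup>2 / (1 - q)"
  have C5: "C5 > 0" using Cm q by (simp add: C5_def)
  have "\<forall>\<^sub>F m in sequentially. block_factor C4 m < 1 / (4 * C5)"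
    using C5 by (intro order_tendstoD(2)[OF block_factor_tendsto_0]) simp
  then obtain m where m: "block_factor C4 m < 1 / (4 * C5)"
    using eventually_sequentially by auto
  define n :: nat where "n = 2 ^ m"
  have n: "n \<ge> 1" by (simp add: n_def)
  have block: "g (l + n) \<le> 1 / 2 * g l" for l
  proof -
    have "(\<Sum>k<2 ^ m. (gap (u (l + Suc k)) (u (l + k)))\<^sup>2) \<le> \<kappa>\<^sup>2 * sqrt ((2 * \<sigma>) ^ m) * (4 * C * g l)\<^sup>2"
    proof (rule quasi_orthogonality[of "\<lambda>k. X (l + k)" "\<lambda>k. u (l + k)"])
      show "X (l + k) \<subseteq> V" "X (l + k) \<subseteq> X (l + Suc k)" "u (l + k) \<in> X (l + k)" for k
        using X[of "l + k"] u by simp_all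
      show "(\<lambda>x. v x - w x) \<in> X (l + k)" if "v \<in> X (l + k)" "w \<in> X (l + k)" for k v w
        by (rule X_diff[OF that])
      show "b (\<lambda>x. u (l + Suc k) x - u (l + k) x) v = 0" if "v \<in> X (l + k)" for k v
        using orth[OF that] by simp
      show "\<exists>w\<in>X (l + k). \<forall>v\<in>X (l + k). b v w = b v d" if "d \<in> V" for k d
        by (rule adj[OF that])
      show "gap (u (l + k)) (u (l + j)) \<le> 4 * C * g l" if "j \<le> k" for j k
        by (rule osc) (use that in simp_all)
    qed
    then have D: "(\<Sum>k<n. (d (l + k))\<^sup>2) \<le> \<kappa>\<^sup>2 * sqrt ((2 * \<sigma>) ^ m) * (4 * C * g l)\<^sup>2"
      by (simp add: d_def n_def)
    let ?S = "\<Sum>k<n. (g (Suc (l + k)))\<^sup>2"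
    \<comment> \<open>Shifting the index by one exchanges the first summand for the last, so that
      \<open>q * ?S\<close> can be absorbed on the left.\<close>
    have tele: "(\<Sum>k<n. (g (l + k))\<^sup>2) \<le> (g l)\<^sup>2 + ?S"
    proof -
      have "(\<Sum>k<Suc n. (g (l + k))\<^sup>2) = (g l)\<^sup>2 + ?S"
        by (simp add: sum.lessThan_Suc_shift del: sum.lessThan_Suc)
      with zero_le_power2[of "g (l + n)"] show ?thesis unfolding sum.lessThan_Suc by linarith
    qed
    have "?S \<le> (\<Sum>k<n. q * (g (l + k))\<^sup>2 + C3 * (d (l + k))\<^sup>2)"
      by (intro sum_mono sq)
    also have "\<dots> = q * (\<Sum>k<n. (g (l + k))\<^sup>2) + C3 * (\<Sum>k<n. (d (l + k))\<^sup>2)"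
      by (simp add: sum.distrib sum_distrib_left)
    also have "\<dots> \<le> q * ((g l)\<^sup>2 + ?S) + C3 * (\<kappa>\<^sup>2 * sqrt ((2 * \<sigma>) ^ m) * (4 * C * g l)\<^sup>2)"
      using q C3 by (intro add_mono mult_left_mono tele D) auto
    finally have "(1 - q) * ?S \<le> q * (g l)\<^sup>2 + C4 * sqrt ((2 * \<sigma>) ^ m) * (g l)\<^sup>2"
      by (simp add: C4_def power_mult_distrib algebra_simps)
    also have "\<dots> \<le> (1 + C4 * sqrt ((2 * \<sigma>) ^ m)) * (g l)\<^sup>2"
      using q by (simp add: algebra_simps mult_left_le_one_le)
    finally have S: "(1 - q) * ?S \<le> (1 + C4 * sqrt ((2 * \<sigma>) ^ m)) * (g l)\<^sup>2" .
    have "real n * (g (l + n))\<^sup>2 = (\<Sum>k<n. (g (l + n))\<^sup>2)" by simp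
    also have "\<dots> \<le> (\<Sum>k<n. Cm\<^sup>2 * (g (Suc (l + k)))\<^sup>2)"
    proof (rule sum_mono)
      fix k assume "k \<in> {..<n}"
      then have "g (l + n) \<le> Cm * g (Suc (l + k))" by (intro mono) auto
      from power_mono[OF this g, of 2] show "(g (l + n))\<^sup>2 \<le> Cm\<^sup>2 * (g (Suc (l + k)))\<^sup>2"
        by (simp add: power_mult_distrib)
    qed
    also have "\<dots> = C5 * ((1 - q) * ?S)" using q by (simp add: C5_def sum_distrib_left)
    also have "\<dots> \<le> C5 * ((1 + C4 * sqrt ((2 * \<sigma>) ^ m)) * (g l)\<^sup>2)"
      using S C5 by (intro mult_left_mono) auto
    finally have "(g (l + n))\<^sup>2 \<le> C5 * block_factor C4 m * (g l)\<^sup>2"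
      by (simp add: n_def block_factor_def field_simps)
    also have "\<dots> \<le> 1 / 4 * (g l)\<^sup>2"
      using m C5 by (intro mult_right_mono) (auto simp: field_simps)
    finally have "(g (l + n))\<^sup>2 \<le> (1 / 2 * g l)\<^sup>2" by (simp add: power2_eq_square)
    then show ?thesis by (rule power2_le_imp_le) (simp add: g)
  qed
  show ?thesis
  proof (intro exI conjI allI impI)
    show "0 < root n (1 / 2)" "root n (1 / 2) < 1" using n by auto
    show "1 \<le> Cm / (1 / 2)" using Cm by simp
    show "g k \<le> Cm / (1 / 2) * root n (1 / 2) ^ (k - j) * g j" if "j \<le> k" for j k
      by (rule geometric_decay_of_blocks[where L=k]) (use n Cm g mono block that in auto)
  qed
qed

end

section \<open>Preconditioned GMRES\<close>

text \<open>\<open>pnorm\<close> contains \<open>the (mat_inverse P)\<close>, so existence of the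
  inverse has to be settled before any property of the norm.\<close>

lemma injective_mat_inverse:
  fixes A :: "real Matrix.mat"
  assumes A: "A \<in> carrier_mat n n"
    and inj: "\<And>x. x \<in> carrier_vec n \<Longrightarrow> A *\<^sub>v x = 0\<^sub>v n \<Longrightarrow> x = 0\<^sub>v n"
  obtains R where "mat_inverse A = Some R" "R \<in> carrier_mat n n" "A * R = 1\<^sub>m n" "R * A = 1\<^sub>m n"
proof -
  have "Determinant.det A \<noteq> 0" using det_0_iff_vec_prod_zero[OF A] inj by blast
  then have "A \<in> Units (ring_mat TYPE(real) n ())" by (rule det_non_zero_imp_unit[OF A])
  then obtain R where R: "mat_inverse A = Some R"
    using mat_inverse(1)[OF A, of "()"] by (cases "mat_inverse A") auto
  from mat_inverse(2)[OF A R] that[OF R] show thesis by simp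
qed

lemma injective_mat_solve:
  fixes A :: "real Matrix.mat"
  assumes A: "A \<in> carrier_mat n n" and e: "e \<in> carrier_vec n"
    and inj: "\<And>x. x \<in> carrier_vec n \<Longrightarrow> A *\<^sub>v x = 0\<^sub>v n \<Longrightarrow> x = 0\<^sub>v n"
  obtains x where "x \<in> carrier_vec n" "A *\<^sub>v x = e"
proof -
  obtain R where R: "R \<in> carrier_mat n n" "A * R = 1\<^sub>m n"
    by (rule injective_mat_inverse[OF A inj])
  have "A *\<^sub>v (R *\<^sub>v e) = (A * R) *\<^sub>v e" by (rule assoc_mult_mat_vec[OF A R(1) e, symmetric])
  also have "\<dots> = e" unfolding R(2) using e by simp
  finally have "A *\<^sub>v (R *\<^sub>v e) = e" .
  with that[of "R *\<^sub>v e"] R(1) e show thesis by simp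
qed

lemma krylov_index:
  assumes "A \<in> carrier_mat n n" "s \<in> carrier_vec n" "c \<in> carrier_vec K" "i < n"
  shows "vec_index (mat_of_cols n (map (\<lambda>i. (A ^\<^sub>m i) *\<^sub>v s) [0..<K]) *\<^sub>v c) i
    = (\<Sum>j<K. vec_index ((A ^\<^sub>m j) *\<^sub>v s) i * vec_index c j)"
  using assms by (simp add: scalar_prod_def mat_of_cols_index lessThan_atLeast0)

lemma krylov_carrier: "z \<in> krylov_space n A s K \<Longrightarrow> z \<in> carrier_vec n"
  unfolding krylov_space_def by (auto intro!: mult_mat_vec_carrier[OF mat_of_cols_carrier(1)])

lemma smult_in_krylov:
  assumes A: "A \<in> carrier_mat n n" and s: "s \<in> carrier_vec n" and K: "K \<ge> 1"
  shows "t \<cdot>\<^sub>v s \<in> krylov_space n A s K"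
proof -
  define c where "c = Matrix.vec K (\<lambda>i. if i = 0 then t else 0)"
  have c: "c \<in> carrier_vec K" by (simp add: c_def)
  have "t \<cdot>\<^sub>v s = mat_of_cols n (map (\<lambda>i. (A ^\<^sub>m i) *\<^sub>v s) [0..<K]) *\<^sub>v c" (is "_ = ?z")
  proof (rule eq_vecI)
    fix i assume "i < dim_vec ?z"
    then have i: "i < n" by simp
    have "vec_index ?z i = (\<Sum>j<K. if j = 0 then vec_index ((A ^\<^sub>m j) *\<^sub>v s) i * t else 0)"
      unfolding krylov_index[OF A s c i] by (intro sum.cong) (auto simp: c_def)
    also have "\<dots> = vec_index ((A ^\<^sub>m 0) *\<^sub>v s) i * t" using K by (simp add: sum.delta)
    finally show "vec_index (t \<cdot>\<^sub>v s) i = vec_index ?z i" using A s i by simp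
  qed (use s in simp)
  with c show ?thesis unfolding krylov_space_def by blast
qed

lemma krylov_Suc:
  assumes A: "A \<in> carrier_mat n n" and s: "s \<in> carrier_vec n" and z: "z \<in> krylov_space n A s K"
  shows "z \<in> krylov_space n A s (Suc K)"
proof -
  let ?M = "\<lambda>K. mat_of_cols n (map (\<lambda>i. (A ^\<^sub>m i) *\<^sub>v s) [0..<K])"
  obtain c where c: "c \<in> carrier_vec K" and zc: "z = ?M K *\<^sub>v c"
    using z unfolding krylov_space_def by blast
  define c' where "c' = Matrix.vec (Suc K) (\<lambda>i. if i < K then vec_index c i else 0)"
  have c': "c' \<in> carrier_vec (Suc K)" by (simp add: c'_def)
  have "?M K *\<^sub>v c = ?M (Suc K) *\<^sub>v c'"
  proof (rule eq_vecI)
    fix i assume "i < dim_vec (?M (Suc K) *\<^sub>v c')"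
    then have i: "i < n" by simp
    show "vec_index (?M K *\<^sub>v c) i = vec_index (?M (Suc K) *\<^sub>v c') i"
      unfolding krylov_index[OF A s c i] krylov_index[OF A s c' i] by (simp add: c'_def)
  qed simp
  with c' zc show ?thesis unfolding krylov_space_def by blast
qed

section \<open>The inner product of the inverse preconditioner\<close>

locale spd_mat =
  fixes n :: nat and P :: "real Matrix.mat"
  assumes spd: "spd n P"
begin

lemma P_carrier: "P \<in> carrier_mat n n"
  using spd by (simp add: spd_def)

lemma P_inverse: "the (mat_inverse P) \<in> carrier_mat n n" "P * the (mat_inverse P) = 1\<^sub>m n"
  "the (mat_inverse P) * P = 1\<^sub>m n"
proof -
  have inj: "x = 0\<^sub>v n" if x: "x \<in> carrier_vec n" "P *\<^sub>v x = 0\<^sub>v n" for x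
  proof (rule ccontr)
    assume "x \<noteq> 0\<^sub>v n"
    with spd x(1) have "scalar_prod (P *\<^sub>v x) x > 0" by (simp add: spd_def)
    with x show False by simp
  qed
  obtain R where "mat_inverse P = Some R" "R \<in> carrier_mat n n" "P * R = 1\<^sub>m n" "R * P = 1\<^sub>m n"
    by (rule injective_mat_inverse[OF P_carrier inj])
  then show "the (mat_inverse P) \<in> carrier_mat n n" "P * the (mat_inverse P) = 1\<^sub>m n"
    "the (mat_inverse P) * P = 1\<^sub>m n" by auto
qed

definition ip :: "real Matrix.vec \<Rightarrow> real Matrix.vec \<Rightarrow> real" where
  "ip x y = scalar_prod (the (mat_inverse P) *\<^sub>v x) y"

lemma P_scalar_prod_comm:
  "x \<in> carrier_vec n \<Longrightarrow> y \<in> carrier_vec n \<Longrightarrow> scalar_prod (P *\<^sub>v x) y = scalar_prod x (P *\<^sub>v y)"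
  using transpose_vec_mult_scalar[OF P_carrier, of y x] spd by (simp add: spd_def)

lemma ip_P: "x \<in> carrier_vec n \<Longrightarrow> ip (P *\<^sub>v x) y = scalar_prod x y"
  using assoc_mult_mat_vec[OF P_inverse(1) P_carrier, of x] P_inverse(3) by (simp add: ip_def)

text \<open>Writing a vector as \<open>P *\<^sub>v a\<close> turns \<open>ip\<close> into a plain
  scalar product by \<open>ip_P\<close>; symmetry, positivity and definiteness are then inherited
  from \<open>P\<close> without studying its inverse.\<close>

lemma P_surj: "x \<in> carrier_vec n \<Longrightarrow> \<exists>a\<in>carrier_vec n. x = P *\<^sub>v a"
  using assoc_mult_mat_vec[OF P_carrier P_inverse(1), of x] P_inverse(1,2)
  by (intro bexI[of _ "the (mat_inverse P) *\<^sub>v x"]) simp_all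

lemma ip_comm: "x \<in> carrier_vec n \<Longrightarrow> y \<in> carrier_vec n \<Longrightarrow> ip x y = ip y x"
proof -
  assume xy: "x \<in> carrier_vec n" "y \<in> carrier_vec n"
  from P_surj[OF xy(1)] P_surj[OF xy(2)] obtain a b
    where ab: "a \<in> carrier_vec n" "x = P *\<^sub>v a" "b \<in> carrier_vec n" "y = P *\<^sub>v b" by blast
  have "scalar_prod a (P *\<^sub>v b) = scalar_prod (P *\<^sub>v a) b" using P_scalar_prod_comm ab by simp
  also have "\<dots> = scalar_prod b (P *\<^sub>v a)" using P_carrier ab by (intro comm_scalar_prod[of _ n]) auto
  finally show ?thesis using ab by (simp add: ip_P)
qed

lemma ip_add_left:
  "x \<in> carrier_vec n \<Longrightarrow> y \<in> carrier_vec n \<Longrightarrow> z \<in> carrier_vec n \<Longrightarrow> ip (x + y) z = ip x z + ip y z"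
  unfolding ip_def
  by (subst mult_add_distrib_mat_vec[OF P_inverse(1)], assumption+, subst add_scalar_prod_distrib[of _ n])
    (auto intro: mult_mat_vec_carrier[OF P_inverse(1)])

lemma ip_smult_left:
  "x \<in> carrier_vec n \<Longrightarrow> z \<in> carrier_vec n \<Longrightarrow> ip (t \<cdot>\<^sub>v x) z = t * ip x z"
  unfolding ip_def
  by (subst mult_mat_vec[OF P_inverse(1)], assumption, subst smult_scalar_prod_distrib[of _ n])
    (auto intro: mult_mat_vec_carrier[OF P_inverse(1)])

lemma ip_nonneg: "x \<in> carrier_vec n \<Longrightarrow> ip x x \<ge> 0"
proof -
  assume "x \<in> carrier_vec n"
  from P_surj[OF this] obtain a where a: "a \<in> carrier_vec n" "x = P *\<^sub>v a" by blast
  have "ip x x = scalar_prod (P *\<^sub>v a) a" using a by (simp add: ip_P P_scalar_prod_comm)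
  moreover have "scalar_prod (P *\<^sub>v a) a \<ge> 0"
  proof (cases "a = 0\<^sub>v n")
    case True
    then show ?thesis using P_carrier by simp
  next
    case False
    then show ?thesis using spd a(1) unfolding spd_def by (auto intro: less_imp_le)
  qed
  ultimately show ?thesis by simp
qed

lemma pnorm_sq: "x \<in> carrier_vec n \<Longrightarrow> (pnorm P x)\<^sup>2 = ip x x"
  using ip_nonneg by (simp add: pnorm_def ip_def)

lemma pnorm_nonneg: "x \<in> carrier_vec n \<Longrightarrow> pnorm P x \<ge> 0"
  using ip_nonneg by (simp add: pnorm_def ip_def)

lemma pnorm_add_smult_sq:
  assumes "x \<in> carrier_vec n" "y \<in> carrier_vec n"
  shows "(pnorm P (x + t \<cdot>\<^sub>v y))\<^sup>2 = (pnorm P x)\<^sup>2 + 2 * t * ip y x + t\<^sup>2 * (pnorm P y)\<^sup>2"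
proof -
  have c: "x + t \<cdot>\<^sub>v y \<in> carrier_vec n" "t \<cdot>\<^sub>v y \<in> carrier_vec n" using assms by auto
  have lin: "ip (x + t \<cdot>\<^sub>v y) z = ip x z + t * ip y z" if "z \<in> carrier_vec n" for z
    using assms c that by (simp add: ip_add_left ip_smult_left)
  have "(pnorm P (x + t \<cdot>\<^sub>v y))\<^sup>2 = ip x (x + t \<cdot>\<^sub>v y) + t * ip y (x + t \<cdot>\<^sub>v y)"
    using lin[OF c(1)] pnorm_sq[OF c(1)] by simp
  also have "ip x (x + t \<cdot>\<^sub>v y) = ip x x + t * ip y x"
    using ip_comm[OF assms(1) c(1)] lin[OF assms(1)] by simp
  also have "ip y (x + t \<cdot>\<^sub>v y) = ip y x + t * ip y y"
    using ip_comm[OF assms(2) c(1)] lin[OF assms(2)] ip_comm[OF assms] by simp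
  finally have "(pnorm P (x + t \<cdot>\<^sub>v y))\<^sup>2 = ip x x + 2 * t * ip y x + t\<^sup>2 * ip y y"
    by (simp add: algebra_simps power2_eq_square)
  then show ?thesis unfolding pnorm_sq[OF assms(1)] pnorm_sq[OF assms(2)] .
qed

text \<open>Cauchy-Schwarz from a nonnegative quadratic polynomial in \<open>t\<close>. If
  \<open>pnorm P x = 0\<close> the polynomial is affine, so its slope cannot be positive.\<close>

lemma ip_le:
  assumes x: "x \<in> carrier_vec n" and y: "y \<in> carrier_vec n"
  shows "ip x y \<le> pnorm P x * pnorm P y"
proof (cases "pnorm P x = 0")
  case True
  have "ip x y \<le> 0"
  proof (rule ccontr)
    assume "\<not> ip x y \<le> 0"
    then have pos: "ip x y > 0" by simp
    \<comment> \<open>At this \<open>t\<close> the affine polynomial takes the value -1.\<close>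
    define t where "t = - ((pnorm P y)\<^sup>2 + 1) / (2 * ip x y)"
    have "0 \<le> (pnorm P (y + t \<cdot>\<^sub>v x))\<^sup>2" by simp
    also have "\<dots> = (pnorm P y)\<^sup>2 + 2 * t * ip x y" using pnorm_add_smult_sq[OF y x, of t] True by simp
    also have "2 * t * ip x y = - ((pnorm P y)\<^sup>2 + 1)" unfolding t_def using pos by simp
    finally show False by simp
  qed
  then show ?thesis using True by simp
next
  case False
  then have p: "pnorm P x > 0" using pnorm_nonneg[OF x] by simp
  \<comment> \<open>The minimizer of the quadratic polynomial.\<close>
  define t where "t = - ip x y / (pnorm P x)\<^sup>2"
  have "0 \<le> (pnorm P (y + t \<cdot>\<^sub>v x))\<^sup>2" by simp
  also have "\<dots> = (pnorm P y)\<^sup>2 + 2 * t * ip x y + t\<^sup>2 * (pnorm P x)\<^sup>2" by (rule pnorm_add_smult_sq[OF y x])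
  also have "\<dots> = (pnorm P y)\<^sup>2 - (ip x y)\<^sup>2 / (pnorm P x)\<^sup>2"
  proof -
    have "t * (pnorm P x)\<^sup>2 = - ip x y" using p by (simp add: t_def)
    then have "t\<^sup>2 * (pnorm P x)\<^sup>2 = - t * ip x y" by (simp add: power2_eq_square[of t] mult.assoc)
    moreover have "t * ip x y = - ((ip x y)\<^sup>2 / (pnorm P x)\<^sup>2)" by (simp add: t_def power2_eq_square)
    ultimately show ?thesis by simp
  qed
  finally have "(ip x y)\<^sup>2 / (pnorm P x)\<^sup>2 \<le> (pnorm P y)\<^sup>2" by simp
  then have "(ip x y)\<^sup>2 \<le> (pnorm P x * pnorm P y)\<^sup>2"
    using p by (simp add: pos_divide_le_eq power_mult_distrib mult.commute)
  then show ?thesis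
    by (rule power2_le_imp_le) (intro mult_nonneg_nonneg pnorm_nonneg x y)
qed

lemma pnorm_eq_0: "x \<in> carrier_vec n \<Longrightarrow> pnorm P x = 0 \<Longrightarrow> x = 0\<^sub>v n"
proof -
  assume x: "x \<in> carrier_vec n" and 0: "pnorm P x = 0"
  from P_surj[OF x] obtain a where a: "a \<in> carrier_vec n" "x = P *\<^sub>v a" by blast
  have "scalar_prod (P *\<^sub>v a) a = 0" using pnorm_sq[OF x] 0 a by (simp add: ip_P P_scalar_prod_comm)
  then have "a = 0\<^sub>v n" using spd a(1) unfolding spd_def by (metis less_irrefl)
  moreover have "P *\<^sub>v 0\<^sub>v n = 0\<^sub>v n" using P_carrier by (intro eq_vecI) auto
  ultimately show ?thesis using a(2) by simp
qed

end

section \<open>Galerkin systems and their residuals\<close>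

text \<open>The two inequalities with \<gamma> are (PRE) with \<open>N\<close> in place of the
  energy norm, so that form and preconditioner are tied by \<kappa> and \<gamma> alone.\<close>

locale galerkin_level = coercive_form V b \<kappa> + spd_mat n P
  for V :: "(real^'n \<Rightarrow> real) set" and b \<kappa> n P +
  fixes X :: "(real^'n \<Rightarrow> real) set" and \<phi> :: "nat \<Rightarrow> real^'n \<Rightarrow> real"
    and F :: "(real^'n \<Rightarrow> real) \<Rightarrow> real" and \<gamma> :: real
  assumes X_V: "X \<subseteq> V"
    and X_linear: "v \<in> X \<Longrightarrow> w \<in> X \<Longrightarrow> (\<lambda>x. \<alpha> * v x + \<beta> * w x) \<in> X"
    and X_zero: "(\<lambda>x. 0) \<in> X"
    and basis: "is_basis n \<phi> X"
    and F_linear: "v \<in> V \<Longrightarrow> w \<in> V \<Longrightarrow> F (\<lambda>x. \<alpha> * v x + \<beta> * w x) = \<alpha> * F v + \<beta> * F w"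
    and \<gamma>_ge_1: "\<gamma> \<ge> 1"
    and pnorm_le: "x \<in> carrier_vec n \<Longrightarrow> pnorm P x \<le> \<gamma> * N (fe_fun n \<phi> x)"
    and le_pnorm: "x \<in> carrier_vec n \<Longrightarrow> N (fe_fun n \<phi> x) \<le> \<gamma> * pnorm P x"
begin

abbreviation fe :: "real Matrix.vec \<Rightarrow> real^'n \<Rightarrow> real" where
  "fe \<equiv> fe_fun n \<phi>"

definition B :: "real Matrix.mat" where
  "B = Matrix.mat n n (\<lambda>(j, k). b (\<phi> k) (\<phi> j))"

definition d :: "real Matrix.vec" where
  "d = Matrix.vec n (\<lambda>j. F (\<phi> j))"

definition s :: "real Matrix.vec \<Rightarrow> real Matrix.vec" where
  "s x = prec_residual P B d x"

lemma B_carrier: "B \<in> carrier_mat n n" and d_carrier: "d \<in> carrier_vec n"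
  by (simp_all add: B_def d_def)

lemma \<phi>_X: "j < n \<Longrightarrow> \<phi> j \<in> X"
  using basis by (simp add: is_basis_def)

lemma \<phi>_V: "j < n \<Longrightarrow> \<phi> j \<in> V"
  using \<phi>_X X_V by blast

lemma fe_coords:
  assumes "v \<in> X" obtains x where "x \<in> carrier_vec n" "v = fe x"
  using assms basis unfolding is_basis_def by blast

text \<open>One induction over the number of summands proves all parts, because each linearity step
  uses the membership of the partial sum.\<close>

lemma fe_expand:
  assumes "m \<le> n"
  shows "(\<lambda>y. \<Sum>j<m. c j * \<phi> j y) \<in> X"
    "z \<in> V \<Longrightarrow> b (\<lambda>y. \<Sum>j<m. c j * \<phi> j y) z = (\<Sum>j<m. c j * b (\<phi> j) z)"
    "z \<in> V \<Longrightarrow> b z (\<lambda>y. \<Sum>j<m. c j * \<phi> j y) = (\<Sum>j<m. c j * b z (\<phi> j))"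
    "F (\<lambda>y. \<Sum>j<m. c j * \<phi> j y) = (\<Sum>j<m. c j * F (\<phi> j))"
proof -
  have F0: "F (\<lambda>x. 0) = 0" using F_linear[OF V_zero V_zero, of 0 0] by simp
  have "(\<lambda>y. \<Sum>j<m. c j * \<phi> j y) \<in> X \<and>
    (\<forall>z\<in>V. b (\<lambda>y. \<Sum>j<m. c j * \<phi> j y) z = (\<Sum>j<m. c j * b (\<phi> j) z) \<and>
       b z (\<lambda>y. \<Sum>j<m. c j * \<phi> j y) = (\<Sum>j<m. c j * b z (\<phi> j))) \<and>
    F (\<lambda>y. \<Sum>j<m. c j * \<phi> j y) = (\<Sum>j<m. c j * F (\<phi> j))"
    using assms
  proof (induction m)
    case 0
    then show ?case using X_zero b_zero F0 by simp
  next
    case (Suc m)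
    let ?f = "\<lambda>y. \<Sum>j<m. c j * \<phi> j y"
    have X: "?f \<in> X" "\<phi> m \<in> X" using Suc \<phi>_X by auto
    then have V: "?f \<in> V" "\<phi> m \<in> V" using X_V by auto
    show ?case
      using Suc X_linear[OF X, of 1 "c m"] F_linear[OF V, of 1 "c m"]
        b_linear_left[OF V, of _ 1 "c m"] b_linear_right[OF V, of _ 1 "c m"]
      by simp
  qed
  then show "(\<lambda>y. \<Sum>j<m. c j * \<phi> j y) \<in> X"
    "z \<in> V \<Longrightarrow> b (\<lambda>y. \<Sum>j<m. c j * \<phi> j y) z = (\<Sum>j<m. c j * b (\<phi> j) z)"
    "z \<in> V \<Longrightarrow> b z (\<lambda>y. \<Sum>j<m. c j * \<phi> j y) = (\<Sum>j<m. c j * b z (\<phi> j))"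
    "F (\<lambda>y. \<Sum>j<m. c j * \<phi> j y) = (\<Sum>j<m. c j * F (\<phi> j))"
    by blast+
qed

lemma fe_X: "fe x \<in> X" and fe_V: "fe x \<in> V"
  using fe_expand(1)[of n "vec_index x"] X_V by (auto simp: fe_fun_def)

lemma fe_diff: "x \<in> carrier_vec n \<Longrightarrow> y \<in> carrier_vec n \<Longrightarrow> fe (x - y) = (\<lambda>z. fe x z - fe y z)"
  by (auto simp: fe_fun_def sum_subtractf[symmetric] algebra_simps intro!: ext sum.cong)

lemma B_scalar_prod:
  assumes "x \<in> carrier_vec n" "y \<in> carrier_vec n"
  shows "scalar_prod (B *\<^sub>v x) y = b (fe x) (fe y)"
proof -
  have "scalar_prod (B *\<^sub>v x) y = (\<Sum>j<n. (\<Sum>k<n. b (\<phi> k) (\<phi> j) * vec_index x k) * vec_index y j)"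
    using assms by (simp add: scalar_prod_def B_def lessThan_atLeast0)
  also have "\<dots> = (\<Sum>j<n. vec_index y j * b (fe x) (\<phi> j))"
    unfolding fe_fun_def by (intro sum.cong refl) (simp add: fe_expand(2) \<phi>_V mult.commute)
  also have "\<dots> = b (fe x) (fe y)"
    unfolding fe_fun_def[of n \<phi> y] by (simp add: fe_expand(3) fe_V)
  finally show ?thesis .
qed

text \<open>Definiteness of \<open>b\<close> on the discrete space is imported from the
  preconditioner: if \<open>N\<close> vanishes, so does the equivalent coefficient norm. It makes
  the Galerkin matrix and its transpose injective, hence their systems solvable.\<close>

lemma fe_N_eq_0: "x \<in> carrier_vec n \<Longrightarrow> b (fe x) (fe x) = 0 \<Longrightarrow> x = 0\<^sub>v n"
  using pnorm_le[of x] pnorm_nonneg[of x] by (intro pnorm_eq_0) (simp_all add: N_def)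

lemma B_injective: "x \<in> carrier_vec n \<Longrightarrow> B *\<^sub>v x = 0\<^sub>v n \<Longrightarrow> x = 0\<^sub>v n"
  using B_scalar_prod[of x x] by (intro fe_N_eq_0) simp_all

lemma B_transpose_scalar_prod:
  assumes "x \<in> carrier_vec n" "y \<in> carrier_vec n"
  shows "scalar_prod (transpose_mat B *\<^sub>v y) x = b (fe x) (fe y)"
proof -
  have "scalar_prod (transpose_mat B *\<^sub>v y) x = scalar_prod y (B *\<^sub>v x)"
    by (rule transpose_vec_mult_scalar[OF B_carrier assms])
  also have "\<dots> = scalar_prod (B *\<^sub>v x) y"
    using assms B_carrier by (intro comm_scalar_prod[of _ n]) auto
  finally show ?thesis using B_scalar_prod[OF assms] by simp
qed

lemma B_transpose_injective:
  assumes "x \<in> carrier_vec n" "transpose_mat B *\<^sub>v x = 0\<^sub>v n" shows "x = 0\<^sub>v n"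
  using B_transpose_scalar_prod[OF assms(1,1)] assms by (intro fe_N_eq_0) simp_all

lemma galerkin_solution:
  obtains x where "x \<in> carrier_vec n" "B *\<^sub>v x = d" "\<And>v. v \<in> X \<Longrightarrow> b (fe x) v = F v"
proof -
  obtain x where x: "x \<in> carrier_vec n" "B *\<^sub>v x = d"
    by (rule injective_mat_solve[OF B_carrier d_carrier B_injective])
  have "b (fe x) v = F v" if "v \<in> X" for v
  proof -
    from \<open>v \<in> X\<close> obtain y where y: "y \<in> carrier_vec n" "v = fe y" by (rule fe_coords)
    have "b (fe x) v = scalar_prod d y" using B_scalar_prod[OF x(1) y(1)] x(2) y(2) by simp
    also have "\<dots> = (\<Sum>j<n. vec_index y j * F (\<phi> j))"
      using y(1) by (simp add: d_def scalar_prod_def lessThan_atLeast0 mult.commute)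
    also have "\<dots> = F v" unfolding y(2) fe_fun_def by (simp add: fe_expand(4))
    finally show ?thesis .
  qed
  with x that show thesis by blast
qed

text \<open>A linear system with the transposed Galerkin matrix. It supplies the hypothesis
  \<open>adj\<close> of the quasi-orthogonality argument.\<close>

lemma adjoint_galerkin_projection:
  assumes z: "z \<in> V"
  shows "\<exists>w\<in>X. \<forall>v\<in>X. b v w = b v z"
proof -
  let ?e = "Matrix.vec n (\<lambda>j. b (\<phi> j) z)"
  have T: "transpose_mat B \<in> carrier_mat n n" using B_carrier by simp
  obtain y where y: "y \<in> carrier_vec n" "transpose_mat B *\<^sub>v y = ?e"
    by (rule injective_mat_solve[OF T vec_carrier B_transpose_injective])
  have "b v (fe y) = b v z" if "v \<in> X" for v
  proof -
    from \<open>v \<in> X\<close> obtain x where x: "x \<in> carrier_vec n" "v = fe x" by (rule fe_coords)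
    have "b v (fe y) = scalar_prod ?e x" using B_transpose_scalar_prod[OF x(1) y(1)] x(2) y(2) by simp
    also have "\<dots> = (\<Sum>j<n. vec_index x j * b (\<phi> j) z)"
      using x(1) by (simp add: scalar_prod_def lessThan_atLeast0 mult.commute)
    also have "\<dots> = b v z" unfolding x(2) fe_fun_def by (simp add: fe_expand(2) z)
    finally show ?thesis .
  qed
  with fe_X show ?thesis by blast
qed

lemma s_carrier: "x \<in> carrier_vec n \<Longrightarrow> s x \<in> carrier_vec n"
  using P_carrier B_carrier d_carrier by (auto simp: s_def prec_residual_def)

text \<open>The preconditioned residual of \<open>x\<close> is \<open>P B e\<close> with \<open>e\<close> the algebraic error of \<open>x\<close>.\<close>
lemma pnorm_PB_le:
  assumes y: "y \<in> carrier_vec n"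
  shows "pnorm P (P *\<^sub>v (B *\<^sub>v y)) \<le> \<kappa> * \<gamma> * N (fe y)"
proof (cases "pnorm P (P *\<^sub>v (B *\<^sub>v y)) = 0")
  case True
  then show ?thesis using \<kappa>_ge_1 \<gamma>_ge_1 N_nonneg[OF fe_V] by simp
next
  case False
  let ?t = "P *\<^sub>v (B *\<^sub>v y)"
  have By: "B *\<^sub>v y \<in> carrier_vec n" using B_carrier y by simp
  then have t: "?t \<in> carrier_vec n" using P_carrier by simp
  then have pos: "pnorm P ?t > 0" using False pnorm_nonneg[of ?t] by simp
  \<comment> \<open>The residual is tested with \<open>?t\<close> itself: its \<open>ip\<close>
    square is the plain scalar product of \<open>B *\<^sub>v y\<close> with \<open>?t\<close>, that
    is, \<open>b (fe y) (fe ?t)\<close>.\<close>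
  have "(pnorm P ?t)\<^sup>2 = b (fe y) (fe ?t)"
    using pnorm_sq[OF t] ip_P[OF By, of ?t] B_scalar_prod[OF y t] by simp
  also have "\<dots> \<le> \<kappa> * (N (fe y) * N (fe ?t))" by (intro b_le fe_V)
  also have "\<dots> \<le> \<kappa> * (N (fe y) * (\<gamma> * pnorm P ?t))"
    using \<kappa>_ge_1 by (intro mult_left_mono le_pnorm t N_nonneg fe_V) auto
  finally have "pnorm P ?t * pnorm P ?t \<le> \<kappa> * \<gamma> * N (fe y) * pnorm P ?t"
    by (simp add: power2_eq_square mult_ac)
  then show ?thesis using pos by simp
qed

text \<open>The square of \<open>N (fe y)\<close> is \<open>ip\<close> of
  \<open>P *\<^sub>v (B *\<^sub>v y)\<close> with \<open>y\<close>; Cauchy-Schwarz leaves the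
  coefficient norm of \<open>y\<close>, which is again equivalent to \<open>N (fe y)\<close> and
  cancels.\<close>

lemma N_le_pnorm_PB:
  assumes y: "y \<in> carrier_vec n"
  shows "N (fe y) \<le> \<gamma> * pnorm P (P *\<^sub>v (B *\<^sub>v y))"
proof (cases "N (fe y) = 0")
  case True
  have "P *\<^sub>v (B *\<^sub>v y) \<in> carrier_vec n" using P_carrier B_carrier y by simp
  then show ?thesis using True pnorm_nonneg \<gamma>_ge_1 by simp
next
  case False
  then have pos: "N (fe y) > 0" using N_nonneg[OF fe_V, of y] by simp
  let ?t = "P *\<^sub>v (B *\<^sub>v y)"
  have By: "B *\<^sub>v y \<in> carrier_vec n" using B_carrier y by simp
  then have t: "?t \<in> carrier_vec n" using P_carrier by simp
  have "(N (fe y))\<^sup>2 = ip ?t y"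
    using ip_P[OF By, of y] B_scalar_prod[OF y y] N_sq[OF fe_V] by simp
  also have "\<dots> \<le> pnorm P ?t * pnorm P y" by (rule ip_le[OF t y])
  also have "\<dots> \<le> pnorm P ?t * (\<gamma> * N (fe y))" by (intro mult_left_mono pnorm_le y pnorm_nonneg t)
  finally have "N (fe y) * N (fe y) \<le> \<gamma> * pnorm P ?t * N (fe y)"
    by (simp add: power2_eq_square mult_ac)
  then show ?thesis using pos by simp
qed

lemma s_eq:
  assumes "z \<in> carrier_vec n" "B *\<^sub>v z = d" "x \<in> carrier_vec n"
  shows "s x = P *\<^sub>v (B *\<^sub>v (z - x))"
  using assms mult_minus_distrib_mat_vec[OF B_carrier assms(1,3)] by (simp add: s_def prec_residual_def)

lemma residual_error_equivalence:
  assumes "z \<in> carrier_vec n" "B *\<^sub>v z = d" "x \<in> carrier_vec n"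
  shows "pnorm P (s x) \<le> \<kappa> * \<gamma> * gap (fe z) (fe x)"
    and "gap (fe z) (fe x) \<le> \<gamma> * pnorm P (s x)"
  using pnorm_PB_le[of "z - x"] N_le_pnorm_PB[of "z - x"] s_eq[OF assms] fe_diff[OF assms(1,3)] assms
  by simp_all

lemma s_add_smult:
  assumes x: "x \<in> carrier_vec n" and z: "z \<in> carrier_vec n"
  shows "s (x + t \<cdot>\<^sub>v z) = s x + (- t) \<cdot>\<^sub>v (P *\<^sub>v (B *\<^sub>v z))"
proof -
  have Bz: "B *\<^sub>v z \<in> carrier_vec n" and Bx: "B *\<^sub>v x \<in> carrier_vec n" using B_carrier x z by auto
  have "B *\<^sub>v (x + t \<cdot>\<^sub>v z) = B *\<^sub>v x + t \<cdot>\<^sub>v (B *\<^sub>v z)"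
    using mult_add_distrib_mat_vec[OF B_carrier x, of "t \<cdot>\<^sub>v z"] mult_mat_vec[OF B_carrier z] z by simp
  then have "d - B *\<^sub>v (x + t \<cdot>\<^sub>v z) = (d - B *\<^sub>v x) + (- t) \<cdot>\<^sub>v (B *\<^sub>v z)"
    using Bz Bx d_carrier by (intro eq_vecI) auto
  then have "s (x + t \<cdot>\<^sub>v z) = P *\<^sub>v ((d - B *\<^sub>v x) + (- t) \<cdot>\<^sub>v (B *\<^sub>v z))"
    by (simp add: s_def prec_residual_def)
  also have "\<dots> = P *\<^sub>v (d - B *\<^sub>v x) + P *\<^sub>v ((- t) \<cdot>\<^sub>v (B *\<^sub>v z))"
    using Bz Bx d_carrier by (intro mult_add_distrib_mat_vec[OF P_carrier]) auto
  also have "P *\<^sub>v ((- t) \<cdot>\<^sub>v (B *\<^sub>v z)) = (- t) \<cdot>\<^sub>v (P *\<^sub>v (B *\<^sub>v z))"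
    by (rule mult_mat_vec[OF P_carrier Bz])
  finally show ?thesis by (simp add: s_def prec_residual_def)
qed

text \<open>One descent step contracts the square by
  \<open>1 - 1 / (\<kappa> * \<gamma> ^ 4)\<^sup>2\<close>, which vanishes for
  \<open>\<kappa> = \<gamma> = 1\<close>. The extra 2 keeps the factor positive, so that one can
  divide by it and its roots stay in the open unit interval.\<close>

definition qpg :: real where
  "qpg = sqrt (1 - 1 / (2 * (\<kappa> * \<gamma> ^ 4)\<^sup>2))"

lemma qpg_bounds: "0 < qpg" "qpg < 1"
proof -
  have "1 \<le> \<kappa> * \<gamma> ^ 4" using mult_mono[OF \<kappa>_ge_1 one_le_power[OF \<gamma>_ge_1, of 4]] \<kappa>_ge_1 by simp
  then have "1 \<le> (\<kappa> * \<gamma> ^ 4)\<^sup>2" by (simp add: one_le_power)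
  then have "1 / (2 * (\<kappa> * \<gamma> ^ 4)\<^sup>2) < 1" "0 < 1 / (2 * (\<kappa> * \<gamma> ^ 4)\<^sup>2)"
    by (auto simp: divide_less_eq_1 intro!: divide_pos_pos)
  then show "0 < qpg" "qpg < 1" by (auto simp: qpg_def)
qed

text \<open>Along the direction \<open>s x\<close> the squared residual norm is a quadratic
  polynomial in \<open>t\<close>, with its slope controlled by coercivity and its curvature by
  boundedness: the classical one-step estimate for GMRES.\<close>

lemma steepest_descent_contraction:
  assumes x: "x \<in> carrier_vec n"
  obtains t where "pnorm P (s (x + t \<cdot>\<^sub>v s x)) \<le> qpg * pnorm P (s x)"
proof -
  let ?p = "pnorm P (s x)" and ?w = "P *\<^sub>v (B *\<^sub>v s x)"
  \<comment> \<open>\<beta> bounds \<open>P * B\<close> in the \<open>pnorm\<close>, and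
    \<open>t\<close> minimizes the bound
    \<open>1 - 2 * t / \<gamma>\<^sup>2 + t\<^sup>2 * \<beta>\<^sup>2\<close> of the squared
    contraction factor.\<close>
  define \<beta> where "\<beta> = \<kappa> * \<gamma>\<^sup>2"
  define t where "t = 1 / (\<gamma>\<^sup>2 * \<beta>\<^sup>2)"
  have sx: "s x \<in> carrier_vec n" by (rule s_carrier[OF x])
  have Bs: "B *\<^sub>v s x \<in> carrier_vec n" using B_carrier sx by simp
  have w: "?w \<in> carrier_vec n" using P_carrier Bs by simp
  have p: "?p \<ge> 0" by (rule pnorm_nonneg[OF sx])
  have \<beta>: "\<beta> > 0" using \<kappa>_ge_1 \<gamma>_ge_1 by (simp add: \<beta>_def)
  have t: "t > 0" using \<gamma>_ge_1 \<beta> by (simp add: t_def)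
  have "pnorm P ?w \<le> \<kappa> * \<gamma> * N (fe (s x))" by (rule pnorm_PB_le[OF sx])
  also have "\<dots> \<le> \<kappa> * \<gamma> * (\<gamma> * ?p)" using \<kappa>_ge_1 \<gamma>_ge_1 by (intro mult_left_mono le_pnorm sx) auto
  finally have wp: "pnorm P ?w \<le> \<beta> * ?p" by (simp add: \<beta>_def power2_eq_square mult_ac)
  then have wp2: "(pnorm P ?w)\<^sup>2 \<le> \<beta>\<^sup>2 * ?p\<^sup>2"
    using power_mono[OF wp pnorm_nonneg[OF w], of 2] by (simp add: power_mult_distrib)
  have "?p\<^sup>2 \<le> \<gamma>\<^sup>2 * (N (fe (s x)))\<^sup>2"
    using power_mono[OF pnorm_le[OF sx] p, of 2] by (simp add: power_mult_distrib)
  also have "(N (fe (s x)))\<^sup>2 = ip ?w (s x)"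
    using ip_P[OF Bs, of "s x"] B_scalar_prod[OF sx sx] N_sq[OF fe_V] by simp
  finally have ipw: "?p\<^sup>2 / \<gamma>\<^sup>2 \<le> ip ?w (s x)" using \<gamma>_ge_1 by (simp add: pos_divide_le_eq mult.commute)
  have "(pnorm P (s (x + t \<cdot>\<^sub>v s x)))\<^sup>2 = ?p\<^sup>2 + 2 * (- t) * ip ?w (s x) + (- t)\<^sup>2 * (pnorm P ?w)\<^sup>2"
    unfolding s_add_smult[OF x sx] by (rule pnorm_add_smult_sq[OF sx w])
  also have "\<dots> \<le> ?p\<^sup>2 + 2 * (- t) * (?p\<^sup>2 / \<gamma>\<^sup>2) + (- t)\<^sup>2 * (\<beta>\<^sup>2 * ?p\<^sup>2)"
    using t ipw wp2 by (intro add_mono mult_left_mono mult_left_mono_neg) auto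
  also have "\<dots> = (1 - 1 / (\<gamma>\<^sup>2 * \<beta>)\<^sup>2) * ?p\<^sup>2"
  proof -
    have "t / \<gamma>\<^sup>2 = 1 / (\<gamma>\<^sup>2 * \<beta>)\<^sup>2" by (simp add: t_def power_mult_distrib power2_eq_square)
    moreover have "t\<^sup>2 * \<beta>\<^sup>2 = t / \<gamma>\<^sup>2" using \<beta> by (simp add: t_def power_divide power_mult_distrib power2_eq_square)
    moreover have "?p\<^sup>2 + 2 * (- t) * (?p\<^sup>2 / \<gamma>\<^sup>2) + (- t)\<^sup>2 * (\<beta>\<^sup>2 * ?p\<^sup>2)
        = ?p\<^sup>2 - 2 * (t / \<gamma>\<^sup>2) * ?p\<^sup>2 + (t\<^sup>2 * \<beta>\<^sup>2) * ?p\<^sup>2" by simp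
    ultimately show ?thesis by (simp only: left_diff_distrib)
  qed
  also have "\<gamma>\<^sup>2 * \<beta> = \<kappa> * \<gamma> ^ 4" by (simp add: \<beta>_def power2_eq_square power4_eq_xxxx)
  also have "(1 - 1 / (\<kappa> * \<gamma> ^ 4)\<^sup>2) * ?p\<^sup>2 \<le> qpg\<^sup>2 * ?p\<^sup>2"
  proof (intro mult_right_mono)
    have "qpg\<^sup>2 = 1 - 1 / (2 * (\<kappa> * \<gamma> ^ 4)\<^sup>2)"
      using qpg_bounds(1) by (simp add: qpg_def)
    moreover have "1 / (2 * (\<kappa> * \<gamma> ^ 4)\<^sup>2) \<le> 1 / (\<kappa> * \<gamma> ^ 4)\<^sup>2"
      using \<kappa>_ge_1 \<gamma>_ge_1 by (intro divide_left_mono) auto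
    ultimately show "1 - 1 / (\<kappa> * \<gamma> ^ 4)\<^sup>2 \<le> qpg\<^sup>2" by simp
  qed simp
  finally have "(pnorm P (s (x + t \<cdot>\<^sub>v s x)))\<^sup>2 \<le> (qpg * ?p)\<^sup>2" by (simp add: power_mult_distrib)
  then have "pnorm P (s (x + t \<cdot>\<^sub>v s x)) \<le> qpg * ?p"
    by (rule power2_le_imp_le) (use qpg_bounds p in simp)
  then show thesis by (rule that)
qed

section \<open>Restarted GMRES along one level\<close>

context
  fixes x :: "nat \<Rightarrow> real Matrix.vec" and kmax L :: nat
  assumes kmax: "kmax \<ge> 1" and x0: "x 0 \<in> carrier_vec n"
    and step: "\<And>k. 1 \<le> k \<Longrightarrow> k \<le> L \<Longrightarrow> pgmres_step n P B d kmax x k"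
begin

abbreviation (input) dim_krylov :: "nat \<Rightarrow> nat" where
  "dim_krylov k \<equiv> (k - 1) mod kmax + 1"

lemma pgmres_min:
  assumes k: "1 \<le> k" "k \<le> L"
    and z: "z \<in> krylov_space n (P * B) (s (x (k - dim_krylov k))) (dim_krylov k)"
  shows "pnorm P (s (x k)) \<le> pnorm P (s (x (k - dim_krylov k) + z))"
  using step[OF k] z unfolding pgmres_step_def Let_def is_arg_min_def s_def not_less[symmetric] by blast

lemma pgmres_mem:
  assumes k: "1 \<le> k" "k \<le> L"
  obtains z where "x k = x (k - dim_krylov k) + z"
    "z \<in> krylov_space n (P * B) (s (x (k - dim_krylov k))) (dim_krylov k)"
  using step[OF k] unfolding pgmres_step_def Let_def is_arg_min_def s_def by blast

lemma x_carrier: "k \<le> L \<Longrightarrow> x k \<in> carrier_vec n"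
proof (induction k rule: less_induct)
  case (less k)
  show ?case
  proof (cases "k = 0")
    case False
    then have "1 \<le> k" by simp
    from pgmres_mem[OF this less.prems] obtain z where
      z: "x k = x (k - dim_krylov k) + z"
        "z \<in> krylov_space n (P * B) (s (x (k - dim_krylov k))) (dim_krylov k)" .
    have "x (k - dim_krylov k) \<in> carrier_vec n" using False less.prems by (intro less.IH) auto
    with krylov_carrier[OF z(2)] z(1) show ?thesis by simp
  qed (use x0 in simp)
qed

lemma PB_carrier: "P * B \<in> carrier_mat n n"
  using P_carrier B_carrier by simp

text \<open>Even the one-dimensional Krylov space contains the residual of the last restart, so the
  minimizer is at least as good as one descent step from there.\<close>

lemma pgmres_contraction:
  assumes k: "1 \<le> k" "k \<le> L"
  shows "pnorm P (s (x k)) \<le> qpg * pnorm P (s (x (k - dim_krylov k)))"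
proof -
  let ?m = "k - dim_krylov k"
  have c: "x ?m \<in> carrier_vec n" using k by (intro x_carrier) auto
  obtain t where t: "pnorm P (s (x ?m + t \<cdot>\<^sub>v s (x ?m))) \<le> qpg * pnorm P (s (x ?m))"
    by (rule steepest_descent_contraction[OF c])
  have "pnorm P (s (x k)) \<le> pnorm P (s (x ?m + t \<cdot>\<^sub>v s (x ?m)))"
    by (intro pgmres_min k smult_in_krylov PB_carrier s_carrier c) simp
  with t show ?thesis by linarith
qed

text \<open>Within a cycle the sets of admissible iterates are nested; right after a restart the
  contraction itself gives monotonicity.\<close>

lemma pgmres_antimono_step:
  assumes k: "Suc k \<le> L"
  shows "pnorm P (s (x (Suc k))) \<le> pnorm P (s (x k))"
proof (cases "k mod kmax = 0")
  case True
  have "pnorm P (s (x (Suc k))) \<le> qpg * pnorm P (s (x k))"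
    using pgmres_contraction[of "Suc k"] k True by simp
  also have "\<dots> \<le> pnorm P (s (x k))"
    using qpg_bounds k by (intro mult_left_le_one_le pnorm_nonneg s_carrier x_carrier) auto
  finally show ?thesis .
next
  case False
  let ?K = "(k - 1) mod kmax + 1"
  have k1: "1 \<le> k" using False by (cases k) auto
  \<comment> \<open>\<open>k\<close> and \<open>Suc k\<close> lie in the same cycle: the restart
    index is the same, and the Krylov dimension at \<open>Suc k\<close> is one larger.\<close>
  have K: "k mod kmax = ?K" using False k1 by (cases k) (auto simp: mod_Suc split: if_splits)
  have m: "Suc k - ((Suc k - 1) mod kmax + 1) = k - ?K" using K by simp
  obtain z where z: "x k = x (k - ?K) + z" "z \<in> krylov_space n (P * B) (s (x (k - ?K))) ?K"
    using pgmres_mem[of k] k1 k by auto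
  have "z \<in> krylov_space n (P * B) (s (x (k - ?K))) (Suc ?K)"
    using k by (intro krylov_Suc z PB_carrier s_carrier x_carrier) auto
  then have "pnorm P (s (x (Suc k))) \<le> pnorm P (s (x (k - ?K) + z))"
    using pgmres_min[of "Suc k" z] k K unfolding m by simp
  with z(1) show ?thesis by simp
qed

lemma pgmres_antimono:
  assumes "j \<le> k" "k \<le> L"
  shows "pnorm P (s (x k)) \<le> pnorm P (s (x j))"
  using assms
proof (induction k rule: dec_induct)
  case (step k)
  then show ?case using pgmres_antimono_step[of k] by simp
qed simp

lemma pgmres_decay:
  assumes jk: "j \<le> k" "k \<le> L"
  shows "pnorm P (s (x k)) \<le> 1 / qpg * root kmax qpg ^ (k - j) * pnorm P (s (x j))"
proof (rule geometric_decay_of_blocks[OF kmax qpg_bounds _ _ _ _ jk])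
  fix k assume k: "k + kmax \<le> L"
  \<comment> \<open>The last restart index below \<open>k + kmax\<close>. Any \<open>kmax\<close>
    consecutive indices contain one, so \<open>k \<le> m\<close> and the contracting step to
    \<open>Suc m\<close> is done by \<open>k + kmax\<close>.\<close>
  define m where "m = (k + kmax - 1) - (k + kmax - 1) mod kmax"
  have r: "(k + kmax - 1) mod kmax < kmax" using kmax by simp
  have m: "k \<le> m" "m + 1 \<le> k + kmax" using r kmax unfolding m_def by linarith+
  have "m mod kmax = 0" by (simp add: m_def minus_mod_eq_mult_div)
  then have "pnorm P (s (x (Suc m))) \<le> qpg * pnorm P (s (x m))"
    using pgmres_contraction[of "Suc m"] m k by simp
  moreover have "pnorm P (s (x (k + kmax))) \<le> pnorm P (s (x (Suc m)))"
    using m k by (intro pgmres_antimono) auto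
  moreover have "qpg * pnorm P (s (x m)) \<le> qpg * pnorm P (s (x k))"
    using m k qpg_bounds by (intro mult_left_mono pgmres_antimono) auto
  ultimately show "pnorm P (s (x (k + kmax))) \<le> qpg * pnorm P (s (x k))" by linarith
qed (auto intro: pnorm_nonneg s_carrier x_carrier pgmres_antimono)

end

end

section \<open>Linear convergence from tail sums\<close>

text \<open>With tails \<open>r\<close>, the relations \<open>r n = a n + r (n + 1)\<close> and
  \<open>r n \<le> C * a n\<close> make the tails contract by \<open>1 - 1 / C\<close>. The finite
  horizon \<open>M\<close> avoids any question of summability.\<close>

lemma tail_sum_decay:
  fixes a :: "nat \<Rightarrow> real"
  assumes C: "C > 1" and tail: "\<And>n. n \<le> M \<Longrightarrow> (\<Sum>i=n..M. a i) \<le> C * a n"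
    and nonneg: "\<And>n. n \<le> M \<Longrightarrow> a n \<ge> 0" and m: "m \<le> M"
  shows "a M \<le> C * (1 - 1 / C) ^ (M - m) * a m"
proof -
  define r where "r = (\<lambda>n. \<Sum>i=n..M. a i)"
  let ?q = "1 - 1 / C"
  have q: "?q \<ge> 0" using C by simp
  have "r (m + k) \<le> ?q ^ k * r m" if "m + k \<le> M" for k
    using that
  proof (induction k)
    case (Suc k)
    have "r (m + k) = a (m + k) + r (m + Suc k)"
      using Suc.prems by (simp add: r_def sum.atLeast_Suc_atMost)
    moreover have "r (m + k) \<le> C * a (m + k)" unfolding r_def using Suc.prems by (intro tail) simp
    ultimately have "r (m + Suc k) \<le> ?q * r (m + k)" using C by (simp add: field_simps)
    also have "\<dots> \<le> ?q * (?q ^ k * r m)" using Suc q by (intro mult_left_mono) auto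
    finally show ?case by (simp add: mult.assoc)
  qed simp
  from this[of "M - m"] have "r M \<le> ?q ^ (M - m) * r m" using m by simp
  also have "\<dots> \<le> ?q ^ (M - m) * (C * a m)"
    unfolding r_def using q m by (intro mult_left_mono tail) auto
  finally show ?thesis by (simp add: r_def mult_ac)
qed

text \<open>Decay from level \<open>i\<close> on is pulled back one level at a time. The constants
  of \<open>step\<close> may depend on the level, since only finitely many of them enter.\<close>

lemma decay_extend:
  fixes h :: "nat \<Rightarrow> real"
  assumes nonneg: "\<And>l. h l \<ge> 0" and step: "\<And>l. \<exists>c. h (Suc l) \<le> c * h l"
    and \<rho>: "0 < \<rho>" and decay: "\<And>j l. i \<le> j \<Longrightarrow> j \<le> l \<Longrightarrow> h l \<le> C * \<rho> ^ (l - j) * h j"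
  shows "\<exists>C\<ge>1. \<forall>j l. j \<le> l \<longrightarrow> h l \<le> C * \<rho> ^ (l - j) * h j"
  using decay
proof (induction i arbitrary: C)
  case 0
  show ?case
  proof (intro exI conjI allI impI)
    fix j l :: nat assume "j \<le> l"
    then have "h l \<le> C * \<rho> ^ (l - j) * h j" by (intro "0.prems") simp_all
    also have "\<dots> \<le> max 1 C * \<rho> ^ (l - j) * h j"
      using \<rho> by (intro mult_right_mono nonneg) simp_all
    finally show "h l \<le> max 1 C * \<rho> ^ (l - j) * h j" .
  qed simp
next
  case (Suc m)
  obtain c where "h (Suc m) \<le> c * h m" using step by blast
  also have "c * h m \<le> \<bar>c\<bar> * h m" by (intro mult_right_mono nonneg) simp
  finally have c: "h (Suc m) \<le> \<bar>c\<bar> * h m" .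
  \<comment> \<open>The entries serve, in this order, equal indices, decay already known, and one
    extra step from \<open>m\<close>; the last costs \<open>1 / \<rho>\<close> because the exponent
    grows by one.\<close>
  define E where "E = max 1 (max C (\<bar>C\<bar> * \<bar>c\<bar> / \<rho>))"
  have E: "1 \<le> E" "C \<le> E" "\<bar>C\<bar> * \<bar>c\<bar> / \<rho> \<le> E" by (simp_all add: E_def)
  show ?case
  proof (rule Suc.IH[of E])
    fix j l assume j: "m \<le> j" "j \<le> l"
    consider "Suc m \<le> j" | "j = m" "l = m" | "j = m" "Suc m \<le> l" using j by linarith
    then show "h l \<le> E * \<rho> ^ (l - j) * h j"
    proof cases
      case 1
      then have "h l \<le> C * \<rho> ^ (l - j) * h j" using j by (intro Suc.prems)
      also have "\<dots> \<le> E * \<rho> ^ (l - j) * h j"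
        using \<rho> by (intro mult_right_mono nonneg E) simp
      finally show ?thesis .
    next
      case 2
      then show ?thesis using mult_right_mono[OF E(1) nonneg[of m]] by simp
    next
      case 3
      have "h l \<le> C * \<rho> ^ (l - Suc m) * h (Suc m)" using 3 by (intro Suc.prems) auto
      also have "\<dots> \<le> \<bar>C\<bar> * \<rho> ^ (l - Suc m) * h (Suc m)"
        using \<rho> by (intro mult_right_mono nonneg) simp_all
      also have "\<dots> \<le> \<bar>C\<bar> * \<rho> ^ (l - Suc m) * (\<bar>c\<bar> * h m)"
        using \<rho> by (intro mult_left_mono c) simp
      also have "\<dots> = \<bar>C\<bar> * \<bar>c\<bar> / \<rho> * \<rho> ^ (l - m) * h m"
      proof -
        have "l - m = Suc (l - Suc m)" using 3 by simp
        then have "\<rho> ^ (l - m) = \<rho> * \<rho> ^ (l - Suc m)" by (simp only: power_Suc)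
        then show ?thesis using \<rho> by simp
      qed
      also have "\<dots> \<le> E * \<rho> ^ (l - m) * h m"
        using \<rho> by (intro mult_right_mono nonneg E) simp
      finally show ?thesis using 3(1) by simp
    qed
  qed
qed

lemma ennreal_inverse_le:
  assumes "0 < c" "0 \<le> x" "0 \<le> y" "y \<le> c * x"
  shows "inverse (ennreal x) \<le> ennreal c * inverse (ennreal y)"
proof (cases "y = 0")
  case True
  then show ?thesis using assms by (simp add: ennreal_mult_top)
next
  case False
  then have "y > 0" "x > 0" using assms by (auto simp: less_le)
  then have "inverse x \<le> c * inverse y" using assms by (simp add: field_simps)
  then show ?thesis
    using \<open>y > 0\<close> \<open>x > 0\<close> assms by (simp add: inverse_ennreal ennreal_mult[symmetric] ennreal_leI)
qed

text \<open>If the partial sums of \<open>1/h\<close> are dominated by the current term, they grow geometrically.\<close>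
lemma decay_of_inverse_sum:
  fixes h :: "nat \<Rightarrow> real" and S :: "nat \<Rightarrow> ennreal"
  assumes h: "\<And>l. h l \<ge> 0" and K: "K > 0"
    and S: "\<And>l. S (Suc l) = S l + inverse (ennreal (h l))"
    and dom: "\<And>l. l0 \<le> l \<Longrightarrow> S l \<le> ennreal K * inverse (ennreal (h l))"
    and jl: "l0 \<le> j" "j \<le> l"
  shows "h l \<le> (K + 1) * (K / (K + 1)) ^ (l - j) * h j"
proof (cases "h l = 0 \<or> j = l")
  case True
  then show ?thesis
  proof
    assume "h l = 0"
    then show ?thesis using K h[of j] by simp
  next
    assume "j = l"
    then show ?thesis using mult_right_mono[of 1 "K + 1" "h l"] K h[of l] by simp
  qed
next
  case False
  then have l: "h l > 0" "j < l" using h[of l] jl by auto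
  have mono: "S i \<le> S k" if "i \<le> k" for i k
    by (rule lift_Suc_mono_le[OF _ that]) (simp add: S)
  \<comment> \<open>Since \<open>1 / 0\<close> is infinite in \<open>ennreal\<close>, finiteness of
    \<open>S l\<close> excludes zeros of \<open>h\<close> before \<open>l\<close>; the rest takes
    place in the reals.\<close>
  have Sl: "S l < top_class.top"
  proof -
    have "S l \<le> ennreal K * inverse (ennreal (h l))" using jl by (intro dom) simp
    also have "\<dots> < top_class.top" using l K by (simp add: inverse_ennreal ennreal_mult[symmetric])
    finally show ?thesis .
  qed
  have hi: "h i > 0" if "i < l" for i
  proof (rule ccontr)
    assume "\<not> h i > 0"
    then have "h i = 0" using h[of i] by simp
    then have "S (Suc i) = top_class.top" by (simp add: S)
    moreover have "S (Suc i) < top_class.top" using that by (intro le_less_trans[OF mono Sl]) simp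
    ultimately show False by simp
  qed
  define t where "t = (\<lambda>i. enn2real (S i))"
  have St: "S i = ennreal (t i)" if "i \<le> l" for i
    unfolding t_def by (rule ennreal_enn2real[OF le_less_trans[OF mono[OF that] Sl], symmetric])
  have t0: "t i \<ge> 0" for i by (simp add: t_def)
  have tS: "t (Suc i) = t i + inverse (h i)" if "i < l" for i
  proof -
    have "ennreal (t (Suc i)) = ennreal (t i) + ennreal (inverse (h i))"
      using that hi[OF that] S[of i] St[of "Suc i"] St[of i] by (simp add: inverse_ennreal)
    also have "\<dots> = ennreal (t i + inverse (h i))" by (rule ennreal_plus[symmetric]) (use t0 hi[OF that] in simp_all)
    finally show ?thesis using t0 hi[OF that] by (subst (asm) ennreal_inj) (auto intro: add_nonneg_nonneg)
  qed
  have td: "t i \<le> K * inverse (h i)" if "l0 \<le> i" "i \<le> l" for i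
  proof -
    have "h i > 0" using hi[of i] l that by (cases "i = l") auto
    then show ?thesis
      using dom[OF that(1)] St[OF that(2)] K t0[of i]
      by (simp add: inverse_ennreal ennreal_mult[symmetric] ennreal_le_iff)
  qed
  \<comment> \<open>By \<open>td\<close> the increment is at least \<open>t i / K\<close>, so each
    step multiplies \<open>t\<close> by at least \<open>(K + 1) / K\<close>. The start is
    \<open>Suc j\<close>, where the partial sum first contains \<open>inverse (h j)\<close>.\<close>
  have grow: "t (Suc j + k) \<ge> ((K + 1) / K) ^ k * inverse (h j)" if "Suc j + k \<le> l" for k
    using that
  proof (induction k)
    case 0
    then show ?case using tS[of j] t0[of j] l by simp
  next
    case (Suc k)
    have "((K + 1) / K) ^ Suc k * inverse (h j) = (K + 1) / K * (((K + 1) / K) ^ k * inverse (h j))" by simp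
    also have "\<dots> \<le> (K + 1) / K * t (Suc j + k)" using Suc K by (intro mult_left_mono) auto
    also have "\<dots> = t (Suc j + k) + t (Suc j + k) / K" using K by (simp add: add_divide_distrib distrib_right)
    also have "\<dots> \<le> t (Suc j + k) + inverse (h (Suc j + k))"
      using td[of "Suc j + k"] Suc.prems jl K by (simp add: pos_divide_le_eq mult.commute)
    also have "\<dots> = t (Suc j + Suc k)" using tS[of "Suc j + k"] Suc.prems by simp
    finally show ?case .
  qed
  define p where "p = ((K + 1) / K) ^ (l - Suc j)"
  define r where "r = (K / (K + 1)) ^ (l - Suc j)"
  have rp: "r * p = 1" using K by (simp add: r_def p_def power_mult_distrib[symmetric])
  have r0: "r \<ge> 0" using K by (simp add: r_def)
  have hj: "h j > 0" by (rule hi[OF l(2)])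
  have "p * inverse (h j) \<le> K * inverse (h l)"
    using grow[of "l - Suc j"] td[of l] l jl by (simp add: p_def)
  then have "p * h l \<le> K * h j" using l(1) hj by (simp add: field_simps)
  then have "r * (p * h l) \<le> r * (K * h j)" using r0 by (rule mult_left_mono)
  then have "h l \<le> r * K * h j" using rp by (simp add: mult.assoc[symmetric])
  also have "r * K = (K + 1) * (K / (K + 1)) ^ (l - j)"
  proof -
    have "l - j = Suc (l - Suc j)" using l by simp
    then show ?thesis using K by (simp add: r_def)
  qed
  finally show ?thesis .
qed

lemma geometric_sum_le:
  fixes \<rho> :: real
  assumes "0 < \<rho>" "\<rho> < 1"
  shows "(\<Sum>i<n. \<rho> ^ i) \<le> 1 / (1 - \<rho>)"
proof -
  have "(\<Sum>i<n. \<rho> ^ i) \<le> (\<Sum>i. \<rho> ^ i)" using assms by (intro sum_le_suminf summable_geometric) auto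
  also have "\<dots> = 1 / (1 - \<rho>)" using assms by (intro suminf_geometric) auto
  finally show ?thesis .
qed

section \<open>Enumeration of the index set\<close>

locale level_indices =
  fixes ks :: "nat \<Rightarrow> enat" and Q :: "(nat \<times> nat) set"
  assumes Q_def: "Q = {(l, k). (\<forall>j<l. ks j \<noteq> \<infinity>) \<and> enat k \<le> ks l}"
begin

definition count :: "nat \<Rightarrow> nat \<Rightarrow> nat" where
  "count l k = card {(l', k'). (l', k') \<in> Q \<and> (l' < l \<or> l' = l \<and> k' \<le> k)}"

text \<open>The lexicographic successor: the next solver step if there is one, else the start of the
  next level. Iterated from \<open>(0, 0)\<close> it lists \<open>Q\<close>; a level with
  \<open>ks l = \<infinity>\<close> is never left.\<close>

fun next_index :: "nat \<times> nat \<Rightarrow> nat \<times> nat" where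
  "next_index (l, k) = (if enat k < ks l then (l, Suc k) else (Suc l, 0))"

definition index :: "nat \<Rightarrow> nat \<times> nat" where
  "index n = (next_index ^^ n) (0, 0)"

lemma index_0: "index 0 = (0, 0)" and index_Suc: "index (Suc n) = next_index (index n)"
  by (simp_all add: index_def)

lemma next_index_Q: "q \<in> Q \<Longrightarrow> next_index q \<in> Q"
proof (cases q)
  case (Pair l k)
  assume "q \<in> Q"
  then have q: "\<forall>j<l. ks j \<noteq> \<infinity>" "enat k \<le> ks l" by (auto simp: Pair Q_def)
  show ?thesis
  proof (cases "enat k < ks l")
    case True
    then have "enat (Suc k) \<le> ks l" by (simp add: Suc_ile_eq)
    with q True show ?thesis by (simp add: Pair Q_def)
  next
    case False
    then have "ks l \<noteq> \<infinity>" by (cases "ks l") auto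
    with q False show ?thesis by (auto simp: Pair Q_def less_Suc_eq zero_enat_def[symmetric])
  qed
qed

lemma index_Q: "index n \<in> Q"
proof (induction n)
  case 0
  show ?case by (simp add: index_0 Q_def zero_enat_def[symmetric])
next
  case (Suc n)
  show ?case unfolding index_Suc by (rule next_index_Q[OF Suc])
qed

definition below :: "nat \<times> nat \<Rightarrow> (nat \<times> nat) set" where
  "below q = {(l', k'). (l', k') \<in> Q \<and> (l' < fst q \<or> l' = fst q \<and> k' \<le> snd q)}"

lemma below_next_index:
  assumes "q \<in> Q"
  shows "below (next_index q) = insert (next_index q) (below q)" "next_index q \<notin> below q"
proof -
  obtain l k where q: "q = (l, k)" by (cases q)
  have Q: "\<forall>j<l. ks j \<noteq> \<infinity>" "enat k \<le> ks l" using assms by (auto simp: q Q_def)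
  show "next_index q \<notin> below q" by (auto simp: q below_def)
  have nQ: "next_index q \<in> Q" by (rule next_index_Q[OF assms])
  show "below (next_index q) = insert (next_index q) (below q)"
  proof (cases "enat k < ks l")
    case True
    then have n: "next_index q = (l, Suc k)" by (simp add: q)
    show ?thesis using nQ unfolding n by (auto simp: q below_def le_Suc_eq)
  next
    case False
    then have kl: "ks l = enat k" using Q by simp
    have n: "next_index q = (Suc l, 0)" using False by (simp add: q)
    have "k' \<le> k" if "(l, k') \<in> Q" for k' using that kl by (simp add: Q_def)
    then show ?thesis using nQ unfolding n by (auto simp: q below_def less_Suc_eq)
  qed
qed

text \<open>The segment up to the \<open>n\<close>-th index consists of the first
  \<open>n + 1\<close> indices. Counting thus becomes the position in the enumeration, up to a shift
  by one that cancels in differences.\<close>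

lemma below_index: "below (index n) = index ` {..n}" "card (below (index n)) = Suc n"
proof -
  have "below (index n) = index ` {..n} \<and> finite (below (index n)) \<and> card (below (index n)) = Suc n"
  proof (induction n)
    case 0
    have "below (index 0) = {(0, 0)}"
      using index_Q[of 0] by (auto simp: below_def index_0)
    then show ?case by (simp add: index_0)
  next
    case (Suc n)
    note n = below_next_index[OF index_Q[of n], folded index_Suc]
    have "card (insert (index (Suc n)) (below (index n))) = Suc (card (below (index n)))"
      using Suc n(2) by (intro card_insert_disjoint) auto
    with Suc n(1) show ?case by (auto simp: atMost_Suc)
  qed
  then show "below (index n) = index ` {..n}" "card (below (index n)) = Suc n" by auto
qed

lemma inj_index: "inj index"
proof (rule injI)
  fix m n assume "index m = index n"
  then have "card (below (index m)) = card (below (index n))" by simp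
  then show "m = n" unfolding below_index(2) by simp
qed

lemma count_index: "index n = (l, k) \<Longrightarrow> count l k = Suc n"
  using below_index(2)[of n] by (simp add: count_def below_def)

lemma index_surj: "(l, k) \<in> Q \<Longrightarrow> \<exists>n. index n = (l, k)"
proof (induction l arbitrary: k)
  case 0
  then show ?case
  proof (induction k)
    case 0
    then show ?case using index_0 by blast
  next
    case (Suc k)
    then have lt: "enat k < ks 0" by (simp add: Q_def Suc_ile_eq)
    with Suc obtain n where "index n = (0, k)" by (auto simp: Q_def less_imp_le)
    with lt have "index (Suc n) = (0, Suc k)" by (simp add: index_Suc)
    then show ?case by blast
  qed
next
  case (Suc l)
  note IHl = Suc.IH
  from Suc.prems show ?case
  proof (induction k)
    case 0
    then obtain m where m: "ks l = enat m" by (auto simp: Q_def)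
    with 0 have "(l, m) \<in> Q" by (auto simp: Q_def)
    from IHl[OF this] obtain n where "index n = (l, m)" by blast
    with m have "index (Suc n) = (Suc l, 0)" by (simp add: index_Suc)
    then show ?case by blast
  next
    case (Suc k)
    then have lt: "enat k < ks (Suc l)" by (simp add: Q_def Suc_ile_eq)
    with Suc obtain n where "index n = (Suc l, k)" by (auto simp: Q_def less_imp_le)
    with lt have "index (Suc n) = (Suc l, Suc k)" by (simp add: index_Suc)
    then show ?case by blast
  qed
qed

lemma index_mono_lex:
  assumes "m \<le> n"
  shows "fst (index m) < fst (index n) \<or> fst (index m) = fst (index n) \<and> snd (index m) \<le> snd (index n)"
proof -
  have "index m \<in> below (index n)" using assms by (simp add: below_index)
  then show ?thesis by (auto simp: below_def)
qed

text \<open>Along the enumeration the tail sums of \<open>H\<close> are bounded by the current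
  value, so \<open>tail_sum_decay\<close> applies. The sum over one level is a geometric series by
  \<open>inner\<close>, the sum over the levels one by \<open>outer\<close>, and
  \<open>nested\<close> connects the two.\<close>

lemma linear_convergence:
  fixes H :: "nat \<Rightarrow> nat \<Rightarrow> real"
  assumes nonneg: "\<And>l k. (l, k) \<in> Q \<Longrightarrow> H l k \<ge> 0"
    and A: "C \<ge> 1" "0 < \<rho>" "\<rho> < 1"
    and inner: "\<And>l j k. (l, k) \<in> Q \<Longrightarrow> j \<le> k \<Longrightarrow> H l k \<le> C * \<rho> ^ (k - j) * H l j"
    and nested: "\<And>l m. (Suc l, 0) \<in> Q \<Longrightarrow> ks l = enat m \<Longrightarrow> H (Suc l) 0 \<le> C * H l m"
    and outer: "\<And>j l m m'. (Suc l, 0) \<in> Q \<Longrightarrow> j \<le> l \<Longrightarrow> ks l = enat m \<Longrightarrow> ks j = enat m' \<Longrightarrow>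
      H l m \<le> C * \<rho> ^ (l - j) * H j m'"
  shows "\<exists>q c. 0 < q \<and> q < 1 \<and> 0 < c \<and> (\<forall>l' k' l k. (l', k') \<in> Q \<and> (l, k) \<in> Q \<and> count l' k' \<le> count l k \<longrightarrow>
    H l k \<le> c * q ^ (count l k - count l' k') * H l' k')"
proof -
  define a where "a = (\<lambda>n. H (fst (index n)) (snd (index n)))"
  define G where "G = 1 / (1 - \<rho>)"
  have G: "G \<ge> 1" "G > 0" using A by (auto simp: G_def)
  \<comment> \<open>The first term stands for the rest of the current level, the second for all
    later levels: one \<open>G\<close> for the steps of a level, one for the levels, and one
    \<open>C\<close> each from \<open>level\<close>, \<open>nested\<close>, \<open>outer\<close> and
    \<open>inner\<close>. The 1 ensures \<open>Ct > 1\<close>.\<close>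
  define Ct where "Ct = C * G + C ^ 4 * G * G + 1"
  have Q_le: "(l, j) \<in> Q" if "(l, k) \<in> Q" "j \<le> k" for l j k
    using that by (auto simp: Q_def intro: order_trans[of "enat j" "enat k"])
  have level: "(\<Sum>k\<in>{k. j \<le> k \<and> k < j + K \<and> (l, k) \<in> Q}. H l k) \<le> C * G * H l j" if "(l, j) \<in> Q" for l j K
  proof -
    have "(\<Sum>k\<in>{k. j \<le> k \<and> k < j + K \<and> (l, k) \<in> Q}. H l k)
        \<le> (\<Sum>k\<in>{k. j \<le> k \<and> k < j + K \<and> (l, k) \<in> Q}. C * \<rho> ^ (k - j) * H l j)"
      by (intro sum_mono inner) auto
    also have "\<dots> \<le> (\<Sum>k\<in>{j..<j + K}. C * \<rho> ^ (k - j) * H l j)"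
      using A nonneg[OF that] by (intro sum_mono2) auto
    also have "\<dots> = C * H l j * (\<Sum>i<K. \<rho> ^ i)"
    proof -
      have "(\<Sum>k\<in>{j..<j + K}. C * \<rho> ^ (k - j) * H l j) = (\<Sum>i<K. C * \<rho> ^ i * H l j)"
        using sum.shift_bounds_nat_ivl[of "\<lambda>k. C * \<rho> ^ (k - j) * H l j" 0 j K]
        by (simp add: add.commute lessThan_atLeast0)
      then show ?thesis by (simp add: sum_distrib_left mult_ac)
    qed
    also have "\<dots> \<le> C * H l j * G"
      unfolding G_def using A nonneg[OF that] by (intro mult_left_mono geometric_sum_le) auto
    finally show ?thesis by (simp add: mult_ac)
  qed
  have tail: "(\<Sum>n=m..M. a n) \<le> Ct * a m" if "m \<le> M" for m M
  proof -
    obtain l' k' where m: "index m = (l', k')" by (cases "index m")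
    obtain L kM where M: "index M = (L, kM)" by (cases "index M")
    have mQ: "(l', k') \<in> Q" using index_Q[of m] m by simp
    \<comment> \<open>A cut-off for the step numbers, as the last level may be infinite.\<close>
    define K where "K = Suc (Max (snd ` index ` {m..M}))"
    have K: "snd (index n) < K" if "n \<in> {m..M}" for n
      using that by (auto simp: K_def less_Suc_eq_le intro!: Max_ge)
    define S0 where "S0 = {k. k' \<le> k \<and> k < k' + K \<and> (l', k) \<in> Q}"
    define S where "S = (\<lambda>j. {k. 0 \<le> k \<and> k < 0 + K \<and> (j, k) \<in> Q})"
    \<comment> \<open>\<open>W\<close> encloses the indices from position \<open>m\<close> to
      \<open>M\<close>: those from \<open>k'\<close> on at level \<open>l'\<close>, and all at later
      levels, cut off at \<open>K\<close>. Enlarging the set is harmless since \<open>H\<close> is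
      nonnegative on \<open>Q\<close>.\<close>
    define W where "W = {l'} \<times> S0 \<union> Sigma {Suc l'..L} S"
    have fin: "finite S0" "finite (S j)" for j by (auto simp: S0_def S_def)
    have "index ` {m..M} \<subseteq> W"
    proof
      fix q assume "q \<in> index ` {m..M}"
      then obtain n where n: "n \<in> {m..M}" "q = index n" by auto
      obtain l k where q: "q = (l, k)" by (cases q)
      have ind: "index n = (l, k)" using n(2) q by simp
      have "(l, k) \<in> Q" using index_Q[of n] ind by simp
      moreover have "k < K" using K[OF n(1)] ind by simp
      moreover have "l' < l \<or> l' = l \<and> k' \<le> k" using index_mono_lex[of m n] n(1) m ind by simp
      moreover have "l \<le> L" using index_mono_lex[of n M] n(1) M ind by auto
      ultimately show "q \<in> W" by (auto simp: W_def S_def S0_def q)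
    qed
    moreover have WQ: "W \<subseteq> Q" by (auto simp: W_def S0_def S_def)
    moreover have "finite W" unfolding W_def using fin by (intro finite_UnI finite_SigmaI) auto
    ultimately have "(\<Sum>q\<in>index ` {m..M}. H (fst q) (snd q)) \<le> (\<Sum>q\<in>W. H (fst q) (snd q))"
    proof (intro sum_mono2)
      fix q assume "q \<in> W - index ` {m..M}"
      with WQ have "(fst q, snd q) \<in> Q" by auto
      then show "0 \<le> H (fst q) (snd q)" by (rule nonneg)
    qed
    moreover have "(\<Sum>q\<in>index ` {m..M}. H (fst q) (snd q)) = (\<Sum>n=m..M. a n)"
      unfolding a_def by (subst sum.reindex) (auto intro: inj_on_subset[OF inj_index] simp: o_def)
    moreover have "(\<Sum>q\<in>W. H (fst q) (snd q))
        = (\<Sum>q\<in>{l'} \<times> S0. H (fst q) (snd q)) + (\<Sum>q\<in>Sigma {Suc l'..L} S. H (fst q) (snd q))"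
      unfolding W_def using fin by (intro sum.union_disjoint finite_SigmaI) auto
    moreover have "(\<Sum>q\<in>{l'} \<times> S0. H (fst q) (snd q)) = (\<Sum>k\<in>S0. H l' k)"
      using sum.cartesian_product[of "\<lambda>x y. H x y" S0 "{l'}"] by (simp add: split_def)
    moreover have "(\<Sum>q\<in>Sigma {Suc l'..L} S. H (fst q) (snd q)) = (\<Sum>j=Suc l'..L. \<Sum>k\<in>S j. H j k)"
      using fin by (simp add: sum.Sigma split_def)
    moreover have "(\<Sum>k\<in>S0. H l' k) \<le> C * G * H l' k'"
      unfolding S0_def by (rule level[OF mQ])
    moreover have "(\<Sum>j=Suc l'..L. \<Sum>k\<in>S j. H j k) \<le> C ^ 4 * G * G * H l' k'"
    proof -
      have "(\<Sum>j=Suc l'..L. \<Sum>k\<in>S j. H j k) \<le> (\<Sum>j=Suc l'..L. C ^ 4 * G * H l' k' * \<rho> ^ (j - Suc l'))"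
      proof (rule sum_mono)
        fix j assume "j \<in> {Suc l'..L}"
        \<comment> \<open>Level \<open>j\<close> is not the first one, so it starts from the final
          iterate of the completed level \<open>i\<close>.\<close>
        then obtain i where i: "j = Suc i" "l' \<le> i" "i < L" by (cases j) auto
        have LQ: "\<forall>j<L. ks j \<noteq> \<infinity>" using index_Q[of M] M by (simp add: Q_def)
        obtain ki where ki: "ks i = enat ki" using LQ i by auto
        obtain kl where kl: "ks l' = enat kl" using LQ[rule_format, of l'] i by auto
        have jQ: "(Suc i, 0) \<in> Q" using LQ i by (auto simp: Q_def zero_enat_def[symmetric])
        have lQ: "(l', kl) \<in> Q" using mQ kl by (simp add: Q_def)
        have kkl: "k' \<le> kl" using mQ kl by (simp add: Q_def)
        have h0: "H l' k' \<ge> 0" by (rule nonneg[OF mQ])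
        have "(\<Sum>k\<in>S j. H j k) \<le> C * G * H (Suc i) 0"
          unfolding S_def i by (rule level[OF jQ])
        also have "\<dots> \<le> C * G * (C * H i ki)"
          using A G by (intro mult_left_mono nested jQ ki) auto
        also have "\<dots> \<le> C * G * (C * (C * \<rho> ^ (i - l') * H l' kl))"
          using A G by (intro mult_left_mono outer[OF jQ i(2) ki kl]) auto
        also have "\<dots> \<le> C * G * (C * (C * \<rho> ^ (i - l') * (C * \<rho> ^ (kl - k') * H l' k')))"
          using A G by (intro mult_left_mono inner[OF lQ kkl]) auto
        also have "\<dots> \<le> C * G * (C * (C * \<rho> ^ (i - l') * (C * 1 * H l' k')))"
          using A G h0 by (intro mult_left_mono mult_right_mono power_le_one) auto
        also have "\<dots> = C ^ 4 * G * H l' k' * \<rho> ^ (j - Suc l')"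
          by (simp add: i power4_eq_xxxx mult_ac)
        finally show "(\<Sum>k\<in>S j. H j k) \<le> C ^ 4 * G * H l' k' * \<rho> ^ (j - Suc l')" .
      qed
      also have "\<dots> = C ^ 4 * G * H l' k' * (\<Sum>j=Suc l'..L. \<rho> ^ (j - Suc l'))"
        by (simp add: sum_distrib_left)
      also have "(\<Sum>j=Suc l'..L. \<rho> ^ (j - Suc l')) = (\<Sum>i<Suc L - Suc l'. \<rho> ^ i)"
        by (rule sum.reindex_bij_witness[of _ "\<lambda>i. i + Suc l'" "\<lambda>j. j - Suc l'"]) auto
      also have "C ^ 4 * G * H l' k' * (\<Sum>i<Suc L - Suc l'. \<rho> ^ i) \<le> C ^ 4 * G * H l' k' * G"
        unfolding G_def using A nonneg[OF mQ] by (intro mult_left_mono geometric_sum_le) auto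
      finally show ?thesis by (simp add: mult_ac)
    qed
    ultimately have "(\<Sum>n=m..M. a n) \<le> (C * G + C ^ 4 * G * G) * H l' k'"
      by (simp add: algebra_simps)
    also have "\<dots> \<le> Ct * H l' k'" unfolding Ct_def using nonneg[OF mQ] by (intro mult_right_mono) auto
    finally show ?thesis by (simp add: a_def m)
  qed
  have Ct: "Ct > 1"
  proof -
    have "0 < C * G" using A G by simp
    moreover have "0 \<le> C ^ 4 * G * G" using A G by simp
    ultimately show ?thesis by (simp add: Ct_def)
  qed
  have a0: "a n \<ge> 0" for n unfolding a_def using index_Q[of n] by (intro nonneg) simp
  show ?thesis
  proof (intro exI conjI allI impI)
    show "0 < 1 - 1 / Ct" "1 - 1 / Ct < 1" "0 < Ct" using Ct by auto
    fix l' k' l k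
    assume asm: "(l', k') \<in> Q \<and> (l, k) \<in> Q \<and> count l' k' \<le> count l k"
    obtain m where m: "index m = (l', k')" using index_surj asm by blast
    obtain n where n: "index n = (l, k)" using index_surj asm by blast
    have "m \<le> n" using asm count_index[OF m] count_index[OF n] by simp
    then have "a n \<le> Ct * (1 - 1 / Ct) ^ (n - m) * a m"
      by (intro tail_sum_decay Ct tail a0)
    then show "H l k \<le> Ct * (1 - 1 / Ct) ^ (count l k - count l' k') * H l' k'"
      using count_index[OF m] count_index[OF n] by (simp add: a_def m n)
  qed
qed

end

section \<open>Mesh refinement and estimator reduction\<close>

lemma nvb_refinements_refl: "conforming \<T> \<Longrightarrow> \<T> \<in> nvb_refinements \<T>"
  by (simp add: nvb_refinements_def)

lemma nvb_refinements_trans: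
  "\<T>' \<in> nvb_refinements \<T> \<Longrightarrow> \<T> \<in> nvb_refinements \<T>0 \<Longrightarrow> \<T>' \<in> nvb_refinements \<T>0"
  by (auto simp: nvb_refinements_def)

lemma nvb_refinements_conforming: "\<T>' \<in> nvb_refinements \<T> \<Longrightarrow> conforming \<T>'"
  by (simp add: nvb_refinements_def)

text \<open>Admissibility provides the unique existence behind the definite description in
  \<open>nvb_refine\<close>.\<close>

lemma nvb_refine_spec:
  assumes "nvb_admissible \<T>0" "\<T> \<in> nvb_refinements \<T>0" "\<M> \<subseteq> \<T>"
  shows "nvb_refine \<T> \<M> \<in> nvb_refinements \<T>" "\<M> \<inter> nvb_refine \<T> \<M> = {}"
proof -
  have "\<exists>!\<T>'. is_coarsest_refinement \<T> \<M> \<T>'" using assms by (simp add: nvb_admissible_def)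
  from theI'[OF this] have "is_coarsest_refinement \<T> \<M> (nvb_refine \<T> \<M>)" by (simp add: nvb_refine_def)
  then show "nvb_refine \<T> \<M> \<in> nvb_refinements \<T>" "\<M> \<inter> nvb_refine \<T> \<M> = {}"
    by (auto simp: is_coarsest_refinement_def)
qed

text \<open>Bisection adds only the midpoint of an edge, so all vertices of a child lie in the
  convex hull of its parent.\<close>

lemma geo_nvb_children:
  assumes "fst T \<noteq> []" "T' \<in> nvb_children T"
  shows "fst T' \<noteq> []" "geo T' \<subseteq> geo T"
proof -
  let ?zs = "fst T" and ?m = "midpoint (hd (fst T)) (last (fst T))"
  define inner where "inner = butlast (tl (fst T))"
  have inner: "set inner \<subseteq> set ?zs"
    unfolding inner_def by (meson in_set_butlastD list.set_sel(2) assms(1) subsetI)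
  have "?m \<in> convex hull (set ?zs)"
    using assms(1) by (intro midpoints_in_convex_hull hull_inc) auto
  moreover have "set ?zs \<subseteq> convex hull (set ?zs)" by (rule hull_subset)
  moreover have "set (fst T') \<subseteq> insert ?m (set ?zs)"
  proof -
    have "x \<in> set ?zs" if "x \<in> set (take g inner)" for x g
      using that inner in_set_takeD[of x g inner] by blast
    moreover have "x \<in> set ?zs" if "x \<in> set (drop g inner)" for x g
      using that inner in_set_dropD[of x g inner] by blast
    ultimately show ?thesis
      using assms inner unfolding nvb_children_def Let_def inner_def[symmetric] by auto
  qed
  ultimately have "set (fst T') \<subseteq> convex hull (set ?zs)" by blast
  then show "geo T' \<subseteq> geo T" unfolding geo_def by (simp add: hull_minimal)
  show "fst T' \<noteq> []" using assms(2) by (auto simp: nvb_children_def Let_def)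
qed

lemma geo_nvb_refinement:
  assumes "\<T>' \<in> nvb_refinements \<T>" "conforming \<T>" "T' \<in> \<T>'"
  shows "\<exists>T\<in>\<T>. geo T' \<subseteq> geo T"
proof -
  have ne: "\<forall>T\<in>\<T>. fst T \<noteq> []"
    using assms(2) by (force simp: conforming_def valid_tsimplex_def)
  have "bisect_step\<^sup>*\<^sup>* \<T> \<T>'" using assms(1) by (simp add: nvb_refinements_def)
  then have "\<forall>T'\<in>\<T>'. fst T' \<noteq> [] \<and> (\<exists>T\<in>\<T>. geo T' \<subseteq> geo T)"
  proof (induction rule: rtranclp_induct)
    case base
    then show ?case using ne by blast
  next
    case (step \<U> \<U>')
    from step.hyps(2) obtain S where S: "S \<in> \<U>" "\<U>' = (\<U> - {S}) \<union> nvb_children S"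
      by (auto simp: bisect_step_def)
    have IH: "fst T' \<noteq> []" "\<exists>T\<in>\<T>. geo T' \<subseteq> geo T" if "T' \<in> \<U>" for T'
      using step.IH that by auto
    show ?case
    proof
      fix T' assume "T' \<in> \<U>'"
      with S(2) consider "T' \<in> \<U>" | "T' \<in> nvb_children S" by auto
      then show "fst T' \<noteq> [] \<and> (\<exists>T\<in>\<T>. geo T' \<subseteq> geo T)"
      proof cases
        case 1
        then show ?thesis using IH by blast
      next
        case 2
        from geo_nvb_children[OF IH(1)[OF S(1)] 2] IH(2)[OF S(1)] show ?thesis by (meson order_trans)
      qed
    qed
  qed
  with assms(3) show ?thesis by blast
qed

text \<open>Every refined element lies inside a coarse one and inherits its polynomial.\<close>

lemma fe_space_nvb_refinement:
  assumes "\<T>' \<in> nvb_refinements \<T>" "conforming \<T>"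
  shows "fe_space D p \<T> \<subseteq> fe_space D p \<T>'"
proof
  fix v assume v: "v \<in> fe_space D p \<T>"
  have "\<exists>q. polynomial_le p q \<and> (\<forall>x\<in>geo T'. v x = q x)" if "T' \<in> \<T>'" for T'
  proof -
    obtain T where T: "T \<in> \<T>" "geo T' \<subseteq> geo T" using geo_nvb_refinement[OF assms \<open>T' \<in> \<T>'\<close>] by blast
    with v obtain q where "polynomial_le p q" "\<forall>x\<in>geo T. v x = q x" unfolding fe_space_def by blast
    with T show ?thesis by blast
  qed
  with v show "v \<in> fe_space D p \<T>'" unfolding fe_space_def by blast
qed

section \<open>Sums of local error indicators\<close>

lemma eta_nonneg: "eta D \<T> \<U> v \<ge> 0"
  by (simp add: eta_def sum_nonneg)

lemma eta_sq: "(eta D \<T> \<U> v)\<^sup>2 = (\<Sum>T\<in>\<U>. (eta_elem D \<T> T v)\<^sup>2)"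
  by (simp add: eta_def sum_nonneg)

lemma eta_sq_split:
  assumes "finite \<T>"
  shows "(eta D \<S> \<T> v)\<^sup>2 = (eta D \<S> (\<T> \<inter> \<U>) v)\<^sup>2 + (eta D \<S> (\<T> - \<U>) v)\<^sup>2"
proof -
  have "\<T> = (\<T> \<inter> \<U>) \<union> (\<T> - \<U>)" by auto
  then show ?thesis
    unfolding eta_sq using assms by (metis (no_types, lifting) Diff_disjoint Int_Diff_disjoint finite_Diff finite_Int sum.union_disjoint)
qed

lemma eta_mono_set:
  assumes "finite \<V>" "\<U> \<subseteq> \<V>"
  shows "(eta D \<T> \<U> v)\<^sup>2 \<le> (eta D \<T> \<V> v)\<^sup>2"
  unfolding eta_sq using assms by (intro sum_mono2) auto

section \<open>The model problem in terms of \<open>b\<close> and \<open>N\<close>\<close>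

locale afem_problem = pde_problem D for D :: "'n::finite pde" +
  fixes Cell Cbnd :: real and p :: nat and \<T>0 :: "'n tmesh" and ustar :: "real^'n \<Rightarrow> real"
    and Cstab qred Crel :: real
  assumes elliptic: "bounded_elliptic D Cell Cbnd"
    and ustar: "solves_in D (H10 (dom D)) ustar"
    and triangulation: "triangulates \<T>0 (dom D)" and admissible: "nvb_admissible \<T>0"
    and stab: "Cstab > 0" "stability D p \<T>0 Cstab"
    and red: "0 < qred" "qred < 1" "reduction D p \<T>0 qred"
    and rel: "Crel > 0" "reliability D p \<T>0 ustar Crel"
begin

abbreviation "V \<equiv> H10 (dom D)"
abbreviation "b \<equiv> bform D"
abbreviation "\<kappa> \<equiv> Cbnd / Cell"
abbreviation "X \<equiv> fe_space D p"

lemma Cell_pos: "Cell > 0" and Cbnd_ge: "Cell \<le> Cbnd"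
  and b_upper: "v \<in> V \<Longrightarrow> w \<in> V \<Longrightarrow> \<bar>b v w\<bar> \<le> Cbnd * enorm D v * enorm D w"
  and b_lower: "v \<in> V \<Longrightarrow> Cell * (enorm D v)\<^sup>2 \<le> b v v"
  using elliptic unfolding bounded_elliptic_def by blast+

text \<open>\<open>sqrt\<close> is odd in HOL, so \<open>enorm\<close> carries a sign as long as
  that of the energy form is open; ellipticity controls its square and thereby its absolute
  value.\<close>

lemma abs_enorm_le: "v \<in> V \<Longrightarrow> \<bar>enorm D v\<bar> \<le> sqrt (b v v) / sqrt Cell"
proof -
  assume v: "v \<in> V"
  have "(enorm D v)\<^sup>2 \<le> b v v / Cell" using b_lower[OF v] Cell_pos by (simp add: field_simps)
  then show ?thesis by (simp add: real_le_rsqrt real_sqrt_divide[symmetric] abs_le_square_iff real_sqrt_abs2 flip: real_sqrt_abs)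
qed

lemma zero_V: "(\<lambda>x. 0) \<in> V"
  using ustar H10_linear[of ustar ustar 0 0] by (simp add: solves_in_def)

sublocale coercive_form V b \<kappa>
proof
  show "V \<noteq> {}" using zero_V by blast
  show "b v v \<ge> 0" if "v \<in> V" for v
    using b_lower[OF that] Cell_pos by (meson less_imp_le mult_nonneg_nonneg order_trans zero_le_power2)
  show "1 \<le> \<kappa>" using Cell_pos Cbnd_ge by simp
  show "\<bar>b v w\<bar> \<le> \<kappa> * (sqrt (b v v) * sqrt (b w w))" if v: "v \<in> V" and w: "w \<in> V" for v w
  proof -
    have "\<bar>b v w\<bar> \<le> Cbnd * (enorm D v * enorm D w)" using b_upper[OF v w] by (simp add: mult.assoc)
    also have "\<dots> \<le> Cbnd * (\<bar>enorm D v\<bar> * \<bar>enorm D w\<bar>)"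
      using Cell_pos Cbnd_ge by (intro mult_left_mono) (simp_all add: abs_mult[symmetric])
    also have "\<dots> \<le> Cbnd * ((sqrt (b v v) / sqrt Cell) * (sqrt (b w w) / sqrt Cell))"
      using Cell_pos Cbnd_ge by (intro mult_left_mono mult_mono' abs_enorm_le v w) auto
    also have "\<dots> = \<kappa> * (sqrt (b v v) * sqrt (b w w))"
      using Cell_pos by simp
    finally show ?thesis .
  qed
qed (use H10_linear bform_linear_left bform_linear_right in \<open>simp_all only:\<close>)

lemma enorm_le_N: "v \<in> V \<Longrightarrow> enorm D v \<le> N v / sqrt Cell"
  using abs_enorm_le[of v] by (simp add: N_def)

lemma X_V: "X \<T> \<subseteq> V"
  using fe_space_H10 by blast

lemma zero_X: "(\<lambda>x. 0) \<in> X \<T>"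
  unfolding fe_space_def polynomial_le_def using zero_V
  by (auto intro!: exI[of _ "\<lambda>x. 0"] exI[of _ "\<lambda>\<alpha>. 0"])

lemma X_diff: "v \<in> X \<T> \<Longrightarrow> w \<in> X \<T> \<Longrightarrow> (\<lambda>x. v x - w x) \<in> X \<T>"
  using fe_space_linear[of v p \<T> w 1 "-1"] by simp

lemma initial_mesh_nvb: "\<T>0 \<in> nvb_refinements \<T>0"
  using triangulation by (auto simp: triangulates_def intro: nvb_refinements_refl)

lemma nvb_self: "\<T> \<in> nvb_refinements \<T>0 \<Longrightarrow> \<T> \<in> nvb_refinements \<T>"
  by (intro nvb_refinements_refl nvb_refinements_conforming)

lemma finite_mesh: "\<T> \<in> nvb_refinements \<T>0 \<Longrightarrow> finite \<T>"
  using nvb_refinements_conforming by (auto simp: conforming_def)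

lemma eta_lipschitz_enorm:
  assumes "\<T> \<in> nvb_refinements \<T>0" "v \<in> X \<T>" "w \<in> X \<T>"
  shows "\<bar>eta D \<T> \<T> v - eta D \<T> \<T> w\<bar> \<le> Cstab * enorm D (\<lambda>x. v x - w x)"
  using stab(2) assms nvb_self[OF assms(1)] unfolding stability_def by fastforce

text \<open>Stability on a single mesh, applied to \<open>v\<close> and the zero function, bounds an
  absolute value by \<open>Cstab * enorm D v\<close>.\<close>

lemma enorm_nonneg:
  assumes "\<T> \<in> nvb_refinements \<T>0" "v \<in> X \<T>"
  shows "enorm D v \<ge> 0"
proof -
  have "0 \<le> Cstab * enorm D v"
    using eta_lipschitz_enorm[OF assms zero_X] by (simp add: order_trans[OF abs_ge_zero])
  then show ?thesis using stab(1) by (simp add: zero_le_mult_iff)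
qed

lemma N_le_enorm:
  assumes "\<T> \<in> nvb_refinements \<T>0" "v \<in> X \<T>"
  shows "N v \<le> sqrt Cbnd * enorm D v"
proof -
  have v: "v \<in> V" using assms X_V by blast
  have "b v v \<le> Cbnd * (enorm D v)\<^sup>2" using b_upper[OF v v] by (simp add: power2_eq_square mult.assoc)
  then have "N v \<le> sqrt (Cbnd * (enorm D v)\<^sup>2)" unfolding N_def by (rule real_sqrt_le_mono)
  then show ?thesis using enorm_nonneg[OF assms] by (simp add: real_sqrt_mult)
qed

definition "Cst = Cstab / sqrt Cell"

lemma Cst_pos: "Cst > 0"
  using stab(1) Cell_pos by (simp add: Cst_def)

lemma eta_lipschitz:
  assumes "\<T> \<in> nvb_refinements \<T>0" "v \<in> X \<T>" "w \<in> X \<T>"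
  shows "\<bar>eta D \<T> \<T> v - eta D \<T> \<T> w\<bar> \<le> Cst * gap v w"
proof -
  have "(\<lambda>x. v x - w x) \<in> V" using X_diff[OF assms(2,3)] X_V by blast
  from enorm_le_N[OF this] have "Cstab * enorm D (\<lambda>x. v x - w x) \<le> Cstab * (gap v w / sqrt Cell)"
    using stab(1) by (intro mult_left_mono) auto
  with eta_lipschitz_enorm[OF assms] show ?thesis by (simp add: Cst_def)
qed

text \<open>The sign of \<open>enorm D (ustar - u)\<close> is not known a priori, so reliability is only applied through
  the boundedness of the bilinear form, tested with a discrete function.\<close>
lemma galerkin_diff_le_eta:
  assumes \<T>: "\<T> \<in> nvb_refinements \<T>0" and \<T>': "\<T>' \<in> nvb_refinements \<T>"
    and u: "solves_in D (X \<T>) u" and u': "solves_in D (X \<T>') u'"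
  shows "gap u' u \<le> Cbnd * Crel / sqrt Cell * eta D \<T> \<T> u"
proof -
  let ?w = "\<lambda>x. u' x - u x" and ?e = "\<lambda>x. ustar x - u x"
  have T0: "\<T>' \<in> nvb_refinements \<T>0" using nvb_refinements_trans[OF \<T>' \<T>] .
  have "u \<in> X \<T>'" using fe_space_nvb_refinement[OF \<T>' nvb_refinements_conforming[OF \<T>]] u
    by (auto simp: solves_in_def)
  moreover have u'X: "u' \<in> X \<T>'" using u' by (simp add: solves_in_def)
  ultimately have w: "?w \<in> X \<T>'" by (intro X_diff)
  have V: "u \<in> V" "u' \<in> V" "ustar \<in> V" using u u'X ustar X_V by (auto simp: solves_in_def)
  have wV: "?w \<in> V" using w X_V by blast
  have eV: "?e \<in> V" using V by (intro V_diff)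
  \<comment> \<open>The test function lies in the finer space, where \<open>u'\<close> and
    \<open>ustar\<close> satisfy the same equation. This brings in \<open>ustar\<close>, to which
    reliability applies.\<close>
  have "b u' ?w = rhs D ?w" using u' w by (simp add: solves_in_def)
  also have "\<dots> = b ustar ?w" using ustar wV by (simp add: solves_in_def)
  finally have eq: "b u' ?w = b ustar ?w" .
  have "(N ?w)\<^sup>2 = b u' ?w - b u ?w" using V wV by (simp add: N_sq b_diff_left)
  also have "\<dots> = b ?e ?w" using V wV eq by (simp add: b_diff_left)
  also have "\<dots> \<le> Cbnd * enorm D ?e * enorm D ?w" using b_upper[OF eV wV] by simp
  also have "\<dots> \<le> Cbnd * (Crel * eta D \<T> \<T> u) * enorm D ?w"
  proof (intro mult_right_mono mult_left_mono)
    show "enorm D ?e \<le> Crel * eta D \<T> \<T> u" using rel(2) \<T> u by (simp add: reliability_def)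
  qed (use Cell_pos Cbnd_ge enorm_nonneg[OF T0 w] in auto)
  also have "\<dots> \<le> Cbnd * (Crel * eta D \<T> \<T> u) * (N ?w / sqrt Cell)"
    using Cell_pos Cbnd_ge rel(1) by (intro mult_left_mono enorm_le_N wV mult_nonneg_nonneg eta_nonneg) auto
  finally have le: "N ?w * N ?w \<le> (Cbnd * Crel / sqrt Cell * eta D \<T> \<T> u) * N ?w"
    by (simp add: power2_eq_square mult_ac)
  show ?thesis
  proof (cases "N ?w = 0")
    case True
    then show ?thesis using Cell_pos Cbnd_ge rel(1) eta_nonneg[of D \<T> \<T> u] by simp
  next
    case False
    then have "N ?w > 0" using N_nonneg[OF wV] by simp
    with le show ?thesis by (rule mult_right_le_imp_le)
  qed
qed

text \<open>Unrefined elements keep their total contribution, by stability with equal arguments; the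
  refined ones lose the factor \<open>qred\<close>. Every marked element is refined, so Doerfler
  marking ensures that at least the share \<theta> of the square is reduced.\<close>

lemma eta_refine_le:
  assumes \<T>: "\<T> \<in> nvb_refinements \<T>0" and v: "v \<in> X \<T>" and M: "\<M> \<subseteq> \<T>"
    and \<theta>: "0 < \<theta>" "\<theta> \<le> 1" and mark: "\<theta> * (eta D \<T> \<T> v)\<^sup>2 \<le> (eta D \<T> \<M> v)\<^sup>2"
  shows "eta D (nvb_refine \<T> \<M>) (nvb_refine \<T> \<M>) v \<le> sqrt (1 - (1 - qred\<^sup>2) * \<theta>) * eta D \<T> \<T> v"
proof -
  let ?T = "nvb_refine \<T> \<M>"
  note ref = nvb_refine_spec[OF admissible \<T> M]
  have T0: "?T \<in> nvb_refinements \<T>0" using nvb_refinements_trans[OF ref(1) \<T>] .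
  have fin: "finite \<T>" "finite ?T" using finite_mesh \<T> T0 by auto
  have vT: "v \<in> X ?T" using fe_space_nvb_refinement[OF ref(1) nvb_refinements_conforming[OF \<T>]] v by blast
  \<comment> \<open>The difference is the zero function, so the right-hand side of the stability
    estimate is at most 0.\<close>
  have "enorm D (\<lambda>x. v x - v x) \<le> 0"
    using enorm_le_N[OF zero_V] b_zero(1)[OF zero_V] by (simp add: N_def)
  then have "Cstab * enorm D (\<lambda>x. v x - v x) \<le> 0" using stab(1) by (simp add: mult_le_0_iff)
  moreover have "\<bar>eta D ?T (?T \<inter> \<T>) v - eta D \<T> (?T \<inter> \<T>) v\<bar> \<le> Cstab * enorm D (\<lambda>x. v x - v x)"
    using stab(2) \<T> ref(1) v vT unfolding stability_def by blast
  ultimately have same: "eta D ?T (?T \<inter> \<T>) v = eta D \<T> (?T \<inter> \<T>) v" by linarith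
  have "eta D ?T (?T - \<T>) v \<le> qred * eta D \<T> (\<T> - ?T) v"
    using red(3) \<T> ref(1) v unfolding reduction_def by blast
  from power_mono[OF this eta_nonneg, of 2]
  have r: "(eta D ?T (?T - \<T>) v)\<^sup>2 \<le> qred\<^sup>2 * (eta D \<T> (\<T> - ?T) v)\<^sup>2" by (simp add: power_mult_distrib)
  have "\<theta> * (eta D \<T> \<T> v)\<^sup>2 \<le> (eta D \<T> (\<T> - ?T) v)\<^sup>2"
    using mark eta_mono_set[of "\<T> - ?T" \<M> D \<T> v] M ref(2) fin by fastforce
  then have m: "(1 - qred\<^sup>2) * (\<theta> * (eta D \<T> \<T> v)\<^sup>2) \<le> (1 - qred\<^sup>2) * (eta D \<T> (\<T> - ?T) v)\<^sup>2"
    using red by (intro mult_left_mono) (auto simp: power_le_one)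
  have "(eta D ?T ?T v)\<^sup>2 = (eta D ?T (?T \<inter> \<T>) v)\<^sup>2 + (eta D ?T (?T - \<T>) v)\<^sup>2"
    by (rule eta_sq_split[OF fin(2)])
  also have "\<dots> \<le> (eta D \<T> (\<T> \<inter> ?T) v)\<^sup>2 + qred\<^sup>2 * (eta D \<T> (\<T> - ?T) v)\<^sup>2"
    using r same by (simp add: Int_commute)
  also have "\<dots> = (eta D \<T> \<T> v)\<^sup>2 - (1 - qred\<^sup>2) * (eta D \<T> (\<T> - ?T) v)\<^sup>2"
    using eta_sq_split[OF fin(1), of D \<T> v ?T] by (simp add: algebra_simps)
  also have "\<dots> \<le> (1 - (1 - qred\<^sup>2) * \<theta>) * (eta D \<T> \<T> v)\<^sup>2"
    using m by (simp add: algebra_simps)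
  finally have "(eta D ?T ?T v)\<^sup>2 \<le> (1 - (1 - qred\<^sup>2) * \<theta>) * (eta D \<T> \<T> v)\<^sup>2" .
  then have "sqrt ((eta D ?T ?T v)\<^sup>2) \<le> sqrt ((1 - (1 - qred\<^sup>2) * \<theta>) * (eta D \<T> \<T> v)\<^sup>2)"
    by (rule real_sqrt_le_mono)
  then show ?thesis by (simp add: real_sqrt_mult eta_nonneg)
qed

end

section \<open>The adaptive algorithm\<close>

locale afem = afem_problem D Cell Cbnd p \<T>0 ustar Cstab qred Crel
  for D :: "'n::finite pde" and Cell Cbnd p \<T>0 ustar Cstab qred Crel +
  fixes \<theta> Cmark :: real and u00 :: "real^'n \<Rightarrow> real" and Calg lamalg :: real and kmax :: nat
    and \<tau> :: real and r :: "'n afem_run" and Cpre :: real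
  assumes \<theta>: "0 < \<theta>" "\<theta> \<le> 1" and pars: "Calg > 0" "lamalg > 0" "kmax \<ge> 1" "\<tau> < 0"
    and run: "afem_pgmres D p \<T>0 \<theta> Cmark u00 Calg lamalg kmax \<tau> r"
    and Cpre: "Cpre \<ge> 1" "norm_equivalence D \<tau> r Cpre"
begin

abbreviation "R \<equiv> reached D \<tau> r"
abbreviation "Y l \<equiv> X (mesh r l)"
abbreviation "u \<equiv> iterate r"
abbreviation "a \<equiv> alg_err D r"
abbreviation "g \<equiv> est D r"
abbreviation "H \<equiv> quasi_error D r"

text \<open>Converts (PRE) from the energy norm to \<open>N\<close>: the second entry bounds
  \<open>pnorm\<close> by \<open>N\<close> through ellipticity, the third bounds \<open>N\<close> by
  \<open>pnorm\<close> through boundedness.\<close>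

definition "\<gamma> = max 1 (max (Cpre / sqrt Cell) (sqrt Cbnd * Cpre))"

section \<open>Meshes, spaces and solver on the levels of a run\<close>

lemma R_mono: "R l \<Longrightarrow> j \<le> l \<Longrightarrow> R j"
  by (auto simp: reached_def)

lemma R_SucD: "R (Suc l) \<Longrightarrow> R l" "R (Suc l) \<Longrightarrow> level_finishes D \<tau> r l"
  by (auto simp: reached_def)

lemma solve: "R l \<Longrightarrow> solve_level D p kmax r l"
  using run by (simp add: afem_pgmres_def)

lemma update: "R (Suc l) \<Longrightarrow> update_params D r l" and mark: "R (Suc l) \<Longrightarrow> mark_refine D \<theta> Cmark r l"
  using run R_SucD[of l] by (auto simp: afem_pgmres_def)

lemma mesh_nvb: "R l \<Longrightarrow> mesh r l \<in> nvb_refinements \<T>0"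
proof (induction l)
  case 0
  show ?case using run initial_mesh_nvb by (simp add: afem_pgmres_def)
next
  case (Suc l)
  have IH: "mesh r l \<in> nvb_refinements \<T>0" using Suc R_SucD by blast
  have m: "marked r l \<subseteq> mesh r l" "mesh r (Suc l) = nvb_refine (mesh r l) (marked r l)"
    using mark[OF Suc.prems] by (auto simp: mark_refine_def Let_def doerfler_sets_def)
  show ?case unfolding m(2)
    by (rule nvb_refinements_trans[OF nvb_refine_spec(1)[OF admissible IH m(1)] IH])
qed

lemma mesh_Suc:
  assumes "R (Suc l)"
  shows "mesh r (Suc l) \<in> nvb_refinements (mesh r l)" "mesh r (Suc l) = nvb_refine (mesh r l) (marked r l)"
    "marked r l \<subseteq> mesh r l" "u (Suc l) 0 = u l (the_enat (kstop r l))"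
    "\<theta> * (g l (the_enat (kstop r l)))\<^sup>2 \<le> (eta D (mesh r l) (marked r l) (u l (the_enat (kstop r l))))\<^sup>2"
proof -
  show m: "marked r l \<subseteq> mesh r l" "mesh r (Suc l) = nvb_refine (mesh r l) (marked r l)"
    "u (Suc l) 0 = u l (the_enat (kstop r l))"
    "\<theta> * (g l (the_enat (kstop r l)))\<^sup>2 \<le> (eta D (mesh r l) (marked r l) (u l (the_enat (kstop r l))))\<^sup>2"
    using mark[OF assms] by (auto simp: mark_refine_def Let_def doerfler_sets_def est_def)
  show "mesh r (Suc l) \<in> nvb_refinements (mesh r l)"
    unfolding m(2) by (rule nvb_refine_spec(1)[OF admissible mesh_nvb m(1)]) (rule R_SucD[OF assms])
qed

lemma mesh_mono: "R l \<Longrightarrow> j \<le> l \<Longrightarrow> mesh r l \<in> nvb_refinements (mesh r j)"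
proof (induction l)
  case 0
  then show ?case using nvb_self[OF mesh_nvb] by simp
next
  case (Suc l)
  show ?case
  proof (cases "j = Suc l")
    case True
    then show ?thesis using nvb_self[OF mesh_nvb] Suc by simp
  next
    case False
    then have "mesh r l \<in> nvb_refinements (mesh r j)" using Suc R_SucD by auto
    with mesh_Suc(1)[OF Suc.prems(1)] show ?thesis by (rule nvb_refinements_trans)
  qed
qed

lemma level:
  assumes l: "R l"
  shows "galerkin_level V b \<kappa> (ndof r l) (precond r l) (Y l) (basis_fun r l) (rhs D) \<gamma>"
proof
  let ?fe = "fe_fun (ndof r l) (basis_fun r l)"
  note sl = solve[OF l, unfolded solve_level_def]
  show "spd (ndof r l) (precond r l)" "is_basis (ndof r l) (basis_fun r l) (Y l)" using sl by blast+
  show "Y l \<subseteq> V" by (rule X_V)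
  show "(\<lambda>x. 0) \<in> Y l" by (rule zero_X)
  show "1 \<le> \<gamma>" by (simp add: \<gamma>_def)
  show "(\<lambda>x. \<alpha> * v x + \<beta> * w x) \<in> Y l" if "v \<in> Y l" "w \<in> Y l" for v w \<alpha> \<beta>
    by (rule fe_space_linear[OF that])
  show "rhs D (\<lambda>x. \<alpha> * v x + \<beta> * w x) = \<alpha> * rhs D v + \<beta> * rhs D w" if "v \<in> V" "w \<in> V" for v w \<alpha> \<beta>
    by (rule rhs_linear[OF that])
  fix x :: "real Matrix.vec" assume x: "x \<in> carrier_vec (ndof r l)"
  have fe: "?fe x \<in> Y l"
  proof -
    have "(\<lambda>y. \<Sum>j<m. vec_index x j * basis_fun r l j y) \<in> Y l" if "m \<le> ndof r l" for m
      using that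
    proof (induction m)
      case 0
      show ?case using zero_X by simp
    next
      case (Suc m)
      have "basis_fun r l m \<in> Y l" using sl Suc.prems by (simp add: is_basis_def)
      from fe_space_linear[OF Suc.IH this, of 1 "vec_index x m"] Suc.prems show ?case by simp
    qed
    then show ?thesis by (simp add: fe_fun_def)
  qed
  have feV: "?fe x \<in> V" using fe X_V by blast
  have ne: "inverse Cpre * enorm D (?fe x) \<le> pnorm (precond r l) x"
    "pnorm (precond r l) x \<le> Cpre * enorm D (?fe x)"
    using Cpre(2) l x unfolding norm_equivalence_def by blast+
  note N0 = N_nonneg[OF feV]
  have "pnorm (precond r l) x \<le> Cpre * (N (?fe x) / sqrt Cell)"
    using ne(2) enorm_le_N[OF feV] Cpre(1) by (meson mult_left_mono order_trans zero_le_one)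
  also have "\<dots> = Cpre / sqrt Cell * N (?fe x)" by simp
  also have "\<dots> \<le> \<gamma> * N (?fe x)" using N0 by (intro mult_right_mono) (simp_all add: \<gamma>_def)
  finally show "pnorm (precond r l) x \<le> \<gamma> * N (?fe x)" .
  have e: "enorm D (?fe x) \<le> Cpre * pnorm (precond r l) x" using ne(1) Cpre(1) by (simp add: field_simps)
  have "0 \<le> Cpre * pnorm (precond r l) x" using e enorm_nonneg[OF mesh_nvb[OF l] fe] by linarith
  then have p0: "0 \<le> pnorm (precond r l) x" using Cpre(1) by (simp add: zero_le_mult_iff)
  have "N (?fe x) \<le> sqrt Cbnd * enorm D (?fe x)" by (rule N_le_enorm[OF mesh_nvb[OF l] fe])
  also have "\<dots> \<le> sqrt Cbnd * (Cpre * pnorm (precond r l) x)"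
    using e Cell_pos Cbnd_ge by (intro mult_left_mono) auto
  also have "\<dots> = sqrt Cbnd * Cpre * pnorm (precond r l) x" by simp
  also have "\<dots> \<le> \<gamma> * pnorm (precond r l) x" using p0 by (intro mult_right_mono) (simp_all add: \<gamma>_def)
  finally show "N (?fe x) \<le> \<gamma> * pnorm (precond r l) x" .
qed

lemma \<gamma>_ge: "\<gamma> \<ge> 1"
  by (simp add: \<gamma>_def)

lemma u_Y: "R l \<Longrightarrow> u l k \<in> Y l"
  using galerkin_level.fe_X[OF level] by (simp add: iterate_def)

lemma u_V: "R l \<Longrightarrow> u l k \<in> V"
  using u_Y X_V by blast

text \<open>The contraction factor \<open>qpg\<close>, written without reference to a level: it
  depends on \<kappa> and \<gamma> only and hence serves all levels.\<close>

definition "qp = sqrt (1 - 1 / (2 * (\<kappa> * \<gamma> ^ 4)\<^sup>2))"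

text \<open>Extracts from the matrix formulation what is used about a level; from here on the
  arguments concern functions and norms of residuals only.\<close>

lemma level_facts:
  assumes l: "R l"
  shows "enat k \<le> kstop r l \<Longrightarrow> a l k \<ge> 0"
    and "j \<le> k \<Longrightarrow> enat k \<le> kstop r l \<Longrightarrow> a l k \<le> 1 / qp * root kmax qp ^ (k - j) * a l j"
    and "\<exists>v. solves_in D (Y l) v \<and> (\<forall>k. enat k \<le> kstop r l \<longrightarrow>
      gap v (u l k) \<le> \<gamma> * a l k \<and> a l k \<le> \<kappa> * \<gamma> * gap v (u l k))"
    and "0 < qp" "qp < 1"
    and "z \<in> V \<Longrightarrow> \<exists>w\<in>Y l. \<forall>v\<in>Y l. b v w = b v z"
proof -
  interpret L: galerkin_level V b \<kappa> "ndof r l" "precond r l" "Y l" "basis_fun r l" "rhs D" \<gamma>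
    by (rule level[OF l])
  note sl = solve[OF l, unfolded solve_level_def]
  have B: "L.B = galerkin_matrix D (ndof r l) (basis_fun r l)" and d: "L.d = load_vector D (ndof r l) (basis_fun r l)"
    by (simp_all add: L.B_def L.d_def galerkin_matrix_def load_vector_def)
  have a: "a l k = pnorm (precond r l) (L.s (coeff r l k))" for k
    by (simp add: alg_err_def L.s_def B d)
  have qp: "qp = L.qpg" by (simp add: qp_def L.qpg_def)
  have x0: "coeff r l 0 \<in> carrier_vec (ndof r l)" using sl by blast
  have step: "pgmres_step (ndof r l) (precond r l) L.B L.d kmax (coeff r l) k"
    if "1 \<le> k" "k \<le> K" "enat K \<le> kstop r l" for k K
    using sl that unfolding B d by (meson enat_ord_simps(1) order_trans)
  have c: "coeff r l k \<in> carrier_vec (ndof r l)" if "enat k \<le> kstop r l" for k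
    using L.x_carrier[OF pars(3) x0 step[OF _ _ that]] by blast
  show "a l k \<ge> 0" if "enat k \<le> kstop r l" for k
    unfolding a by (intro L.pnorm_nonneg L.s_carrier c that)
  show "a l k \<le> 1 / qp * root kmax qp ^ (k - j) * a l j" if "j \<le> k" "enat k \<le> kstop r l" for j k
    unfolding a qp by (rule L.pgmres_decay[OF pars(3) x0 step[OF _ _ that(2)] that(1)]) auto
  show "0 < qp" "qp < 1" unfolding qp by (rule L.qpg_bounds)+
  show "\<exists>w\<in>Y l. \<forall>v\<in>Y l. b v w = b v z" if "z \<in> V"
    by (rule L.adjoint_galerkin_projection[OF that])
  obtain z where z: "z \<in> carrier_vec (ndof r l)" "L.B *\<^sub>v z = L.d" "\<And>v. v \<in> Y l \<Longrightarrow> b (L.fe z) v = rhs D v"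
    by (rule L.galerkin_solution) blast
  show "\<exists>v. solves_in D (Y l) v \<and> (\<forall>k. enat k \<le> kstop r l \<longrightarrow>
      gap v (u l k) \<le> \<gamma> * a l k \<and> a l k \<le> \<kappa> * \<gamma> * gap v (u l k))"
  proof (intro exI[of _ "L.fe z"] conjI allI impI)
    show "solves_in D (Y l) (L.fe z)" using z(3) L.fe_X by (simp add: solves_in_def)
    fix k assume "enat k \<le> kstop r l"
    from L.residual_error_equivalence[OF z(1,2) c[OF this]]
    show "gap (L.fe z) (u l k) \<le> \<gamma> * a l k" "a l k \<le> \<kappa> * \<gamma> * gap (L.fe z) (u l k)"
      unfolding a iterate_def by auto
  qed
qed


text \<open>The Galerkin solution, chosen together with the equivalence of error and residual that
  \<open>level_facts\<close> provides for it.\<close>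

definition gal :: "nat \<Rightarrow> real^'n \<Rightarrow> real" where
  "gal l = (SOME v. solves_in D (Y l) v \<and> (\<forall>k. enat k \<le> kstop r l \<longrightarrow>
      gap v (u l k) \<le> \<gamma> * a l k \<and> a l k \<le> \<kappa> * \<gamma> * gap v (u l k)))"

lemma gal:
  assumes "R l"
  shows "solves_in D (Y l) (gal l)"
    and "enat k \<le> kstop r l \<Longrightarrow> gap (gal l) (u l k) \<le> \<gamma> * a l k"
    and "enat k \<le> kstop r l \<Longrightarrow> a l k \<le> \<kappa> * \<gamma> * gap (gal l) (u l k)"
  using someI_ex[OF level_facts(3)[OF assms], folded gal_def] by blast+

lemma gal_Y: "R l \<Longrightarrow> gal l \<in> Y l"
  using gal(1) by (simp add: solves_in_def)

lemma gal_V: "R l \<Longrightarrow> gal l \<in> V"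
  using gal_Y X_V by blast

lemma g_nonneg: "g l k \<ge> 0"
  by (simp add: est_def eta_nonneg)

lemma H_nonneg: "R l \<Longrightarrow> enat k \<le> kstop r l \<Longrightarrow> H l k \<ge> 0"
  using g_nonneg[of l k] level_facts(1)[of l k] by (simp add: quasi_error_def)

lemma R_0: "R 0"
  by (simp add: reached_def)

text \<open>The quasi-error is nonnegative and \<open>\<tau> < 0\<close>, so the tolerance test
  never succeeds: a level finishes exactly if its solver stops.\<close>

lemma R_Suc_iff: "R (Suc l) \<longleftrightarrow> R l \<and> kstop r l \<noteq> \<infinity>"
proof -
  have "level_finishes D \<tau> r l \<longleftrightarrow> kstop r l \<noteq> \<infinity>" if "R l"
  proof (cases "kstop r l")
    case (enat k)
    then have "H l k \<ge> 0" using H_nonneg[OF that, of k] by simp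
    then have "\<not> H l k \<le> \<tau>" using pars(4) by simp
    with enat show ?thesis by (simp add: level_finishes_def)
  qed (simp add: level_finishes_def)
  moreover have "R (Suc l) \<longleftrightarrow> R l \<and> level_finishes D \<tau> r l"
    unfolding reached_def less_Suc_eq by blast
  ultimately show ?thesis by blast
qed

lemma R_iff: "R l \<longleftrightarrow> (\<forall>j<l. kstop r j \<noteq> \<infinity>)"
  by (induction l) (auto simp: R_0 R_Suc_iff less_Suc_eq simp del: not_infinity_eq)

abbreviation "kf l \<equiv> the_enat (kstop r l)"

text \<open>Meaningful for completed levels only, that is, for \<open>R (Suc l)\<close>.\<close>

definition h :: "nat \<Rightarrow> real" where
  "h l = H l (kf l)"

lemma kf: "R (Suc l) \<Longrightarrow> kstop r l = enat (kf l)"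
  using R_Suc_iff by auto

lemma stop_criterion: "R (Suc l) \<Longrightarrow> a l (kf l) \<le> lam r l * g l (kf l)"
proof -
  assume l: "R (Suc l)"
  have "R l" using R_SucD[OF l] by simp
  from solve[OF this] kf[OF l] show ?thesis unfolding solve_level_def by blast
qed

lemma h_nonneg: "R (Suc l) \<Longrightarrow> h l \<ge> 0"
  using H_nonneg[of l "kf l"] kf[of l] R_Suc_iff[of l] by (simp add: h_def)

section \<open>Decay of the quasi-error within a level\<close>

definition "\<rho>p = root kmax qp"

lemma qp: "0 < qp" "qp < 1"
  using level_facts(4,5)[OF R_0] by auto

lemma \<rho>p: "0 < \<rho>p" "\<rho>p < 1"
  using qp pars(3) by (auto simp: \<rho>p_def)

text \<open>\<open>(1 + 1 / \<mu>) / qp\<close> is the constant before the last step. The last step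
  adds \<open>1 + 2 * \<gamma> * Cst\<close> from stability of the estimator,
  \<open>1 + 1 / qp\<close> from the two residuals involved, and \<open>1 / \<rho>p\<close> for the
  missing step in the exponent.\<close>

definition "CA \<mu> = (1 + 2 * \<gamma> * Cst) * (1 + 1 / qp) * ((1 + 1 / \<mu>) / qp) / \<rho>p"

lemma CA_ge: "\<mu> > 0 \<Longrightarrow> CA \<mu> \<ge> (1 + 1 / \<mu>) / qp \<and> CA \<mu> \<ge> 1"
proof -
  assume \<mu>: "\<mu> > 0"
  let ?c = "(1 + 1 / \<mu>) / qp"
  have q1: "1 \<le> 1 / qp" using qp by simp
  have "1 * 1 \<le> (1 + 1 / \<mu>) * (1 / qp)" using \<mu> q1 by (intro mult_mono) auto
  then have c: "?c \<ge> 1" by simp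
  have "1 * 1 \<le> (1 + 2 * \<gamma> * Cst) * (1 + 1 / qp)"
    using \<gamma>_ge Cst_pos q1 qp by (intro mult_mono) auto
  then have "1 * ?c \<le> (1 + 2 * \<gamma> * Cst) * (1 + 1 / qp) * ?c" using c by (intro mult_right_mono) auto
  moreover have "(1 + 2 * \<gamma> * Cst) * (1 + 1 / qp) * ?c \<le> CA \<mu>"
  proof -
    have "y \<le> y / \<rho>p" if "y \<ge> 0" for y
      using \<rho>p that by (simp add: pos_le_divide_eq mult_left_le)
    moreover have "0 \<le> (1 + 2 * \<gamma> * Cst) * (1 + 1 / qp) * ?c"
      using \<open>1 * ?c \<le> (1 + 2 * \<gamma> * Cst) * (1 + 1 / qp) * ?c\<close> c by linarith
    ultimately show ?thesis unfolding CA_def by blast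
  qed
  ultimately show ?thesis using c by linarith
qed

text \<open>While the stopping test fails, the residual dominates the estimator and GMRES contracts
  it. At the final step the test holds and this argument breaks down; stability then compares with
  the step before. The lower bound \<mu> of \<open>lam\<close> makes the constant independent of the
  level.\<close>

lemma inner:
  assumes l: "R l" and \<mu>: "0 < \<mu>" "\<mu> \<le> lam r l" and jk: "j \<le> k" "enat k \<le> kstop r l"
  shows "H l k \<le> CA \<mu> * \<rho>p ^ (k - j) * H l j"
proof -
  let ?C = "(1 + 1 / \<mu>) / qp"
  note CA = CA_ge[OF \<mu>(1)]
  have le: "enat i \<le> kstop r l" if "i \<le> k" for i using jk(2) that by (meson enat_ord_simps(1) order_trans)
  have a0: "a l i \<ge> 0" if "i \<le> k" for i by (rule level_facts(1)[OF l le[OF that]])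
  have aH: "a l i \<le> H l i" for i using g_nonneg by (simp add: quasi_error_def)
  have H0: "H l i \<ge> 0" if "i \<le> k" for i by (rule H_nonneg[OF l le[OF that]])
  have adecay: "a l i \<le> 1 / qp * \<rho>p ^ (i - j) * a l j" if "j \<le> i" "i \<le> k" for i j
    unfolding \<rho>p_def by (rule level_facts(2)[OF l that(1) le[OF that(2)]])
  \<comment> \<open>\<open>j < i\<close> entails \<open>i \<ge> 1\<close>: the stopping test is not
    performed at the initial iterate.\<close>
  have main: "H l i \<le> ?C * \<rho>p ^ (i - j) * H l j" if i: "i \<le> k" "j < i" "enat i < kstop r l" for i
  proof -
    have "\<not> a l i \<le> lam r l * g l i" using solve[OF l] i unfolding solve_level_def by auto
    then have "lam r l * g l i < a l i" by simp
    moreover have "\<mu> * g l i \<le> lam r l * g l i" using \<mu>(2) g_nonneg by (intro mult_right_mono)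
    ultimately have "g l i \<le> a l i / \<mu>" using \<mu>(1) by (simp add: pos_le_divide_eq mult.commute)
    then have "H l i \<le> (1 + 1 / \<mu>) * a l i" by (simp add: quasi_error_def distrib_right)
    also have "\<dots> \<le> (1 + 1 / \<mu>) * (1 / qp * \<rho>p ^ (i - j) * a l j)"
      using \<mu>(1) i by (intro mult_left_mono adecay) auto
    also have "\<dots> \<le> (1 + 1 / \<mu>) * (1 / qp * \<rho>p ^ (i - j) * H l j)"
      using \<mu>(1) qp \<rho>p by (intro mult_left_mono aH) auto
    finally show ?thesis by (simp add: mult_ac)
  qed
  show ?thesis
  proof (cases "j = k")
    case True
    then show ?thesis using mult_right_mono[of 1 "CA \<mu>" "H l k"] CA H0[of k] by simp
  next
    case False
    then have jk': "j < k" using jk by simp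
    show ?thesis
    proof (cases "enat k < kstop r l")
      case True
      have "H l k \<le> ?C * (\<rho>p ^ (k - j) * H l j)" using main[OF order_refl jk' True] by (simp add: mult.assoc)
      also have "\<dots> \<le> CA \<mu> * (\<rho>p ^ (k - j) * H l j)"
        using CA \<rho>p H0[of j] jk by (intro mult_right_mono) auto
      finally show ?thesis by (simp add: mult.assoc)
    next
      case last: False
      obtain i where i: "k = Suc i" using jk' by (cases k) auto
      have ik: "i \<le> k" "j \<le> i" "enat i < kstop r l"
      proof -
        show "i \<le> k" "j \<le> i" using i jk' by auto
        have "enat i < enat k" using i by simp
        then show "enat i < kstop r l" using jk(2) by (rule less_le_trans)
      qed
      have ai: "a l k \<le> 1 / qp * a l i"
      proof -
        have "a l k \<le> 1 / qp * (\<rho>p * a l i)" using adecay[of i k] ik i by simp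
        also have "\<dots> \<le> 1 / qp * (1 * a l i)"
          using qp \<rho>p a0[OF ik(1)] by (intro mult_left_mono mult_right_mono) auto
        finally show ?thesis by simp
      qed
      \<comment> \<open>Stability on the fixed mesh, with the distance between the two iterates
        split at the Galerkin solution.\<close>
      have "g l k \<le> g l i + Cst * gap (u l k) (u l i)"
        using eta_lipschitz[OF mesh_nvb[OF l] u_Y[OF l] u_Y[OF l], of k i] by (simp add: est_def)
      also have "gap (u l k) (u l i) \<le> 2 * (gap (u l k) (gal l) + gap (gal l) (u l i))"
        by (intro N_diff_le u_V gal_V l)
      also have "gap (u l k) (gal l) = gap (gal l) (u l k)"
        by (intro N_minus_commute u_V gal_V l)
      also have "2 * (gap (gal l) (u l k) + gap (gal l) (u l i)) \<le> 2 * (\<gamma> * a l k + \<gamma> * a l i)"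
        by (intro mult_left_mono add_mono gal(2)[OF l] le ik(1)) auto
      finally have "g l k \<le> g l i + Cst * (2 * (\<gamma> * a l k + \<gamma> * a l i))"
        using Cst_pos by simp
      then have "H l k \<le> g l i + (1 + 2 * \<gamma> * Cst) * (a l k + a l i)"
        using a0[OF ik(1)] by (simp add: quasi_error_def algebra_simps)
      also have "\<dots> \<le> g l i + (1 + 2 * \<gamma> * Cst) * ((1 + 1 / qp) * a l i)"
        using \<gamma>_ge Cst_pos ai by (intro add_left_mono mult_left_mono) (auto simp: distrib_right)
      also have "\<dots> \<le> (1 + 2 * \<gamma> * Cst) * (1 + 1 / qp) * H l i"
      proof -
        have "1 * 1 \<le> (1 + 2 * \<gamma> * Cst) * (1 + 1 / qp)"
          using \<gamma>_ge Cst_pos qp by (intro mult_mono) auto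
        then have "1 * g l i \<le> (1 + 2 * \<gamma> * Cst) * (1 + 1 / qp) * g l i"
          using g_nonneg by (intro mult_right_mono) auto
        moreover have "x + K1 * (K2 * y) \<le> K1 * K2 * (x + y)" if "1 * x \<le> K1 * K2 * x" for x y K1 K2 :: real
          using that by (simp add: distrib_left mult.assoc)
        ultimately show ?thesis unfolding quasi_error_def by blast
      qed
      also have "\<dots> \<le> (1 + 2 * \<gamma> * Cst) * (1 + 1 / qp) * (?C * \<rho>p ^ (i - j) * H l j)"
      proof (intro mult_left_mono)
        show "H l i \<le> ?C * \<rho>p ^ (i - j) * H l j"
        proof (cases "j = i")
          case True
          have "1 * 1 \<le> (1 + 1 / \<mu>) * (1 / qp)" using \<mu> qp by (intro mult_mono) auto
          then show ?thesis using True mult_right_mono[of 1 ?C "H l i"] H0[OF ik(1)] by simp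
        next
          case False
          then show ?thesis using ik by (intro main) auto
        qed
      qed (use \<gamma>_ge Cst_pos qp in auto)
      also have "\<dots> = CA \<mu> * \<rho>p ^ (k - j) * H l j"
      proof -
        have "\<rho>p ^ (k - j) = \<rho>p * \<rho>p ^ (i - j)" using ik(2) by (simp add: i Suc_diff_le)
        then show ?thesis using \<rho>p by (simp add: CA_def)
      qed
      finally show ?thesis .
    qed
  qed
qed

section \<open>From one level to the next\<close>

definition "Cr = Cbnd * Crel / sqrt Cell"

lemma Cr_pos: "Cr > 0"
  using rel(1) Cell_pos Cbnd_ge by (simp add: Cr_def)

text \<open>Reliability concerns the estimator of the Galerkin solution; stability moves it to any
  iterate at the price of the residual.\<close>

lemma gal_diff_le:
  assumes l: "R l" and jl: "j \<le> l" and k: "enat k \<le> kstop r j"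
  shows "gap (gal l) (gal j) \<le> Cr * (g j k + Cst * (\<gamma> * a j k))"
proof -
  have j: "R j" using R_mono[OF l jl] .
  have "eta D (mesh r j) (mesh r j) (gal j) \<le> g j k + Cst * gap (gal j) (u j k)"
    using eta_lipschitz[OF mesh_nvb[OF j] gal_Y[OF j] u_Y[OF j], of k] by (simp add: est_def)
  also have "\<dots> \<le> g j k + Cst * (\<gamma> * a j k)"
    using Cst_pos by (intro add_left_mono mult_left_mono gal(2)[OF j k]) auto
  finally have "Cr * eta D (mesh r j) (mesh r j) (gal j) \<le> Cr * (g j k + Cst * (\<gamma> * a j k))"
    using Cr_pos by (intro mult_left_mono) auto
  moreover have "gap (gal l) (gal j) \<le> Cr * eta D (mesh r j) (mesh r j) (gal j)"
    unfolding Cr_def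
    by (rule galerkin_diff_le_eta[OF mesh_nvb[OF j] mesh_mono[OF l jl] gal(1)[OF j] gal(1)[OF l]])
  ultimately show ?thesis by linarith
qed

definition "qt = sqrt (1 - (1 - qred\<^sup>2) * \<theta>)"

lemma qt: "0 < qt" "qt < 1"
proof -
  have q: "0 < qred\<^sup>2" "qred\<^sup>2 < 1" using red by (auto simp: power_less_one_iff)
  have "(1 - qred\<^sup>2) * \<theta> \<le> (1 - qred\<^sup>2) * 1" using q \<theta> by (intro mult_left_mono) auto
  also have "\<dots> < 1" using q by simp
  finally have "(1 - qred\<^sup>2) * \<theta> < 1" .
  moreover have "0 < (1 - qred\<^sup>2) * \<theta>" using q \<theta> by simp
  ultimately show "0 < qt" "qt < 1" by (auto simp: qt_def)
qed

lemma est_refined_le: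
  assumes l: "R (Suc l)"
  shows "g (Suc l) 0 \<le> qt * g l (kf l)"
proof -
  have l': "R l" using R_SucD[OF l] by simp
  note m = mesh_Suc[OF l]
  show ?thesis
    using eta_refine_le[OF mesh_nvb[OF l'] u_Y[OF l'] m(3) \<theta> m(5)[unfolded est_def]]
    unfolding est_def m(2) m(4) qt_def .
qed

definition "CB = 1 + 2 * \<kappa> * \<gamma> * (Cr * (1 + Cst * \<gamma>) + \<gamma>)"

lemma \<kappa>\<gamma>_nonneg: "0 \<le> \<kappa> * \<gamma>"
  using \<kappa>_ge_1 \<gamma>_ge by (intro mult_nonneg_nonneg) linarith+

text \<open>The estimator of the inherited iterate does not grow under refinement. Its new residual
  is bounded by a multiple of its distance from \<open>gal (Suc l)\<close>, which is split at
  \<open>gal l\<close>.\<close>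

lemma nested:
  assumes l: "R (Suc l)"
  shows "H (Suc l) 0 \<le> CB * h l"
proof -
  have l': "R l" using R_SucD[OF l] by simp
  have k: "enat (kf l) \<le> kstop r l" using kf[OF l] by simp
  have a0: "a l (kf l) \<ge> 0" by (rule level_facts(1)[OF l' k])
  have ah: "a l (kf l) \<le> h l" and gh: "g l (kf l) \<le> h l"
    using g_nonneg a0 by (auto simp: h_def quasi_error_def)
  have "g (Suc l) 0 \<le> qt * g l (kf l)" by (rule est_refined_le[OF l])
  also have "\<dots> \<le> g l (kf l)" using qt g_nonneg by (intro mult_left_le_one_le) auto
  finally have 1: "g (Suc l) 0 \<le> h l" using gh by linarith
  have "a (Suc l) 0 \<le> \<kappa> * \<gamma> * gap (gal (Suc l)) (u (Suc l) 0)"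
    by (rule gal(3)[OF l]) (simp add: zero_enat_def[symmetric])
  also have "\<dots> = \<kappa> * \<gamma> * gap (gal (Suc l)) (u l (kf l))" unfolding mesh_Suc(4)[OF l] ..
  also have "\<dots> \<le> \<kappa> * \<gamma> * (2 * (gap (gal (Suc l)) (gal l) + gap (gal l) (u l (kf l))))"
    by (intro mult_left_mono N_diff_le gal_V u_V l l' \<kappa>\<gamma>_nonneg)
  also have "\<dots> \<le> \<kappa> * \<gamma> * (2 * (Cr * (g l (kf l) + Cst * (\<gamma> * a l (kf l))) + \<gamma> * a l (kf l)))"
    by (intro mult_left_mono add_mono gal_diff_le gal(2) l l' k \<kappa>\<gamma>_nonneg) simp_all
  also have "\<dots> \<le> \<kappa> * \<gamma> * (2 * (Cr * (h l + Cst * (\<gamma> * h l)) + \<gamma> * h l))"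
    using \<gamma>_ge Cr_pos Cst_pos by (intro mult_left_mono add_mono gh ah \<kappa>\<gamma>_nonneg) simp_all
  finally show ?thesis using 1 by (simp add: quasi_error_def CB_def algebra_simps)
qed

lemma lam_pos: "R l \<Longrightarrow> lam r l > 0"
proof (induction l)
  case 0
  then show ?case using run pars by (simp add: afem_pgmres_def)
next
  case (Suc l)
  then show ?case using update[of l] R_SucD[of l] by (auto simp: update_params_def Let_def)
qed

text \<open>The constant depends on the level, through \<open>lam\<close> among others; it is used
  only to bridge finitely many levels.\<close>

lemma h_step:
  assumes "R (Suc (Suc l))"
  shows "\<exists>c. h (Suc l) \<le> c * h l"
proof -
  have l: "R (Suc l)" using R_SucD[OF assms] by simp
  let ?c = "CA (lam r (Suc l)) * \<rho>p ^ kf (Suc l)"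
  have "h (Suc l) \<le> ?c * H (Suc l) 0"
    unfolding h_def using inner[OF l lam_pos[OF l] order_refl, of 0 "kf (Suc l)"] kf[OF assms] by simp
  also have "\<dots> \<le> ?c * (CB * h l)"
    using CA_ge[OF lam_pos[OF l]] \<rho>p by (intro mult_left_mono nested l) auto
  finally show ?thesis by (auto simp: mult.assoc[symmetric])
qed


text \<open>The estimators of the final iterates satisfy the recursion of
  \<open>estimator_decay\<close> with the Galerkin solutions as \<open>u\<close>: the stopping test
  bounds the algebraic errors by a multiple of the estimator that is small enough to be
  absorbed.\<close>

lemma small_lam_decay:
  assumes all: "\<And>l. R l" and small: "\<And>l. l0 \<le> l \<Longrightarrow> lam r l \<le> (1 - qt) / (16 * Cst * \<gamma>)"
  shows "\<exists>\<rho> C. 0 < \<rho> \<and> \<rho> < 1 \<and> C \<ge> 1 \<and> (\<forall>j l. l0 \<le> j \<longrightarrow> j \<le> l \<longrightarrow> h l \<le> C * \<rho> ^ (l - j) * h j)"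
proof -
  define \<mu> where "\<mu> = (1 - qt) / (16 * Cst * \<gamma>)"
  \<comment> \<open>\<open>e\<close> equals \<open>Cst * (\<gamma> * \<mu>)\<close>. The 16 in the
    threshold ensures \<open>(qt + 4 * e) / (1 - 2 * e) \<le> (1 + qt) / 2\<close>.\<close>
  define e where "e = (1 - qt) / 16"
  have e: "e > 0" "e \<le> 1 / 16" using qt by (auto simp: e_def)
  have \<mu>0: "\<mu> > 0" using qt Cst_pos \<gamma>_ge by (simp add: \<mu>_def)
  have \<mu>: "Cst * (\<gamma> * \<mu>) = e" using Cst_pos \<gamma>_ge by (simp add: \<mu>_def e_def)
  define g' where "g' = (\<lambda>l. g l (kf l))"
  have k: "enat (kf l) \<le> kstop r l" for l using kf[OF all] by simp
  have g'0: "g' l \<ge> 0" for l by (simp add: g'_def g_nonneg)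
  have a\<mu>: "a l (kf l) \<le> \<mu> * g' l" if "l0 \<le> l" for l
  proof -
    have "a l (kf l) \<le> lam r l * g' l" unfolding g'_def by (rule stop_criterion[OF all])
    also have "\<dots> \<le> \<mu> * g' l" unfolding \<mu>_def using small[OF that] g'0 by (intro mult_right_mono)
    finally show ?thesis .
  qed
  have ga: "\<gamma> * a l (kf l) \<le> \<gamma> * \<mu> * g' l" if "l0 \<le> l" for l
    using mult_left_mono[OF a\<mu>[OF that], of \<gamma>] \<gamma>_ge by (simp add: mult.assoc)
  define d where "d = (\<lambda>l. gap (gal (Suc l)) (gal l))"
  have d0: "d l \<ge> 0" for l unfolding d_def by (intro N_nonneg V_diff gal_V all)
  \<comment> \<open>Consecutive final iterates are compared through \<open>gal (Suc l)\<close> and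
    \<open>gal l\<close>. The algebraic error on the new level is a multiple of
    \<open>g' (Suc l)\<close> and moves to the left-hand side.\<close>
  have step: "g' (Suc l) \<le> (1 + qt) / 2 * g' l + 8 * Cst * d l" if "l0 \<le> l" for l
  proof -
    let ?u = "\<lambda>l. u l (kf l)"
    have "g' (Suc l) \<le> g (Suc l) 0 + Cst * gap (?u (Suc l)) (u (Suc l) 0)"
      using eta_lipschitz[OF mesh_nvb[OF all] u_Y[OF all] u_Y[OF all], of "Suc l" "kf (Suc l)" 0]
      by (simp add: g'_def est_def)
    also have "gap (?u (Suc l)) (u (Suc l) 0) = gap (?u (Suc l)) (?u l)"
      unfolding mesh_Suc(4)[OF all] ..
    also have "gap (?u (Suc l)) (?u l)
        \<le> 2 * (gap (?u (Suc l)) (gal (Suc l)) + gap (gal (Suc l)) (?u l))"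
      by (intro N_diff_le u_V gal_V all)
    also have "gap (?u (Suc l)) (gal (Suc l)) = gap (gal (Suc l)) (?u (Suc l))"
      by (intro N_minus_commute u_V gal_V all)
    finally have 1: "g' (Suc l) \<le> g (Suc l) 0
        + Cst * (2 * (gap (gal (Suc l)) (?u (Suc l)) + gap (gal (Suc l)) (?u l)))"
      using Cst_pos by simp
    have "gap (gal (Suc l)) (?u l) \<le> 2 * (d l + gap (gal l) (?u l))"
      unfolding d_def by (intro N_diff_le u_V gal_V all)
    moreover have "gap (gal l) (?u l) \<le> \<gamma> * \<mu> * g' l"
      using gal(2)[OF all k, of l] ga[OF that] by (rule order_trans)
    ultimately have n1: "gap (gal (Suc l)) (?u l) \<le> 2 * (d l + \<gamma> * \<mu> * g' l)" by argo
    have n2: "gap (gal (Suc l)) (?u (Suc l)) \<le> \<gamma> * \<mu> * g' (Suc l)"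
      using gal(2)[OF all k, of "Suc l"] ga[of "Suc l"] that by simp
    have "Cst * (2 * (gap (gal (Suc l)) (?u (Suc l)) + gap (gal (Suc l)) (?u l)))
        \<le> Cst * (2 * (\<gamma> * \<mu> * g' (Suc l) + 2 * (d l + \<gamma> * \<mu> * g' l)))"
      using Cst_pos by (intro mult_left_mono add_mono n1 n2) auto
    also have "\<dots> = 2 * (Cst * (\<gamma> * \<mu>)) * g' (Suc l) + 4 * Cst * d l + 4 * (Cst * (\<gamma> * \<mu>)) * g' l"
      by (simp add: algebra_simps)
    finally have "g' (Suc l) \<le> qt * g' l + (2 * e * g' (Suc l) + 4 * Cst * d l + 4 * e * g' l)"
      using 1 est_refined_le[OF all, of l] unfolding \<mu> g'_def[symmetric] by (simp add: g'_def)
    then have "(1 - 2 * e) * g' (Suc l) \<le> (qt + 4 * e) * g' l + 4 * Cst * d l"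
      by (simp add: algebra_simps)
    also have "\<dots> \<le> ((1 - 2 * e) * ((1 + qt) / 2)) * g' l + ((1 - 2 * e) * (8 * Cst)) * d l"
    proof (intro add_mono mult_right_mono g'0 d0)
      have "e * (1 + qt) \<le> e * 2" using e qt by (intro mult_left_mono) auto
      moreover have "qt + 4 * e \<le> (1 + qt) / 2 - e * 2"
      proof -
        have "16 * e = 1 - qt" by (simp add: e_def)
        then show ?thesis using e(1) by argo
      qed
      moreover have "(1 - 2 * e) * ((1 + qt) / 2) = (1 + qt) / 2 - e * (1 + qt)" by (simp add: left_diff_distrib)
      ultimately show "qt + 4 * e \<le> (1 - 2 * e) * ((1 + qt) / 2)" by argo
      have "1 / 2 * (8 * Cst) \<le> (1 - 2 * e) * (8 * Cst)" using e Cst_pos by (intro mult_right_mono) auto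
      then show "4 * Cst \<le> (1 - 2 * e) * (8 * Cst)" by simp
    qed
    also have "\<dots> = (1 - 2 * e) * ((1 + qt) / 2 * g' l + 8 * Cst * d l)"
      by (simp add: distrib_left mult.assoc)
    finally show ?thesis using e by (simp add: mult_le_cancel_left)
  qed
  have "\<exists>\<rho> C. 0 < \<rho> \<and> \<rho> < 1 \<and> C \<ge> 1 \<and> (\<forall>j k. j \<le> k \<longrightarrow> g' (l0 + k) \<le> C * \<rho> ^ (k - j) * g' (l0 + j))"
  proof (rule estimator_decay[where X="\<lambda>k. Y (l0 + k)" and u="\<lambda>k. gal (l0 + k)" and q="(1 + qt) / 2"
        and c="8 * Cst" and C="2 * Cr"])
    show "Y (l0 + k) \<subseteq> V" for k by (rule X_V)
    show "Y (l0 + k) \<subseteq> Y (l0 + Suc k)" for k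
      using fe_space_nvb_refinement[OF mesh_Suc(1)[OF all] nvb_refinements_conforming[OF mesh_nvb[OF all]], of D p "l0 + k"]
      by simp
    show "(\<lambda>x. v x - w x) \<in> Y (l0 + k)" if "v \<in> Y (l0 + k)" "w \<in> Y (l0 + k)" for k v w
      by (rule X_diff[OF that])
    show "gal (l0 + k) \<in> Y (l0 + k)" for k by (rule gal_Y[OF all])
    show "b (\<lambda>x. gal (l0 + Suc k) x - gal (l0 + k) x) v = 0" if v: "v \<in> Y (l0 + k)" for k v
    proof -
      have v': "v \<in> Y (l0 + Suc k)"
        using fe_space_nvb_refinement[OF mesh_Suc(1)[OF all] nvb_refinements_conforming[OF mesh_nvb[OF all]], of D p "l0 + k"] v
        by auto
      have "b (gal (l0 + Suc k)) v = rhs D v" "b (gal (l0 + k)) v = rhs D v"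
        using gal(1)[OF all, of "l0 + Suc k"] gal(1)[OF all, of "l0 + k"] v v' by (auto simp: solves_in_def)
      then show ?thesis using v X_V by (subst b_diff_left) (auto intro: gal_V all)
    qed
    show "\<exists>w\<in>Y (l0 + k). \<forall>v\<in>Y (l0 + k). b v w = b v z" if "z \<in> V" for k z
      by (rule level_facts(6)[OF all that])
    show "g' (l0 + k) \<ge> 0" for k by (rule g'0)
    show "0 < (1 + qt) / 2" "(1 + qt) / 2 < 1" using qt by auto
    show "8 * Cst > 0" "2 * Cr > 0" using Cst_pos Cr_pos by auto
    show "g' (l0 + Suc k) \<le> (1 + qt) / 2 * g' (l0 + k) + 8 * Cst * gap (gal (l0 + Suc k)) (gal (l0 + k))" for k
      using step[of "l0 + k"] by (simp add: d_def)
    show "gap (gal (l0 + k)) (gal (l0 + j)) \<le> 2 * Cr * g' (l0 + j)" if "j \<le> k" for j k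
    proof -
      let ?l = "l0 + j"
      have "gap (gal (l0 + k)) (gal ?l) \<le> Cr * (g' ?l + Cst * (\<gamma> * a ?l (kf ?l)))"
        unfolding g'_def using that by (intro gal_diff_le all k) simp
      also have "\<dots> \<le> Cr * (g' ?l + Cst * (\<gamma> * \<mu> * g' ?l))"
        using Cr_pos Cst_pos by (intro mult_left_mono add_left_mono ga) auto
      also have "Cst * (\<gamma> * \<mu> * g' ?l) = e * g' ?l" by (simp add: \<mu>[symmetric] mult.assoc)
      also have "Cr * (g' ?l + e * g' ?l) \<le> Cr * (g' ?l + 1 * g' ?l)"
        using e Cr_pos g'0 by (intro mult_left_mono add_left_mono mult_right_mono) auto
      finally show ?thesis by simp
    qed
  qed
  then obtain \<rho> C where \<rho>: "0 < \<rho>" "\<rho> < 1" "C \<ge> 1"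
    and dec: "\<And>j k. j \<le> k \<Longrightarrow> g' (l0 + k) \<le> C * \<rho> ^ (k - j) * g' (l0 + j)" by blast
  have hg: "g' l \<le> h l" for l
    using level_facts(1)[OF all k, of l] by (simp add: h_def g'_def quasi_error_def)
  have gh: "h l \<le> (1 + \<mu>) * g' l" if "l0 \<le> l" for l
    using a\<mu>[OF that] by (simp add: h_def g'_def quasi_error_def distrib_right)
  have "h l \<le> (1 + \<mu>) * C * \<rho> ^ (l - j) * h j" if jl: "l0 \<le> j" "j \<le> l" for j l
  proof -
    have "h l \<le> (1 + \<mu>) * g' l" using jl by (intro gh) simp
    also have "\<dots> \<le> (1 + \<mu>) * (C * \<rho> ^ (l - j) * g' j)"
      using dec[of "j - l0" "l - l0"] jl \<mu>0 by (intro mult_left_mono) auto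
    also have "\<dots> \<le> (1 + \<mu>) * (C * \<rho> ^ (l - j) * h j)"
      using \<rho> \<mu>0 by (intro mult_left_mono hg) auto
    finally show ?thesis by (simp add: mult.assoc)
  qed
  moreover have "1 * 1 \<le> (1 + \<mu>) * C" using \<mu>0 \<rho> by (intro mult_mono) auto
  ultimately show ?thesis using \<rho> by (intro exI[of _ \<rho>] exI[of _ "(1 + \<mu>) * C"]) auto
qed

section \<open>Finiteness of the number of adaptations\<close>

definition adapt :: "nat \<Rightarrow> bool" where
  "adapt l \<longleftrightarrow> l \<ge> 1 \<and> inv_sum r l > ennreal (calg r l) * inverse (ennreal (h l))"

text \<open>Each adaptation doubles \<open>calg\<close> and halves \<open>lam\<close>, so the number
  of past adaptations determines both.\<close>

definition adaptations :: "nat \<Rightarrow> nat" where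
  "adaptations l = card {j. j < l \<and> adapt j}"

lemma update_eqs:
  assumes "R (Suc l)"
  shows "calg r (Suc l) = (if adapt l then 2 * calg r l else calg r l)"
    "lam r (Suc l) = (if adapt l then lam r l / 2 else lam r l)"
    "inv_sum r (Suc l) = inv_sum r l + inverse (ennreal (h l))"
  using update[OF assms] by (simp_all add: update_params_def Let_def adapt_def h_def)

lemma adaptations_Suc: "adaptations (Suc l) = (if adapt l then Suc (adaptations l) else adaptations l)"
proof -
  have "{j. j < Suc l \<and> adapt j} = (if adapt l then insert l {j. j < l \<and> adapt j} else {j. j < l \<and> adapt j})"
    by (auto simp: less_Suc_eq)
  then show ?thesis by (simp add: adaptations_def)
qed

lemma adaptations_mono: "j \<le> l \<Longrightarrow> adaptations j \<le> adaptations l"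
  by (rule lift_Suc_mono_le[of adaptations]) (simp_all add: adaptations_Suc)

lemma calg_lam:
  assumes "R l"
  shows "calg r l = Calg * 2 ^ adaptations l \<and> lam r l = lamalg / 2 ^ adaptations l"
  using assms
proof (induction l)
  case 0
  then show ?case using run by (simp add: afem_pgmres_def adaptations_def)
next
  case (Suc l)
  then show ?case using R_SucD[of l] update_eqs[OF Suc.prems] by (simp add: adaptations_Suc)
qed

lemma inv_sum_eq:
  assumes "\<And>l. R l"
  shows "inv_sum r l = (\<Sum>j<l. inverse (ennreal (h j)))"
proof (induction l)
  case 0
  then show ?case using run by (simp add: afem_pgmres_def)
next
  case (Suc l)
  then show ?case using update_eqs(3)[OF assms] by simp
qed

lemma eventually_no_adaptation:
  assumes all: "\<And>l. R l"
  shows "\<exists>l0. \<forall>l\<ge>l0. \<not> adapt l"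
proof (rule ccontr)
  assume "\<not> ?thesis"
  then have inf: "\<exists>l\<ge>l0. adapt l" for l0 by blast
  have unbounded: "\<exists>l. adaptations l \<ge> n" for n
  proof (induction n)
    case (Suc n)
    then obtain l where l: "adaptations l \<ge> n" by blast
    obtain m where m: "m \<ge> l" "adapt m" using inf by blast
    have "adaptations (Suc m) \<ge> Suc n" using adaptations_mono[OF m(1)] l m(2) by (simp add: adaptations_Suc)
    then show ?case by blast
  qed simp
  have large: "\<exists>l0. \<forall>l\<ge>l0. 2 ^ adaptations l \<ge> x" for x :: real
  proof -
    obtain n where n: "x < 2 ^ n" using real_arch_pow[of 2 x] by auto
    obtain l0 where l0: "adaptations l0 \<ge> n" using unbounded by blast
    have "2 ^ adaptations l \<ge> x" if "l \<ge> l0" for l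
    proof -
      have "(2::real) ^ n \<le> 2 ^ adaptations l"
        using adaptations_mono[OF that] l0 by (intro power_increasing) auto
      with n show ?thesis by linarith
    qed
    then show ?thesis by blast
  qed
  define \<mu> where "\<mu> = (1 - qt) / (16 * Cst * \<gamma>)"
  have \<mu>: "\<mu> > 0" using qt Cst_pos \<gamma>_ge by (simp add: \<mu>_def)
  obtain l0 where l0: "\<And>l. l \<ge> l0 \<Longrightarrow> 2 ^ adaptations l \<ge> lamalg / \<mu>" using large by blast
  have "lam r l \<le> \<mu>" if "l0 \<le> l" for l
  proof -
    have "lamalg \<le> \<mu> * 2 ^ adaptations l"
      using l0[OF that] unfolding pos_divide_le_eq[OF \<mu>] by (simp add: mult.commute)
    then show ?thesis using calg_lam[OF all, of l] by (simp add: pos_divide_le_eq)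
  qed
  then obtain \<rho> C0 where \<rho>: "0 < \<rho>" "\<rho> < 1"
    and dec0: "\<And>j l. l0 \<le> j \<Longrightarrow> j \<le> l \<Longrightarrow> h l \<le> C0 * \<rho> ^ (l - j) * h j"
    using small_lam_decay[OF all, of l0] unfolding \<mu>_def by blast
  \<comment> \<open>\<open>inv_sum\<close> also contains the levels before \<open>lam\<close> became
    small, so the decay must hold from level 0 on, with a larger but fixed constant.\<close>
  obtain C where C: "C \<ge> 1" and dec: "\<And>j l. j \<le> l \<Longrightarrow> h l \<le> C * \<rho> ^ (l - j) * h j"
    using decay_extend[OF h_nonneg[OF all] h_step[OF all] \<rho>(1) dec0] by blast
  have S: "inv_sum r l \<le> ennreal (C / (1 - \<rho>)) * inverse (ennreal (h l))" for l
  proof -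
    have "inv_sum r l \<le> (\<Sum>j<l. ennreal (C * \<rho> ^ (l - j)) * inverse (ennreal (h l)))"
      unfolding inv_sum_eq[OF all]
    proof (rule sum_mono)
      fix j assume "j \<in> {..<l}"
      then show "inverse (ennreal (h j)) \<le> ennreal (C * \<rho> ^ (l - j)) * inverse (ennreal (h l))"
        using C \<rho> dec[of j l] h_nonneg[OF all] by (intro ennreal_inverse_le) auto
    qed
    also have "\<dots> = (\<Sum>j<l. ennreal (C * \<rho> ^ (l - j))) * inverse (ennreal (h l))"
      by (simp add: sum_distrib_right)
    also have "(\<Sum>j<l. ennreal (C * \<rho> ^ (l - j))) = ennreal (\<Sum>j<l. C * \<rho> ^ (l - j))"
      using C \<rho> by (intro sum_ennreal) auto
    also have "\<dots> * inverse (ennreal (h l)) \<le> ennreal (C / (1 - \<rho>)) * inverse (ennreal (h l))"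
    proof (intro mult_right_mono ennreal_leI)
      have "(\<Sum>j<l. C * \<rho> ^ (l - j)) = (\<Sum>i<l. C * \<rho> ^ Suc i)"
        by (rule sum.reindex_bij_witness[of _ "\<lambda>i. l - Suc i" "\<lambda>j. l - Suc j"]) (auto simp: Suc_diff_Suc)
      also have "\<dots> = C * (\<rho> * (\<Sum>i<l. \<rho> ^ i))" by (simp add: sum_distrib_left)
      also have "\<dots> \<le> C * (1 * (1 / (1 - \<rho>)))"
        using C \<rho> by (intro mult_left_mono mult_mono geometric_sum_le sum_nonneg) auto
      finally show "(\<Sum>j<l. C * \<rho> ^ (l - j)) \<le> C / (1 - \<rho>)" by simp
    qed simp
    finally show ?thesis .
  qed
  obtain l1 where l1: "\<And>l. l \<ge> l1 \<Longrightarrow> 2 ^ adaptations l \<ge> C / (1 - \<rho>) / Calg" using large by blast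
  obtain l where l: "l \<ge> l1" "adapt l" using inf by blast
  \<comment> \<open>Once \<open>calg\<close> has outgrown the fixed constant of \<open>S\<close>,
    the inequality behind \<open>adapt l\<close> cannot hold.\<close>
  have "C / (1 - \<rho>) \<le> calg r l"
    using l1[OF l(1)] calg_lam[OF all, of l] unfolding pos_divide_le_eq[OF pars(1)] by (simp add: mult.commute)
  then have "ennreal (C / (1 - \<rho>)) * inverse (ennreal (h l)) \<le> ennreal (calg r l) * inverse (ennreal (h l))"
    by (intro mult_right_mono ennreal_leI) auto
  with S[of l] have "inv_sum r l \<le> ennreal (calg r l) * inverse (ennreal (h l))" by (rule order_trans)
  moreover have "\<not> inv_sum r l \<le> ennreal (calg r l) * inverse (ennreal (h l))"
    using l(2) unfolding adapt_def not_le by blast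
  ultimately show False by blast
qed


section \<open>Bounds uniform in the level\<close>

text \<open>With infinitely many levels \<open>lam\<close> is halved only finitely often; with
  finitely many levels the minimum exists.\<close>

lemma lam_bounded_below: "\<exists>\<mu>>0. \<forall>l. R l \<longrightarrow> \<mu> \<le> lam r l"
proof (cases "\<forall>l. R l")
  case True
  then have all: "\<And>l. R l" by blast
  obtain l0 where l0: "\<And>l. l \<ge> l0 \<Longrightarrow> \<not> adapt l" using eventually_no_adaptation[OF all] by blast
  have const: "adaptations (l0 + i) = adaptations l0" for i
    by (induction i) (simp_all add: adaptations_Suc l0)
  have le: "adaptations l \<le> adaptations l0" for l
    using adaptations_mono[of l "l0 + l"] const[of l] by simp
  have "lamalg / 2 ^ adaptations l0 \<le> lam r l" for l
  proof -
    have "lamalg / 2 ^ adaptations l0 \<le> lamalg / 2 ^ adaptations l"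
      using pars(2) le by (intro divide_left_mono power_increasing) auto
    then show ?thesis using calg_lam[OF all, of l] by simp
  qed
  moreover have "lamalg / 2 ^ adaptations l0 > 0" using pars(2) by simp
  ultimately show ?thesis by blast
next
  case False
  then obtain L where L: "\<not> R L" by blast
  have fin: "finite {l. R l}"
  proof (rule finite_subset[of _ "{..L}"])
    have "l \<le> L" if "R l" for l
      using R_mono[OF that, of L] L by (cases "l \<le> L") auto
    then show "{l. R l} \<subseteq> {..L}" by auto
  qed simp
  have ne: "{l. R l} \<noteq> {}" using R_0 by blast
  have "Min (lam r ` {l. R l}) > 0" using fin ne lam_pos by (subst Min_gr_iff) auto
  moreover have "Min (lam r ` {l. R l}) \<le> lam r l" if "R l" for l using fin that by (intro Min_le) auto
  ultimately show ?thesis by blast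
qed

lemma outer:
  "\<exists>\<rho> C. 0 < \<rho> \<and> \<rho> < 1 \<and> C \<ge> 1 \<and> (\<forall>j l. R (Suc l) \<longrightarrow> j \<le> l \<longrightarrow> h l \<le> C * \<rho> ^ (l - j) * h j)"
proof (cases "\<forall>l. R l")
  case True
  then have all: "\<And>l. R l" by blast
  obtain l0 where l0: "\<And>l. l \<ge> l0 \<Longrightarrow> \<not> adapt l" using eventually_no_adaptation[OF all] by blast
  \<comment> \<open>\<open>Suc l0\<close> rather than \<open>l0\<close>: level 0 is exempt from
    adaptation, so \<open>\<not> adapt l\<close> yields the bound on \<open>inv_sum\<close> only for
    \<open>l \<ge> 1\<close>.\<close>
  have const: "calg r (Suc l0 + i) = calg r (Suc l0)" for i
    by (induction i) (simp_all add: update_eqs(1)[OF all] l0)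
  define K where "K = calg r (Suc l0)"
  have K: "K > 0" using calg_lam[OF all, of "Suc l0"] pars(1) by (simp add: K_def)
  have dom: "inv_sum r l \<le> ennreal K * inverse (ennreal (h l))" if "Suc l0 \<le> l" for l
  proof -
    have "calg r l = K" using const[of "l - Suc l0"] that by (simp add: K_def)
    then show ?thesis using l0[of l] that by (simp add: adapt_def not_less)
  qed
  have dec: "h l \<le> (K + 1) * (K / (K + 1)) ^ (l - j) * h j" if "Suc l0 \<le> j" "j \<le> l" for j l
    by (rule decay_of_inverse_sum[where h=h and S="inv_sum r", OF h_nonneg[OF all] K update_eqs(3)[OF all] dom that])
  have \<rho>: "0 < K / (K + 1)" "K / (K + 1) < 1" using K by auto
  obtain C where "C \<ge> 1" "\<forall>j l. j \<le> l \<longrightarrow> h l \<le> C * (K / (K + 1)) ^ (l - j) * h j"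
    using decay_extend[where h=h, OF h_nonneg[OF all] h_step[OF all] \<rho>(1) dec] by blast
  with \<rho> show ?thesis by (intro exI[of _ "K / (K + 1)"] exI[of _ C]) simp
next
  case False
  then obtain L where L: "\<not> R L" by blast
  \<comment> \<open>Only levels below \<open>L\<close> are completed. With 0 elsewhere the decay
    holds trivially from \<open>L\<close> on, with constant 0, and is pulled back to level 0; the
    rate 1/2 is arbitrary.\<close>
  define h' where "h' = (\<lambda>l. if R (Suc l) then h l else 0)"
  have "\<exists>C\<ge>1. \<forall>j l. j \<le> l \<longrightarrow> h' l \<le> C * (1 / 2) ^ (l - j) * h' j"
  proof (rule decay_extend[where h=h' and i=L and C=0])
    show "h' l \<ge> 0" for l using h_nonneg[of l] by (simp add: h'_def)
    show "\<exists>c. h' (Suc l) \<le> c * h' l" for l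
    proof (cases "R (Suc (Suc l))")
      case True
      then show ?thesis using h_step[OF True] R_SucD[OF True] by (simp add: h'_def)
    next
      case False
      then show ?thesis by (intro exI[of _ 0]) (simp add: h'_def)
    qed
    show "h' l \<le> 0 * (1 / 2) ^ (l - j) * h' j" if "L \<le> j" "j \<le> l" for j l
    proof -
      have "\<not> R (Suc l)" using L R_mono[of "Suc l" L] that by auto
      then show ?thesis by (simp add: h'_def)
    qed
  qed simp
  then obtain C where C: "C \<ge> 1" "\<And>j l. j \<le> l \<Longrightarrow> h' l \<le> C * (1 / 2) ^ (l - j) * h' j" by blast
  have "h l \<le> C * (1 / 2) ^ (l - j) * h j" if "R (Suc l)" "j \<le> l" for j l
    using C(2)[OF that(2)] that R_mono[of "Suc l" "Suc j"] by (simp add: h'_def)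
  then show ?thesis using C(1) by (intro exI[of _ "1 / 2"] exI[of _ C]) auto
qed

section \<open>Combination along the index set\<close>

lemma full_linear_convergence:
  "\<exists>q c. 0 < q \<and> q < 1 \<and> 0 < c \<and>
    (\<forall>l' k' l k. (l', k') \<in> index_set D \<tau> r \<and> (l, k) \<in> index_set D \<tau> r \<and>
       step_count D \<tau> r l' k' \<le> step_count D \<tau> r l k \<longrightarrow>
       H l k \<le> c * q ^ (step_count D \<tau> r l k - step_count D \<tau> r l' k') * H l' k')"
proof -
  interpret I: level_indices "kstop r" "index_set D \<tau> r"
    by unfold_locales (simp only: index_set_def R_iff)
  have count: "I.count l k = step_count D \<tau> r l k" for l k
    by (simp add: I.count_def step_count_def)
  have Q: "R l" "enat k \<le> kstop r l" if "(l, k) \<in> index_set D \<tau> r" for l k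
    using that by (auto simp: index_set_def)
  obtain \<mu> where \<mu>: "\<mu> > 0" "\<And>l. R l \<Longrightarrow> \<mu> \<le> lam r l" using lam_bounded_below by blast
  obtain \<rho> C where \<rho>: "0 < \<rho>" "\<rho> < 1" "C \<ge> 1"
    and out: "\<And>j l. R (Suc l) \<Longrightarrow> j \<le> l \<Longrightarrow> h l \<le> C * \<rho> ^ (l - j) * h j"
    using outer by blast
  \<comment> \<open>The decay within levels, the transition between levels and the decay over levels
    come with different constants and rates; the maxima serve all of them.\<close>
  define C' where "C' = max (CA \<mu>) (max CB C)"
  define \<rho>' where "\<rho>' = max \<rho> \<rho>p"
  have weaken: "c * s ^ n * x \<le> C' * \<rho>' ^ n * x"
    if "0 \<le> s" "s \<le> \<rho>'" "c \<le> C'" "0 \<le> x" for c s n x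
  proof (intro mult_right_mono that)
    have "c * s ^ n \<le> C' * s ^ n" using that by (intro mult_right_mono) auto
    also have "\<dots> \<le> C' * \<rho>' ^ n"
      using that \<rho> by (intro mult_left_mono power_mono) (auto simp: C'_def)
    finally show "c * s ^ n \<le> C' * \<rho>' ^ n" .
  qed
  have "\<exists>q c. 0 < q \<and> q < 1 \<and> 0 < c \<and> (\<forall>l' k' l k. (l', k') \<in> index_set D \<tau> r \<and> (l, k) \<in> index_set D \<tau> r \<and>
      I.count l' k' \<le> I.count l k \<longrightarrow> H l k \<le> c * q ^ (I.count l k - I.count l' k') * H l' k')"
  proof (rule I.linear_convergence[where C=C' and \<rho>=\<rho>'])
    show "H l k \<ge> 0" if "(l, k) \<in> index_set D \<tau> r" for l k
      using H_nonneg Q[OF that] by blast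
    show "1 \<le> C'" "0 < \<rho>'" "\<rho>' < 1" using \<rho> \<rho>p by (auto simp: C'_def \<rho>'_def)
    show "H l k \<le> C' * \<rho>' ^ (k - j) * H l j" if lk: "(l, k) \<in> index_set D \<tau> r" and jk: "j \<le> k" for l j k
    proof -
      note R = Q[OF lk]
      have j: "enat j \<le> kstop r l" using jk R(2) by (meson enat_ord_simps(1) order_trans)
      have "H l k \<le> CA \<mu> * \<rho>p ^ (k - j) * H l j" by (rule inner[OF R(1) \<mu>(1) \<mu>(2)[OF R(1)] jk R(2)])
      also have "\<dots> \<le> C' * \<rho>' ^ (k - j) * H l j"
        using \<rho>p H_nonneg[OF R(1) j] by (intro weaken) (auto simp: C'_def \<rho>'_def)
      finally show ?thesis .
    qed
    show "H (Suc l) 0 \<le> C' * H l m" if l: "(Suc l, 0) \<in> index_set D \<tau> r" and m: "kstop r l = enat m" for l m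
    proof -
      have R: "R (Suc l)" using Q[OF l] by simp
      have "H (Suc l) 0 \<le> CB * h l" by (rule nested[OF R])
      also have "\<dots> \<le> C' * h l" using h_nonneg[OF R] by (intro mult_right_mono) (auto simp: C'_def)
      finally show ?thesis by (simp add: h_def m)
    qed
    show "H l m \<le> C' * \<rho>' ^ (l - j) * H j m'"
      if l: "(Suc l, 0) \<in> index_set D \<tau> r" and jl: "j \<le> l" and m: "kstop r l = enat m" "kstop r j = enat m'"
      for j l m m'
    proof -
      have R: "R (Suc l)" using Q[OF l] by simp
      have Rj: "R (Suc j)" using R_mono[OF R] jl by simp
      have "h l \<le> C * \<rho> ^ (l - j) * h j" by (rule out[OF R jl])
      also have "\<dots> \<le> C' * \<rho>' ^ (l - j) * h j"
        using \<rho> h_nonneg[OF Rj] by (intro weaken) (auto simp: C'_def \<rho>'_def)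
      finally show ?thesis by (simp add: h_def m)
    qed
  qed
  then show ?thesis unfolding count .
qed

end

theorem theorem20:
  fixes D :: "'n::finite pde" and \<T>0 :: "'n tmesh" and ustar u00 :: "real^'n \<Rightarrow> real"
    and r :: "'n afem_run" and p kmax :: nat
    and Cell Cbnd Cstab qred Crel Cpre \<theta> Cmark Calg lamalg \<tau> :: real
  assumes "model_problem D"
    and "bounded_elliptic D Cell Cbnd"
    and "solves_in D (H10 (dom D)) ustar"
    and "triangulates \<T>0 (dom D)" and "nvb_admissible \<T>0"
    and "piecewise_regular D \<T>0"
    and "p \<ge> 1"
    and "Cstab > 0" and "stability D p \<T>0 Cstab"
    and "0 < qred" and "qred < 1" and "reduction D p \<T>0 qred"
    and "Crel > 0" and "reliability D p \<T>0 ustar Crel"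
    and "0 < \<theta>" and "\<theta> \<le> 1" and "Cmark \<ge> 1" and "u00 \<in> fe_space D p \<T>0"
    and "Calg > 0" and "lamalg > 0" and "kmax \<ge> 1" and "\<tau> < 0"
    and "afem_pgmres D p \<T>0 \<theta> Cmark u00 Calg lamalg kmax \<tau> r"
    and "Cpre \<ge> 1" and "norm_equivalence D \<tau> r Cpre"
  shows "\<exists>qlin Clin. 0 < qlin \<and> qlin < 1 \<and> 0 < Clin \<and>
    (\<forall>l' k' l k. (l', k') \<in> index_set D \<tau> r \<and> (l, k) \<in> index_set D \<tau> r \<and>
       step_count D \<tau> r l' k' \<le> step_count D \<tau> r l k \<longrightarrow>
       quasi_error D r l k
         \<le> Clin * qlin ^ (step_count D \<tau> r l k - step_count D \<tau> r l' k') * quasi_error D r l' k')"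
proof -
  interpret afem D Cell Cbnd p \<T>0 ustar Cstab qred Crel \<theta> Cmark u00 Calg lamalg kmax \<tau> r Cpre
    by unfold_locales (fact assms)+
  show ?thesis by (rule full_linear_convergence)
qed

end
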